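(* Let $1\le r<\infty$ and $\ell\in\mathbb{R}$, and put $$v_\ell(x,\omega)=(1+x^2+\omega^2)^{\ell/2},\qquad w_\ell(x,\omega)=\big[1+(c^2+d^2)x^2+(a^2+b^2)\omega^2-2(ac+bd)x\omega\big]^{\ell/2}.$$ If $f\in M^r_{v_\ell}$, then $\mathcal{F}_Af\in M^r_{w_\ell}$.
   Context: $A=\{a,b,c,d,p,q\}$ are real parameters with $ad-bc=1$ and $b\neq0$. The special affine Fourier transform is $\mathcal{F}_Af(\omega)=\frac{1}{\sqrt{|b|}}\int_{\mathbb{R}}f(t)e^{\frac{\pi i}{b}(at^2+2pt-2\omega t+2(bq-dp)\omega+d\omega^2)}\,dt$ for $f\in L^1(\mathbb{R})$. It equals $C_{d/b}M_{(bq-dp)/b}D_b\mathcal{F}C_{a/b}M_{p/b}$, where $C_sf(t)=e^{\pi i s t^2}f(t)$, $M_sf(t)=e^{2\pi i st}f(t)$, $D_sf(t)=|s|^{-1/2}f(t/s)$ and $\mathcal{F}f(\xi)=\int_{\mathbb{R}} f(t)e^{-2\pi i\xi t}dt$; through this formula it extends to tempered distributions $S'(\mathbb{R})$. For a weight $m$ and a fixed nonzero $g\in S(\mathbb{R})$, $M^r_m$ is the space of $f\in S'(\mathbb{R})$ with $\int_{\mathbb{R}}\int_{\mathbb{R}}|V_gf(x,\omega)|^rm(x,\omega)^r\,dx\,d\omega<\infty$, where $V_gf(x,\omega)=\int_{\mathbb{R}}f(t)\overline{g(t-x)}e^{-2\pi i\omega t}\,dt$ (duality pairing for distributions); different nonzero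 Schwartz windows give the same space with equivalent norms. *)

theory Defs
  imports "HOL-Analysis.Analysis"
begin

section \<open>Schwartz functions and tempered distributions on the real line\<close>

definition nderiv :: "nat \<Rightarrow> (real \<Rightarrow> complex) \<Rightarrow> real \<Rightarrow> complex" where
  "nderiv n = (\<lambda>\<phi> t. vector_derivative \<phi> (at t)) ^^ n"

definition schwartz :: "(real \<Rightarrow> complex) set" where
  "schwartz = {\<phi>. (\<forall>n t. nderiv n \<phi> differentiable at t) \<and>
                  (\<forall>k n. bounded (range (\<lambda>t. t ^ k *\<^sub>R nderiv n \<phi> t)))}"

definition schwartz_seminorm :: "nat \<Rightarrow> nat \<Rightarrow> (real \<Rightarrow> complex) \<Rightarrow> real" where
  "schwartz_seminorm k n \<phi> = (SUP t. norm (t ^ k *\<^sub>R nderiv n \<phi> t))"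

text \<open>
  A tempered distribution is a complex-linear functional on Schwartz functions, continuous for the
  topology of the seminorms above. It is represented by a function on all of
  \<^typ>\<open>real \<Rightarrow> complex\<close> whose values outside \<^const>\<open>schwartz\<close> are irrelevant. The pairing is bilinear:
  a function \<open>f\<close> corresponds to \<open>\<phi> \<mapsto> \<integral> f(t) \<phi>(t) dt\<close>, without conjugation.
\<close>

type_synonym functional = "(real \<Rightarrow> complex) \<Rightarrow> complex"

definition tempered :: "functional set" where
  "tempered = {T.
     (\<forall>\<phi>\<in>schwartz. \<forall>\<psi>\<in>schwartz. T (\<lambda>t. \<phi> t + \<psi> t) = T \<phi> + T \<psi>) \<and>
     (\<forall>\<phi>\<in>schwartz. \<forall>z. T (\<lambda>t. z * \<phi> t) = z * T \<phi>) \<and>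
     (\<exists>C N. \<forall>\<phi>\<in>schwartz. norm (T \<phi>) \<le> C * (\<Sum>k\<le>N. \<Sum>n\<le>N. schwartz_seminorm k n \<phi>))}"

section \<open>Elementary operators on functions\<close>

definition chirp :: "real \<Rightarrow> (real \<Rightarrow> complex) \<Rightarrow> real \<Rightarrow> complex" where
  "chirp s f t = exp (\<i> * of_real (pi * s * t\<^sup>2)) * f t"

definition modulate :: "real \<Rightarrow> (real \<Rightarrow> complex) \<Rightarrow> real \<Rightarrow> complex" where
  "modulate s f t = exp (\<i> * of_real (2 * pi * s * t)) * f t"

definition dilate :: "real \<Rightarrow> (real \<Rightarrow> complex) \<Rightarrow> real \<Rightarrow> complex" where
  "dilate s f t = of_real (\<bar>s\<bar> powr (-1/2)) * f (t / s)"

definition fourier :: "(real \<Rightarrow> complex) \<Rightarrow> real \<Rightarrow> complex" where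
  "fourier f \<xi> = (\<integral>t. f t * exp (- (\<i> * of_real (2 * pi * \<xi> * t))) \<partial>lborel)"

definition saft_fun ::
  "real \<Rightarrow> real \<Rightarrow> real \<Rightarrow> real \<Rightarrow> real \<Rightarrow> real \<Rightarrow> (real \<Rightarrow> complex) \<Rightarrow> real \<Rightarrow> complex" where
  "saft_fun a b c d p q f \<omega> =
     of_real (1 / sqrt \<bar>b\<bar>) *
     (\<integral>t. f t * exp (\<i> * of_real (pi / b *
        (a * t\<^sup>2 + 2 * p * t - 2 * \<omega> * t + 2 * (b * q - d * p) * \<omega> + d * \<omega>\<^sup>2))) \<partial>lborel)"

text \<open>The factorisation through which the transform is extended to distributions below.\<close>

lemma saft_fun_factorisation:
  assumes "b \<noteq> 0"
  shows "saft_fun a b c d p q f =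
    chirp (d / b) (modulate ((b * q - d * p) / b) (dilate b
      (fourier (chirp (a / b) (modulate (p / b) f)))))"
proof
  fix \<omega>
  let ?u = "exp (\<i> * of_real (pi * (d / b) * \<omega>\<^sup>2)) *
            exp (\<i> * of_real (2 * pi * ((b * q - d * p) / b) * \<omega>))"
  let ?I = "\<integral>t. chirp (a / b) (modulate (p / b) f) t *
                 exp (- (\<i> * of_real (2 * pi * (\<omega> / b) * t))) \<partial>lborel"
  have pt: "f t * exp (\<i> * of_real (pi / b *
        (a * t\<^sup>2 + 2 * p * t - 2 * \<omega> * t + 2 * (b * q - d * p) * \<omega> + d * \<omega>\<^sup>2))) =
      ?u * (chirp (a / b) (modulate (p / b) f) t * exp (- (\<i> * of_real (2 * pi * (\<omega> / b) * t))))"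
    for t
  proof -
    let ?e = "\<lambda>x::real. exp (\<i> * of_real x) :: complex"
    have "pi / b * (a * t\<^sup>2 + 2 * p * t - 2 * \<omega> * t + 2 * (b * q - d * p) * \<omega> + d * \<omega>\<^sup>2) =
      pi * (d / b) * \<omega>\<^sup>2 + 2 * pi * ((b * q - d * p) / b) * \<omega> +
      (pi * (a / b) * t\<^sup>2 + 2 * pi * (p / b) * t + - (2 * pi * (\<omega> / b) * t))"
      using assms by (simp add: field_simps)

    then have "?e (pi / b * (a * t\<^sup>2 + 2 * p * t - 2 * \<omega> * t + 2 * (b * q - d * p) * \<omega> + d * \<omega>\<^sup>2)) =
      ?e (pi * (d / b) * \<omega>\<^sup>2) * ?e (2 * pi * ((b * q - d * p) / b) * \<omega>) *
      (?e (pi * (a / b) * t\<^sup>2) * ?e (2 * pi * (p / b) * t) * ?e (- (2 * pi * (\<omega> / b) * t)))"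
      by (simp only: of_real_add distrib_left exp_add)
    moreover have "- (\<i> * of_real x) = \<i> * complex_of_real (- x)" for x
      by simp
    ultimately show ?thesis
      unfolding chirp_def modulate_def by (simp only: mult.assoc mult.left_commute[of "f t"])
  qed
  have s: "1 / sqrt \<bar>b\<bar> = \<bar>b\<bar> powr (-1/2)"
    using powr_minus[of "\<bar>b\<bar>" "1/2"] by (simp only: powr_half_sqrt abs_ge_zero inverse_eq_divide minus_divide_left)
  have "saft_fun a b c d p q f \<omega> = of_real (\<bar>b\<bar> powr (-1/2)) * (?u * ?I)"
    by (simp only: saft_fun_def s pt integral_mult_right_zero)
  also have "\<dots> = chirp (d / b) (modulate ((b * q - d * p) / b) (dilate b
      (fourier (chirp (a / b) (modulate (p / b) f))))) \<omega>"
    unfolding chirp_def[of "d / b"] modulate_def[of "(b * q - d * p) / b"] dilate_def fourier_def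
    by (simp only: mult.assoc mult.left_commute[of "of_real (\<bar>b\<bar> powr (-1/2))"])
  finally show "saft_fun a b c d p q f \<omega> =
    chirp (d / b) (modulate ((b * q - d * p) / b) (dilate b
      (fourier (chirp (a / b) (modulate (p / b) f))))) \<omega>" .
qed

section \<open>The special affine Fourier transform on tempered distributions\<close>

text \<open>
  Each operator acts on distributions by transposition with respect to the bilinear pairing:
  \<open>chirp s\<close>, \<open>modulate s\<close> and \<open>fourier\<close> are their own transposes, and the substitution
  \<open>t = s u\<close> shows that the transpose of \<open>dilate s\<close> is \<open>dilate (1 / s)\<close>.
\<close>

definition chirp_dist :: "real \<Rightarrow> functional \<Rightarrow> functional" where
  "chirp_dist s T \<phi> = T (chirp s \<phi>)"

definition modulate_dist :: "real \<Rightarrow> functional \<Rightarrow> functional" where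
  "modulate_dist s T \<phi> = T (modulate s \<phi>)"

definition dilate_dist :: "real \<Rightarrow> functional \<Rightarrow> functional" where
  "dilate_dist s T \<phi> = T (dilate (1 / s) \<phi>)"

definition fourier_dist :: "functional \<Rightarrow> functional" where
  "fourier_dist T \<phi> = T (fourier \<phi>)"

definition saft ::
  "real \<Rightarrow> real \<Rightarrow> real \<Rightarrow> real \<Rightarrow> real \<Rightarrow> real \<Rightarrow> functional \<Rightarrow> functional" where
  "saft a b c d p q T =
     chirp_dist (d / b) (modulate_dist ((b * q - d * p) / b) (dilate_dist b
       (fourier_dist (chirp_dist (a / b) (modulate_dist (p / b) T)))))"

section \<open>Modulation spaces\<close>

definition stft :: "(real \<Rightarrow> complex) \<Rightarrow> functional \<Rightarrow> real \<Rightarrow> real \<Rightarrow> complex" where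
  "stft g T x \<omega> = T (\<lambda>t. cnj (g (t - x)) * exp (- (\<i> * of_real (2 * pi * \<omega> * t))))"

text \<open>The window \<open>g\<close> is an explicit parameter; it is meant to be a nonzero Schwartz function.\<close>

definition modulation_space ::
  "(real \<Rightarrow> complex) \<Rightarrow> real \<Rightarrow> (real \<Rightarrow> real \<Rightarrow> real) \<Rightarrow> functional set" where
  "modulation_space g r m = {T \<in> tempered.
     (\<integral>\<^sup>+ \<omega>. \<integral>\<^sup>+ x. ennreal (norm (stft g T x \<omega>) powr r * m x \<omega> powr r) \<partial>lborel \<partial>lborel) < \<infinity>}"

definition v_weight :: "real \<Rightarrow> real \<Rightarrow> real \<Rightarrow> real" where
  "v_weight l x \<omega> = (1 + x\<^sup>2 + \<omega>\<^sup>2) powr (l / 2)"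

definition w_weight ::
  "real \<Rightarrow> real \<Rightarrow> real \<Rightarrow> real \<Rightarrow> real \<Rightarrow> real \<Rightarrow> real \<Rightarrow> real" where
  "w_weight a b c d l x \<omega> =
     (1 + (c\<^sup>2 + d\<^sup>2) * x\<^sup>2 + (a\<^sup>2 + b\<^sup>2) * \<omega>\<^sup>2 - 2 * (a * c + b * d) * x * \<omega>) powr (l / 2)"

end

theory Submission
  imports Defs "HOL-Probability.Probability"
begin

text \<open>
  The transform intertwines time-frequency shifts: applying its transpose to the shift of a window
  \<open>g\<close> by \<open>(x, \<omega>)\<close> gives, up to a unimodular factor, the shift of another Schwartz window \<open>h\<close> by
  \<open>(d x - b \<omega> + x\<^sub>0, a \<omega> - c x + \<omega>\<^sub>0)\<close>. Hence
  \<open>\<bar>V\<^sub>g (F\<^sub>A f) (x, \<omega>)\<bar> = \<bar>V\<^sub>h f (d x - b \<omega> + x\<^sub>0, a \<omega> - c x + \<omega>\<^sub>0)\<bar>\<close>, and \<open>w\<^sub>l\<close> is \<open>v\<^sub>l\<close> composed with the linear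
  part of this area preserving map. What remains is to replace the window \<open>h\<close> by \<open>g\<close>. Partitioning
  \<open>\<phi>\<close> by the translates of \<open>\<bar>g\<bar>\<^sup>2\<close> and applying Fourier inversion to each piece gives
  \<open>\<parallel>g\<parallel>\<^sup>2 \<langle>f, \<phi>\<rangle> = \<integral>\<integral> V\<^sub>g f (x, \<omega>) F (g(\<cdot> - x) \<phi>) (-\<omega>) d\<omega> dx\<close>, so \<open>\<bar>V\<^sub>h f\<bar>\<close> is dominated by a convolution of
  \<open>\<bar>V\<^sub>g f\<bar>\<close> with a rapidly decreasing kernel, and the weighted Young inequality \<open>L\<^sup>r * L\<^sup>1 \<subseteq> L\<^sup>r\<close> applies.
\<close>

section \<open>Calculus of Schwartz functions\<close>

text \<open>A tempered distribution is only a linear functional with a seminorm estimate, so every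
  integral formula has to be carried past it by hand. The partition by translates and the inversion
  integral are each an integral of Schwartz functions over one real parameter, and one interchange
  result serves both; its hypothesis is that the family lies in \<open>schwartz2\<close>. Absolute
  values are taken only afterwards, when the integrals are nonnegative and joint measurability,
  obtained from separate continuity, suffices. The kernel comes from the Fourier transform of g(t -
  s) cnj (h t), which decays like any power of (1 + s^2)(1 + \<xi>^2). About |l|/2 of these powers
  pay for moving the weight from one point to another, and one further power leaves a Cauchy kernel
  of mass pi^2. The offsets \<open>x0\<close> and \<open>\<omega>0\<close> stem from p and q; by the
  same moderateness of the weight a fixed offset costs only a constant. Fourier inversion is derived
  by Gaussian regularisation from the characteristic function of the normal distribution.\<close>

lemma nderiv_0 [simp]: "nderiv 0 \<phi> = \<phi>"
  by (simp add: nderiv_def)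

lemma nderiv_Suc: "nderiv (Suc n) \<phi> t = vector_derivative (nderiv n \<phi>) (at t)"
  by (simp add: nderiv_def)

lemma nderiv_Suc': "nderiv (Suc n) \<phi> = nderiv n (\<lambda>t. vector_derivative \<phi> (at t))"
  unfolding nderiv_def funpow_Suc_right by simp

lemma has_vector_derivative_imp_fun_eq:
  "(\<And>t. (\<phi> has_vector_derivative \<psi> t) (at t)) \<Longrightarrow> (\<lambda>t. vector_derivative \<phi> (at t)) = \<psi>"
  by (intro ext vector_derivative_at)

text \<open>Iterating the two closure conditions keeps t^k times the n-th derivative inside the
  family, where boundedness is assumed. The index set \<open>P\<close> is kept apart from the
  functions \<open>U p\<close>, so that pairs can index sums and families can index their parameter
  integrals.\<close>

lemma schwartz_coinduct:
  assumes "p \<in> P"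
    and bd: "\<And>p. p \<in> P \<Longrightarrow> bounded (range (U p))"
    and mult: "\<And>p. p \<in> P \<Longrightarrow> \<exists>p'\<in>P. U p' = (\<lambda>t. t *\<^sub>R U p t)"
    and deriv: "\<And>p. p \<in> P \<Longrightarrow> \<exists>p'\<in>P. \<forall>t. (U p has_vector_derivative U p' t) (at t)"
  shows "U p \<in> schwartz"
proof -
  have n: "\<exists>p'\<in>P. nderiv n (U p) = U p'" for n
  proof (induction n)
    case (Suc n)
    then obtain p' where p': "p' \<in> P" "nderiv n (U p) = U p'"
      by blast
    with deriv obtain p'' where "p'' \<in> P" "\<forall>t. (U p' has_vector_derivative U p'' t) (at t)"
      by blast
    with p' show ?case
      using has_vector_derivative_imp_fun_eq[of "U p'" "U p''"] by (auto simp: nderiv_def)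
  qed (use \<open>p \<in> P\<close> in auto)
  have k: "\<exists>p'\<in>P. (\<lambda>t. t ^ k *\<^sub>R nderiv n (U p) t) = U p'" for k n
  proof (induction k)
    case (Suc k)
    then obtain p' where "p' \<in> P" "(\<lambda>t. t ^ k *\<^sub>R nderiv n (U p) t) = U p'"
      by blast
    moreover from this(2) have "(\<lambda>t. t ^ Suc k *\<^sub>R nderiv n (U p) t) = (\<lambda>t. t *\<^sub>R U p' t)"
      by (metis power_Suc scaleR_scaleR)
    ultimately show ?case using mult by metis
  qed (simp add: n)
  have "nderiv n (U p) differentiable at t" for n t
    using n[of n] deriv by (metis differentiableI_vector)
  moreover have "bounded (range (\<lambda>t. t ^ k *\<^sub>R nderiv n (U p) t))" for k n
    using k[of k n] bd by metis
  ultimately show ?thesis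
    unfolding schwartz_def by blast
qed

lemma nderiv_has_vector_derivative:
  assumes "\<phi> \<in> schwartz"
  shows "(nderiv n \<phi> has_vector_derivative nderiv (Suc n) \<phi> t) (at t)"
  using assms unfolding nderiv_Suc schwartz_def by (simp add: vector_derivative_works)

definition deriv1 :: "(real \<Rightarrow> complex) \<Rightarrow> real \<Rightarrow> complex" where
  "deriv1 \<phi> t = vector_derivative \<phi> (at t)"

lemma nderiv_Suc_deriv1: "nderiv (Suc n) \<phi> = nderiv n (deriv1 \<phi>)"
  unfolding nderiv_Suc' deriv1_def ..

lemma schwartz_deriv [simp]:
  "\<phi> \<in> schwartz \<Longrightarrow> deriv1 \<phi> \<in> schwartz"
  unfolding schwartz_def mem_Collect_eq nderiv_Suc_deriv1[symmetric] by blast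

lemma schwartz_has_deriv: 
  "\<phi> \<in> schwartz \<Longrightarrow> (\<phi> has_vector_derivative deriv1 \<phi> t) (at t)"
  using nderiv_has_vector_derivative[of \<phi> 0 t] by (simp add: nderiv_Suc deriv1_def)

lemma deriv1_eq: "(\<And>t. (\<phi> has_vector_derivative \<psi> t) (at t)) \<Longrightarrow> deriv1 \<phi> = \<psi>"
  unfolding deriv1_def by (rule has_vector_derivative_imp_fun_eq)

lemma schwartz_continuous: "\<phi> \<in> schwartz \<Longrightarrow> continuous_on A \<phi>"
  using has_vector_derivative_continuous[OF schwartz_has_deriv]
  by (blast intro: continuous_at_imp_continuous_on)

lemma schwartz_measurable: "\<phi> \<in> schwartz \<Longrightarrow> \<phi> \<in> borel_measurable borel"
  by (intro borel_measurable_continuous_onI schwartz_continuous)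

lemma schwartz_bounded: "\<phi> \<in> schwartz \<Longrightarrow> bounded (range (\<lambda>t. t ^ k *\<^sub>R nderiv n \<phi> t))"
  by (auto simp: schwartz_def)

lemma schwartz_bounded0: "\<phi> \<in> schwartz \<Longrightarrow> bounded (range \<phi>)"
  using schwartz_bounded[of \<phi> 0 0] by simp

text \<open>The commutator of the n-th derivative with multiplication by t is n times the derivative
  of order n - 1. For n = 0 the truncated subtraction is harmless, since the factor
  \<open>of_nat n\<close> vanishes.\<close>

lemma nderiv_mult:
  assumes "\<phi> \<in> schwartz"
  shows "nderiv n (\<lambda>t. t *\<^sub>R \<phi> t) = (\<lambda>t. t *\<^sub>R nderiv n \<phi> t + of_nat n * nderiv (n - 1) \<phi> t)"
proof (induction n)
  case (Suc n)
  have "((\<lambda>t. t *\<^sub>R nderiv n \<phi> t + of_nat n * nderiv (n - 1) \<phi> t) has_vector_derivative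
      t *\<^sub>R nderiv (Suc n) \<phi> t + of_nat (Suc n) * nderiv (Suc n - 1) \<phi> t) (at t)" for t
  proof (cases n)
    case 0
    then show ?thesis
      using nderiv_has_vector_derivative[OF assms, of 0]
      by (auto intro!: derivative_eq_intros)
  next
    case (Suc m)
    then show ?thesis
      using nderiv_has_vector_derivative[OF assms, of n] nderiv_has_vector_derivative[OF assms, of m]
      by (auto intro!: derivative_eq_intros has_vector_derivative_scaleR simp: algebra_simps)
  qed
  then show ?case
    unfolding nderiv_Suc Suc by (auto intro!: ext vector_derivative_at simp: nderiv_Suc)
qed simp

lemma schwartz_mult [simp]:
  assumes "\<phi> \<in> schwartz" shows "(\<lambda>t. t *\<^sub>R \<phi> t) \<in> schwartz"
proof -
  have "bounded (range (\<lambda>t. t ^ k *\<^sub>R (t *\<^sub>R nderiv n \<phi> t + of_nat n * nderiv (n - 1) \<phi> t)))" for k n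
  proof -
    have "bounded (range (\<lambda>t. t ^ Suc k *\<^sub>R nderiv n \<phi> t + of_nat n * (t ^ k *\<^sub>R nderiv (n - 1) \<phi> t)))"
    proof (rule bounded_plus_comp)
      show "bounded (range (\<lambda>t. of_nat n * (t ^ k *\<^sub>R nderiv (n - 1) \<phi> t)))"
        using bounded_linear_image[OF schwartz_bounded[OF assms] bounded_linear_mult_right, of "of_nat n" k "n - 1"]
        by (simp only: image_image)
    qed (rule schwartz_bounded[OF assms])
    then show ?thesis by (simp add: algebra_simps)
  qed
  moreover have "(\<lambda>t. t *\<^sub>R nderiv n \<phi> t + of_nat n * nderiv (n - 1) \<phi> t) differentiable at t" for n t
    using assms by (auto simp: schwartz_def)
  ultimately show ?thesis
    unfolding schwartz_def using nderiv_mult[OF assms] by auto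
qed

lemma schwartz_cmult [simp]:
  assumes "\<phi> \<in> schwartz" shows "(\<lambda>t. z * \<phi> t) \<in> schwartz"
  using assms
proof (rule schwartz_coinduct[where U = "\<lambda>\<phi> t. z * \<phi> t"], goal_cases)
  case (1 \<phi>)
  then show ?case 
    using bounded_linear_image[OF schwartz_bounded0 bounded_linear_mult_right, of \<phi> z]
    by (simp add: image_image)
next
  case (2 \<phi>)
  then show ?case
    by (intro bexI[of _ "\<lambda>t. t *\<^sub>R \<phi> t"]) auto
next
  case (3 \<phi>)
  then show ?case
    by (intro bexI[of _ "deriv1 \<phi>"] allI has_vector_derivative_mult_right schwartz_has_deriv) auto
qed

lemma schwartz_add [simp]:
  assumes "\<phi> \<in> schwartz" "\<psi> \<in> schwartz" shows "(\<lambda>t. \<phi> t + \<psi> t) \<in> schwartz"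
proof -
  have "(\<phi>, \<psi>) \<in> schwartz \<times> schwartz"
    using assms by simp
  then have "(\<lambda>t. fst (\<phi>, \<psi>) t + snd (\<phi>, \<psi>) t) \<in> schwartz"
  proof (rule schwartz_coinduct[where U = "\<lambda>p t. fst p t + snd p t"], goal_cases)
    case (1 p)
    then show ?case by (intro bounded_plus_comp schwartz_bounded0) auto
  next
    case (2 p)
    then show ?case
      by (intro bexI[of _ "(\<lambda>t. t *\<^sub>R fst p t, \<lambda>t. t *\<^sub>R snd p t)"]) (auto simp: scaleR_add_right)
  next
    case (3 p)
    then show ?case
      by (intro bexI[of _ "(deriv1 (fst p), deriv1 (snd p))"])
        (auto intro!: has_vector_derivative_add schwartz_has_deriv)
  qed
  then show ?thesis by simp
qed

lemma schwartz_diff [simp]: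
  assumes "\<phi> \<in> schwartz" "\<psi> \<in> schwartz" shows "(\<lambda>t. \<phi> t - \<psi> t) \<in> schwartz"
  using schwartz_add[OF assms(1) schwartz_cmult[OF assms(2), of "-1"]] by simp

lemma schwartz_cnj [simp]:
  assumes "\<phi> \<in> schwartz" shows "(\<lambda>t. cnj (\<phi> t)) \<in> schwartz"
  using assms
proof (rule schwartz_coinduct[where U = "\<lambda>\<phi> t. cnj (\<phi> t)"], goal_cases)
  case (1 \<phi>)
  then show ?case 
    using bounded_linear_image[OF schwartz_bounded0 bounded_linear_cnj, of \<phi>]
    by (simp add: image_image)
next
  case (2 \<phi>)
  then show ?case
    by (intro bexI[of _ "\<lambda>t. t *\<^sub>R \<phi> t"]) auto
next
  case (3 \<phi>)
  then show ?case
    by (intro bexI[of _ "deriv1 \<phi>"] allI has_vector_derivative_cnj schwartz_has_deriv) auto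
qed

section \<open>Differentiability from quadratic remainder estimates\<close>

lemma has_vector_derivative_quadratic:
  fixes F :: "real \<Rightarrow> 'a::real_normed_vector"
  assumes "\<And>y. norm (F y - F x - (y - x) *\<^sub>R D) \<le> K * (y - x)\<^sup>2"
  shows "(F has_vector_derivative D) (at x)"
  unfolding has_vector_derivative_def has_derivative_at_alt
proof (intro conjI allI impI bounded_linear_scaleR_left)
  fix e :: real
  assume "e > 0"
  \<comment> \<open>The 1 added to \<bar>K\<bar> keeps the radius well defined and positive when K =
    0.\<close>
  have "norm (F y - F x - (y - x) *\<^sub>R D) \<le> e * norm (y - x)" if "norm (y - x) < e / (\<bar>K\<bar> + 1)" for y
  proof -
    have "norm (F y - F x - (y - x) *\<^sub>R D) \<le> K * (y - x)\<^sup>2"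
      by (rule assms)
    also have "\<dots> \<le> ((\<bar>K\<bar> + 1) * \<bar>y - x\<bar>) * \<bar>y - x\<bar>"
      unfolding power2_abs[symmetric, of "y - x"] power2_eq_square[of "\<bar>y - x\<bar>"] mult.assoc
      by (intro mult_right_mono) auto
    also have "\<dots> \<le> e * \<bar>y - x\<bar>"
      using that by (intro mult_right_mono) (auto simp: field_simps)
    finally show ?thesis by simp
  qed
  then show "\<exists>d>0. \<forall>y. norm (y - x) < d \<longrightarrow> norm (F y - F x - (y - x) *\<^sub>R D) \<le> e * norm (y - x)"
    using \<open>e > 0\<close> by (intro exI[of _ "e / (\<bar>K\<bar> + 1)"]) auto
qed

lemma lipschitz_of_vector_derivative_bound:
  fixes f :: "real \<Rightarrow> 'a::real_normed_vector"
  assumes "\<And>u. u \<in> closed_segment x y \<Longrightarrow> (f has_vector_derivative f' u) (at u)"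
    and "\<And>u. u \<in> closed_segment x y \<Longrightarrow> norm (f' u) \<le> B"
  shows "norm (f y - f x) \<le> B * \<bar>y - x\<bar>"
proof -
  have "norm (f y - f x) \<le> B * norm (y - x)"
  proof (rule differentiable_bound[OF convex_closed_segment])
    show "(f has_derivative (\<lambda>h. h *\<^sub>R f' u)) (at u within closed_segment x y)"
      if "u \<in> closed_segment x y" for u
      using assms(1)[OF that] by (auto simp: has_vector_derivative_def intro: has_derivative_at_withinI)
    show "onorm (\<lambda>h. h *\<^sub>R f' u) \<le> B" if "u \<in> closed_segment x y" for u
      using assms(2)[OF that] norm_ge_zero[of "f' u"]
      by (intro onorm_bound) (linarith, simp add: mult.commute[of B] mult_left_mono)
  qed auto
  then show ?thesis by simp
qed

text \<open>Subtracting the tangent term leaves a function of u with derivative f'(u) - f'(x), which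
  the mean value inequality bounds by B |y - x| on the segment; a second use of that inequality
  gives the square. The constant is B instead of the sharp B/2, which is enough.\<close>

lemma taylor_bound_2:
  fixes f :: "real \<Rightarrow> 'a::real_normed_vector"
  assumes f: "\<And>u. (f has_vector_derivative f' u) (at u)"
    and f': "\<And>u. (f' has_vector_derivative f'' u) (at u)"
    and B: "\<And>u. norm (f'' u) \<le> B"
  shows "norm (f y - f x - (y - x) *\<^sub>R f' x) \<le> B * (y - x)\<^sup>2"
proof -
  have "B \<ge> 0" using B[of x] norm_ge_zero order_trans by blast
  have "norm ((f y - y *\<^sub>R f' x) - (f x - x *\<^sub>R f' x)) \<le> (B * \<bar>y - x\<bar>) * \<bar>y - x\<bar>"
  proof (rule lipschitz_of_vector_derivative_bound)
    show "((\<lambda>u. f u - u *\<^sub>R f' x) has_vector_derivative f' u - f' x) (at u)" for u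
      using f by (auto intro!: derivative_eq_intros)
    fix u assume u: "u \<in> closed_segment x y"
    have "norm (f' u - f' x) \<le> B * \<bar>u - x\<bar>"
      by (rule lipschitz_of_vector_derivative_bound[OF f' B])
    also have "\<dots> \<le> B * \<bar>y - x\<bar>"
      using u \<open>B \<ge> 0\<close> by (intro mult_left_mono) (auto simp: closed_segment_eq_real_ivl split: if_splits)
    finally show "norm (f' u - f' x) \<le> B * \<bar>y - x\<bar>" .
  qed
  then show ?thesis
    by (simp add: power2_eq_square algebra_simps abs_mult_self_eq)
qed

text \<open>The bound \<open>w\<close> on the second derivative is uniform in x and integrable in s,
  so the pointwise quadratic remainders integrate to a quadratic remainder.\<close>

lemma deriv_under_integral:
  fixes f :: "real \<Rightarrow> real \<Rightarrow> complex"
  assumes "\<And>x. integrable M (f x)" "\<And>x. integrable M (f' x)" "integrable M w"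
    and "\<And>x s. ((\<lambda>x. f x s) has_vector_derivative f' x s) (at x)"
    and "\<And>x s. ((\<lambda>x. f' x s) has_vector_derivative f'' x s) (at x)"
    and "\<And>x s. norm (f'' x s) \<le> w s"
  shows "((\<lambda>x. \<integral>s. f x s \<partial>M) has_vector_derivative (\<integral>s. f' x s \<partial>M)) (at x)"
proof (rule has_vector_derivative_quadratic)
  fix y
  have "(\<integral>s. f y s \<partial>M) - (\<integral>s. f x s \<partial>M) - (y - x) *\<^sub>R (\<integral>s. f' x s \<partial>M) =
      (\<integral>s. f y s - f x s - (y - x) *\<^sub>R f' x s \<partial>M)"
    using assms by simp
  also have "norm \<dots> \<le> (\<integral>s. w s * (y - x)\<^sup>2 \<partial>M)"
  proof (rule Bochner_Integration.integral_norm_bound_integral)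
    show "norm (f y s - f x s - (y - x) *\<^sub>R f' x s) \<le> w s * (y - x)\<^sup>2" for s
      using assms(4-6) by (rule taylor_bound_2)
  qed (use assms in auto)
  finally show "norm ((\<integral>s. f y s \<partial>M) - (\<integral>s. f x s \<partial>M) - (y - x) *\<^sub>R (\<integral>s. f' x s \<partial>M)) \<le> (\<integral>s. w s \<partial>M) * (y - x)\<^sup>2"
    by simp
qed

section \<open>Continuous operators on the Schwartz space\<close>

lemma norm_le_seminorm:
  assumes "\<phi> \<in> schwartz"
  shows "norm (t ^ k *\<^sub>R nderiv n \<phi> t) \<le> schwartz_seminorm k n \<phi>"
  unfolding schwartz_seminorm_def
  using schwartz_bounded[OF assms, of k n]
  by (intro cSUP_upper) (auto simp: bounded_iff bdd_above_def simp del: norm_scaleR)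

lemma norm_le_seminorm0: "\<phi> \<in> schwartz \<Longrightarrow> norm (\<phi> t) \<le> schwartz_seminorm 0 0 \<phi>"
  using norm_le_seminorm[of \<phi> t 0 0] by simp

lemma seminorm_le: "(\<And>t. norm (t ^ k *\<^sub>R nderiv n \<phi> t) \<le> B) \<Longrightarrow> schwartz_seminorm k n \<phi> \<le> B"
  unfolding schwartz_seminorm_def by (intro cSUP_least) auto

lemma seminorm_nonneg: "\<phi> \<in> schwartz \<Longrightarrow> 0 \<le> schwartz_seminorm k n \<phi>"
  using norm_le_seminorm norm_ge_zero order_trans by blast

text \<open>Continuity at zero in the same form as in \<open>tempered\<close>. The constant is
  required to be nonnegative so that bounds with different N can be enlarged to a common N and
  added.\<close>

definition dominated :: "((real \<Rightarrow> complex) \<Rightarrow> real) \<Rightarrow> bool" where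
  "dominated q \<longleftrightarrow> (\<exists>C N. 0 \<le> C \<and>
     (\<forall>\<phi>\<in>schwartz. q \<phi> \<le> C * (\<Sum>k\<le>N. \<Sum>n\<le>N. schwartz_seminorm k n \<phi>)))"

lemma seminorm_sum_mono:
  fixes N N' :: nat
  assumes "\<phi> \<in> schwartz" "N \<le> N'"
  shows "(\<Sum>k\<le>N. \<Sum>n\<le>N. schwartz_seminorm k n \<phi>) \<le> (\<Sum>k\<le>N'. \<Sum>n\<le>N'. schwartz_seminorm k n \<phi>)"
proof -
  have "(\<Sum>k\<le>N. \<Sum>n\<le>N. schwartz_seminorm k n \<phi>) \<le> (\<Sum>k\<le>N. \<Sum>n\<le>N'. schwartz_seminorm k n \<phi>)"
    using assms by (intro sum_mono sum_mono2) (auto intro: seminorm_nonneg)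
  also have "\<dots> \<le> (\<Sum>k\<le>N'. \<Sum>n\<le>N'. schwartz_seminorm k n \<phi>)"
    using assms by (intro sum_mono2) (auto intro!: sum_nonneg seminorm_nonneg)
  finally show ?thesis .
qed

lemma dominated_mono:
  assumes "dominated q" "\<And>\<phi>. \<phi> \<in> schwartz \<Longrightarrow> q' \<phi> \<le> q \<phi>"
  shows "dominated q'"
  using assms unfolding dominated_def by (meson order_trans)

lemma dominated_seminorm: "dominated (schwartz_seminorm k n)"
proof -
  define N where "N = max k n"
  have "schwartz_seminorm k n \<phi> \<le> 1 * (\<Sum>k\<le>N. \<Sum>n\<le>N. schwartz_seminorm k n \<phi>)"
    if \<phi>: "\<phi> \<in> schwartz" for \<phi>
  proof -
    have "schwartz_seminorm k n \<phi> \<le> (\<Sum>n\<le>N. schwartz_seminorm k n \<phi>)"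
      using \<phi> by (intro member_le_sum[where f = "\<lambda>n. schwartz_seminorm k n \<phi>"])
        (auto simp: N_def intro: seminorm_nonneg)
    also have "\<dots> \<le> (\<Sum>k\<le>N. \<Sum>n\<le>N. schwartz_seminorm k n \<phi>)"
      using \<phi> by (intro member_le_sum[where f = "\<lambda>k. \<Sum>n\<le>N. schwartz_seminorm k n \<phi>"])
        (auto simp: N_def intro!: seminorm_nonneg sum_nonneg)
    finally show ?thesis by simp
  qed
  then show ?thesis
    unfolding dominated_def by (intro exI[of _ 1] exI[of _ N]) auto
qed

lemma dominated_zero: "dominated (\<lambda>\<phi>. 0)"
  unfolding dominated_def by (intro exI[of _ 0]) auto

lemma dominated_cmult:
  assumes "dominated q" "0 \<le> c"
  shows "dominated (\<lambda>\<phi>. c * q \<phi>)"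
proof -
  obtain C N where C: "0 \<le> C"
    "\<And>\<phi>. \<phi> \<in> schwartz \<Longrightarrow> q \<phi> \<le> C * (\<Sum>k\<le>N. \<Sum>n\<le>N. schwartz_seminorm k n \<phi>)"
    using assms by (auto simp: dominated_def)
  then show ?thesis
    unfolding dominated_def using assms(2)
    by (intro exI[of _ "c * C"] exI[of _ N]) (auto simp: mult.assoc intro: mult_left_mono)
qed

lemma dominated_add:
  assumes "dominated q" "dominated q'"
  shows "dominated (\<lambda>\<phi>. q \<phi> + q' \<phi>)"
proof -
  obtain C N where C: "0 \<le> C"
    "\<And>\<phi>. \<phi> \<in> schwartz \<Longrightarrow> q \<phi> \<le> C * (\<Sum>k\<le>N. \<Sum>n\<le>N. schwartz_seminorm k n \<phi>)"
    using assms by (auto simp: dominated_def)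
  obtain C' N' where C': "0 \<le> C'"
    "\<And>\<phi>. \<phi> \<in> schwartz \<Longrightarrow> q' \<phi> \<le> C' * (\<Sum>k\<le>N'. \<Sum>n\<le>N'. schwartz_seminorm k n \<phi>)"
    using assms by (auto simp: dominated_def)
  let ?S = "\<lambda>N \<phi>. \<Sum>k\<le>N. \<Sum>n\<le>N. schwartz_seminorm k n \<phi>"
  have "q \<phi> + q' \<phi> \<le> (C + C') * ?S (max N N') \<phi>" if \<phi>: "\<phi> \<in> schwartz" for \<phi>
  proof -
    have "q \<phi> \<le> C * ?S (max N N') \<phi>"
      using C(2)[OF \<phi>] mult_left_mono[OF seminorm_sum_mono[OF \<phi>, of N "max N N'"] C(1)] by simp
    moreover have "q' \<phi> \<le> C' * ?S (max N N') \<phi>"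
      using C'(2)[OF \<phi>] mult_left_mono[OF seminorm_sum_mono[OF \<phi>, of N' "max N N'"] C'(1)] by simp
    ultimately show ?thesis by (simp add: distrib_right)
  qed
  with C(1) C'(1) show ?thesis
    unfolding dominated_def by (intro exI[of _ "C + C'"] exI[of _ "max N N'"]) auto
qed

lemma dominated_sum: "finite I \<Longrightarrow> (\<And>i. i \<in> I \<Longrightarrow> dominated (q i)) \<Longrightarrow> dominated (\<lambda>\<phi>. \<Sum>i\<in>I. q i \<phi>)"
  by (induction rule: finite_induct) (auto intro: dominated_zero dominated_add)

text \<open>Continuity is tested one target seminorm at a time. Linearity is not part of the notion
  and enters separately where a transpose is formed.\<close>

definition contop :: "((real \<Rightarrow> complex) \<Rightarrow> real \<Rightarrow> complex) \<Rightarrow> bool" where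
  "contop U \<longleftrightarrow> (\<forall>\<phi>\<in>schwartz. U \<phi> \<in> schwartz) \<and> (\<forall>k n. dominated (\<lambda>\<phi>. schwartz_seminorm k n (U \<phi>)))"

lemma contopI:
  "\<lbrakk>\<And>\<phi>. \<phi> \<in> schwartz \<Longrightarrow> U \<phi> \<in> schwartz;
    \<And>k n. dominated (\<lambda>\<phi>. schwartz_seminorm k n (U \<phi>))\<rbrakk> \<Longrightarrow> contop U"
  by (simp add: contop_def)

lemma contop_dominated: "contop U \<Longrightarrow> dominated (\<lambda>\<phi>. schwartz_seminorm k n (U \<phi>))"
  by (simp add: contop_def)

lemma contop_schwartz: "contop U \<Longrightarrow> \<phi> \<in> schwartz \<Longrightarrow> U \<phi> \<in> schwartz"
  by (simp add: contop_def)

lemma dominated_contop: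
  assumes "dominated q" "contop U"
  shows "dominated (\<lambda>\<phi>. q (U \<phi>))"
proof -
  obtain C N where C: "0 \<le> C"
    "\<And>\<phi>. \<phi> \<in> schwartz \<Longrightarrow> q \<phi> \<le> C * (\<Sum>k\<le>N. \<Sum>n\<le>N. schwartz_seminorm k n \<phi>)"
    using assms by (auto simp: dominated_def)
  have "dominated (\<lambda>\<phi>. C * (\<Sum>k\<le>N. \<Sum>n\<le>N. schwartz_seminorm k n (U \<phi>)))"
    using assms C(1) by (intro dominated_cmult dominated_sum) (auto simp: contop_def)
  then show ?thesis
    by (rule dominated_mono) (use C assms contop_def in auto)
qed

lemma contop_comp: "contop U \<Longrightarrow> contop V \<Longrightarrow> contop (\<lambda>\<phi>. U (V \<phi>))"
  using dominated_contop[of "\<lambda>\<phi>. schwartz_seminorm k n (U \<phi>)" V for k n]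
  by (auto simp: contop_def)

lemma contop_id: "contop (\<lambda>\<phi>. \<phi>)"
  by (auto simp: contop_def intro: dominated_seminorm)

lemma contop_deriv1: "contop deriv1"
proof -
  have "schwartz_seminorm k n (deriv1 \<phi>) = schwartz_seminorm k (Suc n) \<phi>" for k n \<phi>
    by (simp add: schwartz_seminorm_def nderiv_Suc_deriv1)
  then show ?thesis
    by (auto simp: contop_def intro: dominated_seminorm)
qed

lemma contop_mult: "contop (\<lambda>\<phi> t. t *\<^sub>R \<phi> t)"
proof (rule contopI)
  have bd: "schwartz_seminorm k n (\<lambda>t. t *\<^sub>R \<phi> t) \<le>
      schwartz_seminorm (Suc k) n \<phi> + of_nat n * schwartz_seminorm k (n - 1) \<phi>"
    if "\<phi> \<in> schwartz" for k n \<phi>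
  proof (rule seminorm_le)
    fix t
    have "t ^ k *\<^sub>R nderiv n (\<lambda>t. t *\<^sub>R \<phi> t) t =
      t ^ Suc k *\<^sub>R nderiv n \<phi> t + of_nat n * (t ^ k *\<^sub>R nderiv (n - 1) \<phi> t)"
      by (simp add: nderiv_mult[OF that] algebra_simps)
    also have "norm \<dots> \<le> norm (t ^ Suc k *\<^sub>R nderiv n \<phi> t) + of_nat n * norm (t ^ k *\<^sub>R nderiv (n - 1) \<phi> t)"
      by (rule order_trans[OF norm_triangle_ineq]) (simp add: norm_mult)
    also have "\<dots> \<le> schwartz_seminorm (Suc k) n \<phi> + of_nat n * schwartz_seminorm k (n - 1) \<phi>"
      by (intro add_mono mult_left_mono norm_le_seminorm that) auto
    finally show "norm (t ^ k *\<^sub>R nderiv n (\<lambda>t. t *\<^sub>R \<phi> t) t) \<le> 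
      schwartz_seminorm (Suc k) n \<phi> + of_nat n * schwartz_seminorm k (n - 1) \<phi>" .
  qed
  have "dominated (\<lambda>\<phi>. schwartz_seminorm (Suc k) n \<phi> + of_nat n * schwartz_seminorm k (n - 1) \<phi>)" for k n
    by (rule dominated_add[OF dominated_seminorm dominated_cmult[OF dominated_seminorm of_nat_0_le_iff]])
  from this bd show "dominated (\<lambda>\<phi>. schwartz_seminorm k n (\<lambda>t. t *\<^sub>R \<phi> t))" for k n
    by (rule dominated_mono)
qed (rule schwartz_mult)

lemma nderiv_cmult: "\<phi> \<in> schwartz \<Longrightarrow> nderiv n (\<lambda>t. z * \<phi> t) = (\<lambda>t. z * nderiv n \<phi> t)"
proof (induction n arbitrary: \<phi>)
  case (Suc n)
  have "deriv1 (\<lambda>t. z * \<phi> t) = (\<lambda>t. z * deriv1 \<phi> t)"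
    using Suc by (intro deriv1_eq has_vector_derivative_mult_right schwartz_has_deriv)
  with Suc show ?case by (simp add: nderiv_Suc_deriv1)
qed simp

lemma nderiv_add:
  "\<phi> \<in> schwartz \<Longrightarrow> \<psi> \<in> schwartz \<Longrightarrow> nderiv n (\<lambda>t. \<phi> t + \<psi> t) = (\<lambda>t. nderiv n \<phi> t + nderiv n \<psi> t)"
proof (induction n arbitrary: \<phi> \<psi>)
  case (Suc n)
  have "deriv1 (\<lambda>t. \<phi> t + \<psi> t) = (\<lambda>t. deriv1 \<phi> t + deriv1 \<psi> t)"
    using Suc by (intro deriv1_eq has_vector_derivative_add schwartz_has_deriv)
  with Suc show ?case by (simp add: nderiv_Suc_deriv1)
qed simp

lemma seminorm_cmult_le:
  assumes "\<phi> \<in> schwartz"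
  shows "schwartz_seminorm k n (\<lambda>t. z * \<phi> t) \<le> norm z * schwartz_seminorm k n \<phi>"
proof (rule seminorm_le)
  fix t
  have "norm (z * (t ^ k *\<^sub>R nderiv n \<phi> t)) \<le> norm z * schwartz_seminorm k n \<phi>"
    unfolding norm_mult by (intro mult_left_mono norm_le_seminorm assms) auto
  then show "norm (t ^ k *\<^sub>R nderiv n (\<lambda>t. z * \<phi> t) t) \<le> norm z * schwartz_seminorm k n \<phi>"
    unfolding nderiv_cmult[OF assms] mult_scaleR_right .
qed

lemma contop_cmult:
  assumes "contop U" shows "contop (\<lambda>\<phi> t. z * U \<phi> t)"
proof (rule contopI)
  show "(\<lambda>t. z * U \<phi> t) \<in> schwartz" if "\<phi> \<in> schwartz" for \<phi>
    by (rule schwartz_cmult; rule contop_schwartz) fact+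
  have "schwartz_seminorm k n (\<lambda>t. z * U \<phi> t) \<le> norm z * schwartz_seminorm k n (U \<phi>)"
    if "\<phi> \<in> schwartz" for k n \<phi>
    by (rule seminorm_cmult_le; rule contop_schwartz) fact+
  then show "dominated (\<lambda>\<phi>. schwartz_seminorm k n (\<lambda>t. z * U \<phi> t))" for k n
    by (rule dominated_mono[OF dominated_cmult[OF contop_dominated[OF assms] norm_ge_zero]])
qed

lemma seminorm_add_le:
  assumes "\<phi> \<in> schwartz" "\<psi> \<in> schwartz"
  shows "schwartz_seminorm k n (\<lambda>t. \<phi> t + \<psi> t) \<le> schwartz_seminorm k n \<phi> + schwartz_seminorm k n \<psi>"
proof (rule seminorm_le)
  fix t
  have "norm (t ^ k *\<^sub>R nderiv n \<phi> t + t ^ k *\<^sub>R nderiv n \<psi> t) \<le>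
      schwartz_seminorm k n \<phi> + schwartz_seminorm k n \<psi>"
    by (rule order_trans[OF norm_triangle_ineq]) (rule add_mono; rule norm_le_seminorm, fact)
  then show "norm (t ^ k *\<^sub>R nderiv n (\<lambda>t. \<phi> t + \<psi> t) t) \<le>
      schwartz_seminorm k n \<phi> + schwartz_seminorm k n \<psi>"
    unfolding nderiv_add[OF assms] scaleR_add_right .
qed

lemma contop_add:
  assumes "contop U" "contop V" shows "contop (\<lambda>\<phi> t. U \<phi> t + V \<phi> t)"
proof (rule contopI)
  show "(\<lambda>t. U \<phi> t + V \<phi> t) \<in> schwartz" if "\<phi> \<in> schwartz" for \<phi>
    by (rule schwartz_add; rule contop_schwartz) fact+
  have "schwartz_seminorm k n (\<lambda>t. U \<phi> t + V \<phi> t) \<le> schwartz_seminorm k n (U \<phi>) + schwartz_seminorm k n (V \<phi>)"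
    if "\<phi> \<in> schwartz" for k n \<phi>
    by (rule seminorm_add_le; rule contop_schwartz) fact+
  then show "dominated (\<lambda>\<phi>. schwartz_seminorm k n (\<lambda>t. U \<phi> t + V \<phi> t))" for k n
    by (rule dominated_mono[OF dominated_add[OF contop_dominated contop_dominated, OF assms]])
qed

text \<open>If U turns differentiation into B and multiplication by t into M, then t^k times the
  n-th derivative of \<open>U \<phi>\<close> equals U applied to M^k B^n \<phi>. A single supremum
  estimate for U thus controls all seminorms.\<close>

lemma contop_intertwine:
  assumes B: "contop B" and M: "contop M"
    and deriv: "\<And>\<phi> t. \<phi> \<in> schwartz \<Longrightarrow> (U \<phi> has_vector_derivative U (B \<phi>) t) (at t)"
    and mult: "\<And>\<phi> t. \<phi> \<in> schwartz \<Longrightarrow> t *\<^sub>R U \<phi> t = U (M \<phi>) t"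
    and bound: "\<And>\<phi> t. \<phi> \<in> schwartz \<Longrightarrow> norm (U \<phi> t) \<le> q \<phi>"
    and q: "dominated q"
  shows "contop U"
  unfolding contop_def
proof (intro conjI ballI allI)
  show "U \<phi> \<in> schwartz" if "\<phi> \<in> schwartz" for \<phi>
    using that
  proof (rule schwartz_coinduct[where U = U], goal_cases)
    case (1 \<phi>)
    then show ?case using bound by (auto simp: bounded_iff)
  next
    case (2 \<phi>)
    then show ?case using mult contop_schwartz[OF M] by (intro bexI[of _ "M \<phi>"]) auto
  next
    case (3 \<phi>)
    then show ?case using deriv contop_schwartz[OF B] by (intro bexI[of _ "B \<phi>"]) auto
  qed
  fix k n
  have funpow: "contop (V ^^ n)" if "contop V" for V n
    by (induction n) (use that in \<open>auto simp: contop_id id_def comp_def intro: contop_comp\<close>)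
  have "nderiv n (U \<phi>) = U ((B ^^ n) \<phi>)" if "\<phi> \<in> schwartz" for \<phi>
    using that
  proof (induction n)
    case (Suc n)
    then show ?case
      using has_vector_derivative_imp_fun_eq[OF deriv[OF contop_schwartz[OF funpow[OF B]], of \<phi> n]]
      by (simp add: nderiv_def)
  qed simp
  moreover have "t ^ k *\<^sub>R U \<phi> t = U ((M ^^ k) \<phi>) t" if "\<phi> \<in> schwartz" for \<phi> t
  proof (induction k)
    case (Suc k)
    have "t ^ Suc k *\<^sub>R U \<phi> t = t *\<^sub>R U ((M ^^ k) \<phi>) t"
      unfolding Suc[symmetric] by simp
    then show ?case
      using mult[OF contop_schwartz[OF funpow[OF M] that]] by simp
  qed simp
  ultimately have "schwartz_seminorm k n (U \<phi>) \<le> q ((M ^^ k) ((B ^^ n) \<phi>))" if "\<phi> \<in> schwartz" for \<phi>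
    using that by (intro seminorm_le) (simp del: norm_scaleR add: bound contop_schwartz funpow B M)
  then show "dominated (\<lambda>\<phi>. schwartz_seminorm k n (U \<phi>))"
    by (intro dominated_mono[OF dominated_contop[OF dominated_contop[OF q funpow[OF M, of k]] funpow[OF B, of n]]])
qed

section \<open>The elementary operators act continuously on Schwartz functions\<close>

text \<open>The function 1 / (1 + t^2) is the common integrable majorant: decay estimates for
  Schwartz functions and for families are brought to this form before integrating.\<close>

lemma integrable_k0: "integrable lborel (\<lambda>t::real. 1 / (1 + t\<^sup>2))"
  using integrable_inverse_1_plus_square
  by (simp add: set_integrable_def einterval_def divide_inverse)

lemma tendsto_k0: "((\<lambda>t::real. C / (1 + t\<^sup>2)) \<longlongrightarrow> 0) at_top" "((\<lambda>t::real. C / (1 + t\<^sup>2)) \<longlongrightarrow> 0) at_bot"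
  by real_asymp+

text \<open>Serves integration by parts for the Fourier transform, where both limits vanish, and the
  interchange of a tempered functional with an integral, where the limit at infinity is the wanted
  value.\<close>

lemma integral_of_derivative:
  fixes f F :: "real \<Rightarrow> complex"
  assumes "\<And>x. (F has_vector_derivative f x) (at x)" "\<And>x. isCont f x" "integrable lborel f"
    and "(F \<longlongrightarrow> A) at_bot" "(F \<longlongrightarrow> B) at_top"
  shows "(\<integral>x. f x \<partial>lborel) = B - A"
proof -
  have "(LBINT x=-\<infinity>..\<infinity>. f x) = B - A"
    using assms by (intro interval_integral_FTC_integrable)
      (auto simp: ereal_tendsto_simps set_integrable_def einterval_def)
  then show ?thesis
    by (simp add: interval_lebesgue_integral_def set_lebesgue_integral_def einterval_def)
qed

lemma schwartz_le_k0:
  assumes "\<phi> \<in> schwartz"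
  shows "norm (\<phi> t) \<le> (schwartz_seminorm 0 0 \<phi> + schwartz_seminorm 2 0 \<phi>) / (1 + t\<^sup>2)"
proof -
  have "norm (\<phi> t) + t\<^sup>2 * norm (\<phi> t) \<le> schwartz_seminorm 0 0 \<phi> + schwartz_seminorm 2 0 \<phi>"
    using norm_le_seminorm[OF assms, of t 0 0] norm_le_seminorm[OF assms, of t 2 0] by simp
  moreover have "0 < 1 + t\<^sup>2" by (simp add: add_pos_nonneg)
  ultimately show ?thesis by (simp add: field_simps)
qed

lemma integrable_schwartz:
  assumes "\<phi> \<in> schwartz" shows "integrable lborel \<phi>"
proof (rule Bochner_Integration.integrable_bound)
  show "integrable lborel (\<lambda>t. (schwartz_seminorm 0 0 \<phi> + schwartz_seminorm 2 0 \<phi>) * (1 / (1 + t\<^sup>2)))"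
    by (intro integrable_mult_right integrable_k0)
  show "AE t in lborel. norm (\<phi> t) \<le> norm ((schwartz_seminorm 0 0 \<phi> + schwartz_seminorm 2 0 \<phi>) * (1 / (1 + t\<^sup>2)))"
    using schwartz_le_k0[OF assms] seminorm_nonneg[OF assms] by (intro always_eventually allI) simp
qed (use schwartz_measurable[OF assms] in simp)

lemma schwartz_tendsto_0:
  assumes "\<phi> \<in> schwartz" shows "(\<phi> \<longlongrightarrow> 0) at_top" "(\<phi> \<longlongrightarrow> 0) at_bot"
  using Lim_null_comparison[OF always_eventually tendsto_k0(1)] Lim_null_comparison[OF always_eventually tendsto_k0(2)]
    schwartz_le_k0[OF assms] by blast+

lemma integral_norm_schwartz_le:
  assumes "\<phi> \<in> schwartz"
  shows "(\<integral>t. norm (\<phi> t) \<partial>lborel) \<le>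
    (schwartz_seminorm 0 0 \<phi> + schwartz_seminorm 2 0 \<phi>) * (\<integral>t. 1 / (1 + t\<^sup>2) \<partial>lborel)"
proof -
  have "(\<integral>t. norm (\<phi> t) \<partial>lborel) \<le> (\<integral>t. (schwartz_seminorm 0 0 \<phi> + schwartz_seminorm 2 0 \<phi>) * (1 / (1 + t\<^sup>2)) \<partial>lborel)"
    using schwartz_le_k0[OF assms]
    by (intro integral_mono integrable_norm integrable_schwartz assms integrable_mult_right integrable_k0) simp
  also have "\<dots> = (schwartz_seminorm 0 0 \<phi> + schwartz_seminorm 2 0 \<phi>) * (\<integral>t. 1 / (1 + t\<^sup>2) \<partial>lborel)"
    by (rule integral_mult_right_zero)
  finally show ?thesis .
qed

lemma has_vector_derivative_cis:
  assumes "(q has_real_derivative q') (at t)"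
  shows "((\<lambda>t. exp (\<i> * of_real (q t))) has_vector_derivative \<i> * of_real q' * exp (\<i> * of_real (q t))) (at t)"
proof -
  have "((\<lambda>t. \<i> * of_real (q t)) has_vector_derivative \<i> * of_real q') (at t)"
    by (intro has_vector_derivative_mult_right has_vector_derivative_of_real assms)
  from field_vector_diff_chain_at[OF this DERIV_exp] show ?thesis
    by (simp add: comp_def)
qed

lemma norm_cis [simp]: "norm (exp (\<i> * complex_of_real x)) = 1" "norm (exp (- (\<i> * complex_of_real x))) = 1"
  using norm_exp_i_times[of x] norm_exp_i_times[of "-x"] by simp_all

lemma has_vector_derivative_mult_schwartz:
  assumes "(q has_real_derivative q') (at t)" "\<phi> \<in> schwartz"
  shows "((\<lambda>t. exp (\<i> * of_real (q t)) * \<phi> t) has_vector_derivative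
    exp (\<i> * of_real (q t)) * (deriv1 \<phi> t + \<i> * of_real q' * \<phi> t)) (at t)"
  using has_vector_derivative_mult[OF has_vector_derivative_cis[OF assms(1)] schwartz_has_deriv[OF assms(2)]]
  by (simp add: algebra_simps)

lemma contop_chirp: "contop (chirp s)"
proof (rule contop_intertwine)
  let ?B = "\<lambda>\<phi> t. deriv1 \<phi> t + \<i> * of_real (2 * pi * s) * (t *\<^sub>R \<phi> t)"
  show "contop ?B"
    by (rule contop_add[OF contop_deriv1 contop_cmult[OF contop_mult]])
  show "(chirp s \<phi> has_vector_derivative chirp s (?B \<phi>) t) (at t)" if "\<phi> \<in> schwartz" for \<phi> t
  proof -
    have "((\<lambda>t. pi * s * t\<^sup>2) has_real_derivative 2 * pi * s * t) (at t)"
      by (auto intro!: derivative_eq_intros)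
    from has_vector_derivative_mult_schwartz[OF this that] show ?thesis
      unfolding chirp_def[abs_def] by (simp add: scaleR_conv_of_real mult_ac)
  qed
  show "norm (chirp s \<phi> t) \<le> schwartz_seminorm 0 0 \<phi>" if "\<phi> \<in> schwartz" for \<phi> t
    using norm_le_seminorm0[OF that] by (simp add: chirp_def norm_mult)
  show "t *\<^sub>R chirp s \<phi> t = chirp s (\<lambda>t. t *\<^sub>R \<phi> t) t" for \<phi> t
    by (simp add: chirp_def)
qed (rule contop_mult dominated_seminorm)+

lemma contop_modulate: "contop (modulate s)"
proof (rule contop_intertwine)
  let ?B = "\<lambda>\<phi> t. deriv1 \<phi> t + \<i> * of_real (2 * pi * s) * \<phi> t"
  show "contop ?B"
    by (rule contop_add[OF contop_deriv1 contop_cmult[OF contop_id]])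
  show "(modulate s \<phi> has_vector_derivative modulate s (?B \<phi>) t) (at t)" if "\<phi> \<in> schwartz" for \<phi> t
  proof -
    have "((\<lambda>t. 2 * pi * s * t) has_real_derivative 2 * pi * s) (at t)"
      by (auto intro!: derivative_eq_intros)
    from has_vector_derivative_mult_schwartz[OF this that] show ?thesis
      unfolding modulate_def[abs_def] by (simp add: mult_ac)
  qed
  show "norm (modulate s \<phi> t) \<le> schwartz_seminorm 0 0 \<phi>" if "\<phi> \<in> schwartz" for \<phi> t
    using norm_le_seminorm0[OF that] by (simp add: modulate_def norm_mult)
  show "t *\<^sub>R modulate s \<phi> t = modulate s (\<lambda>t. t *\<^sub>R \<phi> t) t" for \<phi> t
    by (simp add: modulate_def)
qed (rule contop_mult dominated_seminorm)+

lemma has_vector_derivative_affine: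
  assumes "\<phi> \<in> schwartz"
  shows "((\<lambda>t. \<phi> (c * t + x)) has_vector_derivative c *\<^sub>R deriv1 \<phi> (c * t + x)) (at t)"
proof -
  have "((\<lambda>t. c * t + x) has_vector_derivative c) (at t)"
    by (auto intro!: derivative_eq_intros simp flip: has_real_derivative_iff_has_vector_derivative)
  from vector_diff_chain_at[OF this schwartz_has_deriv[OF assms]] show ?thesis
    by (simp add: comp_def)
qed

lemma contop_dilate:
  assumes "s \<noteq> 0" shows "contop (dilate s)"
proof (rule contop_intertwine)
  let ?c = "\<bar>s\<bar> powr (-1/2)"
  let ?B = "\<lambda>\<phi> t. of_real (1 / s) * deriv1 \<phi> t"
  let ?M = "\<lambda>\<phi> t. of_real s * (t *\<^sub>R \<phi> t)"
  show "contop ?B" "contop ?M"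
    by (rule contop_cmult contop_deriv1 contop_mult)+
  show "dominated (\<lambda>\<phi>. ?c * schwartz_seminorm 0 0 \<phi>)"
    by (rule dominated_cmult[OF dominated_seminorm]) simp
  show "(dilate s \<phi> has_vector_derivative dilate s (?B \<phi>) t) (at t)" if "\<phi> \<in> schwartz" for \<phi> t
    using has_vector_derivative_mult_right[OF has_vector_derivative_affine[OF that, of "1 / s" 0], of "of_real ?c"]
    unfolding dilate_def[abs_def] by (simp add: scaleR_conv_of_real)
  show "norm (dilate s \<phi> t) \<le> ?c * schwartz_seminorm 0 0 \<phi>" if "\<phi> \<in> schwartz" for \<phi> t
    using mult_left_mono[OF norm_le_seminorm0[OF that], of ?c] by (simp add: dilate_def norm_mult)
  show "t *\<^sub>R dilate s \<phi> t = dilate s (?M \<phi>) t" for \<phi> t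
    using assms by (simp add: dilate_def scaleR_conv_of_real)
qed

lemma schwartz_translate [simp]:
  assumes "\<phi> \<in> schwartz" shows "(\<lambda>t. \<phi> (t - x)) \<in> schwartz"
proof -
  have "contop (\<lambda>\<phi> t. \<phi> (t - x))"
  proof (rule contop_intertwine[where B = deriv1])
    \<comment> \<open>Multiplication by t is carried through the translation by writing t = (t - x)
      + x.\<close>
    let ?M = "\<lambda>\<phi> t. t *\<^sub>R \<phi> t + of_real x * \<phi> t"
    show "contop ?M"
      by (rule contop_add[OF contop_mult contop_cmult[OF contop_id]])
    show "((\<lambda>t. \<phi> (t - x)) has_vector_derivative deriv1 \<phi> (t - x)) (at t)" if "\<phi> \<in> schwartz" for \<phi> t
      using has_vector_derivative_affine[OF that, of 1 "-x"] by simp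
    show "t *\<^sub>R \<phi> (t - x) = ?M \<phi> (t - x)" for \<phi> :: "real \<Rightarrow> complex" and t
      by (simp add: scaleR_conv_of_real algebra_simps)
    show "norm (\<phi> (t - x)) \<le> schwartz_seminorm 0 0 \<phi>" if "\<phi> \<in> schwartz" for \<phi> t
      using norm_le_seminorm0[OF that] .
  qed (rule contop_deriv1 dominated_seminorm)+
  then show ?thesis using assms by (simp add: contop_def)
qed

lemma schwartz_modulate_exp [simp]:
  assumes "\<phi> \<in> schwartz" shows "(\<lambda>t. \<phi> t * exp (- (\<i> * of_real (2 * pi * \<omega> * t)))) \<in> schwartz"
proof -
  have "modulate (- \<omega>) \<phi> = (\<lambda>t. \<phi> t * exp (- (\<i> * of_real (2 * pi * \<omega> * t))))"
    by (auto simp: modulate_def)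
  then show ?thesis using contop_schwartz[OF contop_modulate assms, of "-\<omega>"] by simp
qed

section \<open>The Fourier transform on Schwartz functions\<close>

lemma fourier_has_vector_derivative:
  assumes "\<phi> \<in> schwartz"
  shows "(fourier \<phi> has_vector_derivative fourier (\<lambda>t. - (2 * pi * \<i>) * (t *\<^sub>R \<phi> t)) \<xi>) (at \<xi>)"
  unfolding fourier_def[abs_def]
proof (rule deriv_under_integral)
  let ?D = "\<lambda>\<phi> t. - (2 * pi * \<i>) * (t *\<^sub>R \<phi> t)"
  have D: "?D \<phi> \<in> schwartz" if "\<phi> \<in> schwartz" for \<phi>
    by (intro schwartz_cmult schwartz_mult that)
  show "integrable lborel (\<lambda>t. \<phi> t * exp (- (\<i> * of_real (2 * pi * \<xi> * t))))"
    "integrable lborel (\<lambda>t. ?D \<phi> t * exp (- (\<i> * of_real (2 * pi * \<xi> * t))))" for \<xi>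
    by (intro integrable_schwartz schwartz_modulate_exp D assms)+
  show "integrable lborel (\<lambda>t. norm (?D (?D \<phi>) t))"
    by (intro integrable_norm integrable_schwartz D assms)
  have *: "((\<lambda>\<xi>. \<psi> t * exp (- (\<i> * of_real (2 * pi * \<xi> * t)))) has_vector_derivative
     ?D \<psi> t * exp (- (\<i> * of_real (2 * pi * \<xi> * t)))) (at \<xi>)" for \<psi> :: "real \<Rightarrow> complex" and \<xi> t
  proof -
    have "((\<lambda>\<xi>. - (2 * pi * \<xi> * t)) has_real_derivative - (2 * pi * t)) (at \<xi>)"
      by (auto intro!: derivative_eq_intros)
    from has_vector_derivative_mult_right[OF has_vector_derivative_cis[OF this], of "\<psi> t"] show ?thesis
      by (simp add: scaleR_conv_of_real mult_ac)
  qed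
  show "((\<lambda>\<xi>. \<phi> t * exp (- (\<i> * of_real (2 * pi * \<xi> * t)))) has_vector_derivative
     ?D \<phi> t * exp (- (\<i> * of_real (2 * pi * \<xi> * t)))) (at \<xi>)" for t \<xi>
    by (rule *)
  show "((\<lambda>\<xi>. ?D \<phi> t * exp (- (\<i> * of_real (2 * pi * \<xi> * t)))) has_vector_derivative
     ?D (?D \<phi>) t * exp (- (\<i> * of_real (2 * pi * \<xi> * t)))) (at \<xi>)" for t \<xi>
    by (rule *)
  show "norm (?D (?D \<phi>) t * exp (- (\<i> * of_real (2 * pi * \<xi> * t)))) \<le> norm (?D (?D \<phi>) t)" for t \<xi>
    by (simp only: norm_mult norm_cis mult_1_right order_refl)
qed

text \<open>Integration by parts: \<phi> times the exponential is again Schwartz, hence its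
  derivative has integral zero, and the product rule splits this integral into the two
  sides.\<close>

lemma fourier_deriv:
  assumes "\<phi> \<in> schwartz"
  shows "fourier (deriv1 \<phi>) \<xi> = 2 * pi * \<i> * (\<xi> *\<^sub>R fourier \<phi> \<xi>)"
proof -
  let ?e = "\<lambda>t. exp (- (\<i> * of_real (2 * pi * \<xi> * t)))"
  define \<psi> where "\<psi> = (\<lambda>t. \<phi> t * ?e t)"
  have \<psi>: "\<psi> \<in> schwartz"
    unfolding \<psi>_def by (rule schwartz_modulate_exp[OF assms])
  have int: "integrable lborel (\<lambda>t. deriv1 \<phi> t * ?e t)" "integrable lborel \<psi>"
    by (intro integrable_schwartz schwartz_modulate_exp schwartz_deriv assms \<psi>)+
  have D: "deriv1 \<psi> = (\<lambda>t. deriv1 \<phi> t * ?e t - 2 * pi * \<i> * \<xi> * \<psi> t)"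
  proof (rule deriv1_eq)
    fix t
    have "((\<lambda>t. - (2 * pi * \<xi> * t)) has_real_derivative - (2 * pi * \<xi>)) (at t)"
      by (auto intro!: derivative_eq_intros)
    from has_vector_derivative_mult_schwartz[OF this assms]
    show "(\<psi> has_vector_derivative (deriv1 \<phi> t * ?e t - 2 * pi * \<i> * \<xi> * \<psi> t)) (at t)"
      by (simp add: \<psi>_def algebra_simps)
  qed
  have "(\<integral>t. deriv1 \<psi> t \<partial>lborel) = 0 - 0"
    using \<psi> schwartz_continuous[OF schwartz_deriv[OF \<psi>], of UNIV]
    by (intro integral_of_derivative[of \<psi>] schwartz_has_deriv schwartz_tendsto_0 integrable_schwartz)
      (auto simp: continuous_on_eq_continuous_at)
  then have "(\<integral>t. deriv1 \<phi> t * ?e t \<partial>lborel) = 2 * pi * \<i> * \<xi> * (\<integral>t. \<psi> t \<partial>lborel)"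
    using int by (simp add: D)
  then show ?thesis
    by (simp add: fourier_def \<psi>_def scaleR_conv_of_real)
qed

lemma fourier_cmult: "fourier (\<lambda>t. z * \<phi> t) \<xi> = z * fourier \<phi> \<xi>"
  by (simp add: fourier_def mult.assoc)

lemma fourier_add:
  assumes "\<phi> \<in> schwartz" "\<psi> \<in> schwartz"
  shows "fourier (\<lambda>t. \<phi> t + \<psi> t) \<xi> = fourier \<phi> \<xi> + fourier \<psi> \<xi>"
  unfolding fourier_def distrib_right
  by (intro Bochner_Integration.integral_add integrable_schwartz schwartz_modulate_exp assms)

lemma norm_fourier_le: "norm (fourier \<phi> \<xi>) \<le> (\<integral>t. norm (\<phi> t) \<partial>lborel)"
  unfolding fourier_def by (rule order_trans[OF integral_norm_bound]) (simp only: norm_mult norm_cis mult_1_right order_refl)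

text \<open>The transform exchanges the two operations: differentiation becomes multiplication by -
  2 pi i t, and multiplication becomes differentiation divided by 2 pi i. The supremum of the
  transform is at most the L^1 norm, which two seminorms control.\<close>

lemma contop_fourier: "contop fourier"
proof (rule contop_intertwine)
  let ?M = "\<lambda>\<phi> t. (1 / (2 * pi * \<i>)) * deriv1 \<phi> t"
  show "contop (\<lambda>\<phi> t. - (2 * pi * \<i>) * (t *\<^sub>R \<phi> t))" "contop ?M"
    by (rule contop_cmult contop_deriv1 contop_mult)+
  show "t *\<^sub>R fourier \<phi> t = fourier (?M \<phi>) t" if "\<phi> \<in> schwartz" for \<phi> t
    by (simp only: fourier_cmult fourier_deriv[OF that]) simp
  show "norm (fourier \<phi> t) \<le>
     (\<integral>t. 1 / (1 + t\<^sup>2) \<partial>lborel) * (schwartz_seminorm 0 0 \<phi> + schwartz_seminorm 2 0 \<phi>)"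
    if "\<phi> \<in> schwartz" for \<phi> t
    using norm_fourier_le[of \<phi> t] integral_norm_schwartz_le[OF that] by (simp add: mult.commute)
  show "dominated (\<lambda>\<phi>. (\<integral>t. 1 / (1 + t\<^sup>2) \<partial>lborel) * (schwartz_seminorm 0 0 \<phi> + schwartz_seminorm 2 0 \<phi>))"
    by (intro dominated_cmult dominated_add dominated_seminorm integral_nonneg) simp
qed (rule fourier_has_vector_derivative)

section \<open>Tempered functionals and their transposes\<close>

lemma tempered_dominated: "T \<in> tempered \<Longrightarrow> dominated (\<lambda>\<phi>. norm (T \<phi>))"
proof -
  assume "T \<in> tempered"
  then obtain C N where C: "\<And>\<phi>. \<phi> \<in> schwartz \<Longrightarrow> norm (T \<phi>) \<le> C * (\<Sum>k\<le>N. \<Sum>n\<le>N. schwartz_seminorm k n \<phi>)"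
    unfolding tempered_def by blast
  have "norm (T \<phi>) \<le> \<bar>C\<bar> * (\<Sum>k\<le>N. \<Sum>n\<le>N. schwartz_seminorm k n \<phi>)" if "\<phi> \<in> schwartz" for \<phi>
    by (rule order_trans[OF C[OF that] mult_right_mono]) (auto intro!: sum_nonneg seminorm_nonneg that)
  then show ?thesis
    unfolding dominated_def by (intro exI[of _ "\<bar>C\<bar>"] exI[of _ N]) auto
qed

lemma tempered_add: "\<lbrakk>T \<in> tempered; \<phi> \<in> schwartz; \<psi> \<in> schwartz\<rbrakk> \<Longrightarrow> T (\<lambda>t. \<phi> t + \<psi> t) = T \<phi> + T \<psi>"
  by (simp add: tempered_def)

lemma tempered_cmult: "\<lbrakk>T \<in> tempered; \<phi> \<in> schwartz\<rbrakk> \<Longrightarrow> T (\<lambda>t. z * \<phi> t) = z * T \<phi>"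
  by (simp add: tempered_def)

lemma tempered_diff: "\<lbrakk>T \<in> tempered; \<phi> \<in> schwartz; \<psi> \<in> schwartz\<rbrakk> \<Longrightarrow> T (\<lambda>t. \<phi> t - \<psi> t) = T \<phi> - T \<psi>"
  using tempered_add[of T \<phi> "\<lambda>t. (-1) * \<psi> t"] tempered_cmult[of T \<psi> "-1"] schwartz_cmult[of \<psi> "-1"] by simp

text \<open>Linearity is asked for on Schwartz functions only, because \<open>fourier\<close> is
  additive only where the integrals converge.\<close>

lemma tempered_transpose:
  assumes T: "T \<in> tempered" and U: "contop U"
    and add: "\<And>\<phi> \<psi>. \<phi> \<in> schwartz \<Longrightarrow> \<psi> \<in> schwartz \<Longrightarrow> U (\<lambda>t. \<phi> t + \<psi> t) = (\<lambda>t. U \<phi> t + U \<psi> t)"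
    and cmult: "\<And>\<phi> z. \<phi> \<in> schwartz \<Longrightarrow> U (\<lambda>t. z * \<phi> t) = (\<lambda>t. z * U \<phi> t)"
  shows "(\<lambda>\<phi>. T (U \<phi>)) \<in> tempered"
  unfolding tempered_def mem_Collect_eq
proof (intro conjI ballI allI)
  show "\<exists>C N. \<forall>\<phi>\<in>schwartz. norm (T (U \<phi>)) \<le> C * (\<Sum>k\<le>N. \<Sum>n\<le>N. schwartz_seminorm k n \<phi>)"
    using dominated_contop[OF tempered_dominated[OF T] U] unfolding dominated_def by blast
qed (simp_all add: add cmult tempered_add[OF T] tempered_cmult[OF T] contop_schwartz[OF U])

lemma tempered_saft:
  assumes "T \<in> tempered" "b \<noteq> 0"
  shows "saft a b c d p q T \<in> tempered"
proof -
  have 1: "modulate_dist s T \<in> tempered" if "T \<in> tempered" for s T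
    unfolding modulate_dist_def[abs_def]
    by (rule tempered_transpose[OF that contop_modulate]) (auto simp: modulate_def algebra_simps)
  have 2: "chirp_dist s T \<in> tempered" if "T \<in> tempered" for s T
    unfolding chirp_dist_def[abs_def]
    by (rule tempered_transpose[OF that contop_chirp]) (auto simp: chirp_def algebra_simps)
  have 3: "dilate_dist s T \<in> tempered" if "T \<in> tempered" "s \<noteq> 0" for s T
    unfolding dilate_dist_def[abs_def]
    by (rule tempered_transpose[OF that(1) contop_dilate]) (use that(2) in \<open>auto simp: dilate_def algebra_simps\<close>)
  have 4: "fourier_dist T \<in> tempered" if "T \<in> tempered" for T
    unfolding fourier_dist_def[abs_def]
    by (rule tempered_transpose[OF that contop_fourier]) (auto simp: fourier_add fourier_cmult)
  show ?thesis
    unfolding saft_def by (intro 1 2 3 4 assms)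
qed

section \<open>Rapidly decreasing families of Schwartz functions\<close>

text \<open>
  The union of all invariant sets of functions: membership is shown by exhibiting such a set, which
  avoids mixed partial derivatives and Leibniz formulas.
\<close>

definition schwartz2 :: "(real \<Rightarrow> real \<Rightarrow> complex) set" where
  "schwartz2 = {\<Phi>. \<exists>X. \<Phi> \<in> X \<and> (\<forall>\<Psi>\<in>X.
     (\<exists>C. \<forall>s t. norm (\<Psi> s t) \<le> C) \<and>
     (\<lambda>s t. s *\<^sub>R \<Psi> s t) \<in> X \<and> (\<lambda>s t. t *\<^sub>R \<Psi> s t) \<in> X \<and>
     (\<exists>\<Psi>'\<in>X. \<forall>s t. ((\<lambda>s. \<Psi> s t) has_vector_derivative \<Psi>' s t) (at s)) \<and>
     (\<exists>\<Psi>'\<in>X. \<forall>s t. (\<Psi> s has_vector_derivative \<Psi>' s t) (at t)))}"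

lemma
  assumes "\<Phi> \<in> schwartz2"
  shows schwartz2_bounded: "\<exists>C. \<forall>s t. norm (\<Phi> s t) \<le> C"
    and schwartz2_mult1: "(\<lambda>s t. s *\<^sub>R \<Phi> s t) \<in> schwartz2"
    and schwartz2_mult2: "(\<lambda>s t. t *\<^sub>R \<Phi> s t) \<in> schwartz2"
    and schwartz2_deriv1: "\<exists>\<Psi>\<in>schwartz2. \<forall>s t. ((\<lambda>s. \<Phi> s t) has_vector_derivative \<Psi> s t) (at s)"
    and schwartz2_deriv2: "\<exists>\<Psi>\<in>schwartz2. \<forall>s t. (\<Phi> s has_vector_derivative \<Psi> s t) (at t)"
proof -
  from assms obtain X where X: "\<Phi> \<in> X" "\<forall>\<Psi>\<in>X.
     (\<exists>C. \<forall>s t. norm (\<Psi> s t) \<le> C) \<and>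
     (\<lambda>s t. s *\<^sub>R \<Psi> s t) \<in> X \<and> (\<lambda>s t. t *\<^sub>R \<Psi> s t) \<in> X \<and>
     (\<exists>\<Psi>'\<in>X. \<forall>s t. ((\<lambda>s. \<Psi> s t) has_vector_derivative \<Psi>' s t) (at s)) \<and>
     (\<exists>\<Psi>'\<in>X. \<forall>s t. (\<Psi> s has_vector_derivative \<Psi>' s t) (at t))" (is "\<forall>\<Psi>\<in>X. ?P X \<Psi>")
    unfolding schwartz2_def by blast
  then have sub: "X \<subseteq> schwartz2"
    unfolding schwartz2_def by blast
  have P: "?P X \<Phi>" using X by blast
  show "\<exists>C. \<forall>s t. norm (\<Phi> s t) \<le> C" using P by blast
  show "(\<lambda>s t. s *\<^sub>R \<Phi> s t) \<in> schwartz2" using P sub by blast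
  show "(\<lambda>s t. t *\<^sub>R \<Phi> s t) \<in> schwartz2" using P sub by blast
  show "\<exists>\<Psi>\<in>schwartz2. \<forall>s t. ((\<lambda>s. \<Phi> s t) has_vector_derivative \<Psi> s t) (at s)" using P sub by blast
  show "\<exists>\<Psi>\<in>schwartz2. \<forall>s t. (\<Phi> s has_vector_derivative \<Psi> s t) (at t)" using P sub by blast
qed

text \<open>Sums are needed because the product rule leaves a set of products. Scalars need no rule
  of their own: in each application the generators absorb them.\<close>

inductive_set span2 :: "(real \<Rightarrow> real \<Rightarrow> complex) set \<Rightarrow> (real \<Rightarrow> real \<Rightarrow> complex) set" for G where
  base: "\<Phi> \<in> G \<Longrightarrow> \<Phi> \<in> span2 G"
| add: "\<Phi> \<in> span2 G \<Longrightarrow> \<Psi> \<in> span2 G \<Longrightarrow> (\<lambda>s t. \<Phi> s t + \<Psi> s t) \<in> span2 G"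

text \<open>Boundedness, the multiplications and the differentiations are compatible with sums, so
  it is enough that they send generators into the span; the span is then itself an invariant
  set.\<close>

lemma span2_subset_schwartz2:
  assumes "\<And>\<Phi>. \<Phi> \<in> G \<Longrightarrow> \<exists>C. \<forall>s t. norm (\<Phi> s t) \<le> C"
    and "\<And>\<Phi>. \<Phi> \<in> G \<Longrightarrow> (\<lambda>s t. s *\<^sub>R \<Phi> s t) \<in> span2 G"
    and "\<And>\<Phi>. \<Phi> \<in> G \<Longrightarrow> (\<lambda>s t. t *\<^sub>R \<Phi> s t) \<in> span2 G"
    and "\<And>\<Phi>. \<Phi> \<in> G \<Longrightarrow> \<exists>\<Psi>\<in>span2 G. \<forall>s t. ((\<lambda>s. \<Phi> s t) has_vector_derivative \<Psi> s t) (at s)"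
    and "\<And>\<Phi>. \<Phi> \<in> G \<Longrightarrow> \<exists>\<Psi>\<in>span2 G. \<forall>s t. (\<Phi> s has_vector_derivative \<Psi> s t) (at t)"
  shows "span2 G \<subseteq> schwartz2"
proof -
  have 1: "\<exists>C. \<forall>s t. norm (\<Phi> s t) \<le> C" if "\<Phi> \<in> span2 G" for \<Phi>
    using that
  proof induction
    case (add \<Phi> \<Psi>)
    then obtain C D where "\<forall>s t. norm (\<Phi> s t) \<le> C" "\<forall>s t. norm (\<Psi> s t) \<le> D" by blast
    then show ?case by (meson add_mono norm_triangle_le)
  qed (rule assms)
  have 2: "(\<lambda>s t. s *\<^sub>R \<Phi> s t) \<in> span2 G" if "\<Phi> \<in> span2 G" for \<Phi>
    using that by induction (simp_all add: assms scaleR_add_right span2.add)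
  have 3: "(\<lambda>s t. t *\<^sub>R \<Phi> s t) \<in> span2 G" if "\<Phi> \<in> span2 G" for \<Phi>
    using that by induction (simp_all add: assms scaleR_add_right span2.add)
  have 4: "\<exists>\<Psi>\<in>span2 G. \<forall>s t. ((\<lambda>s. \<Phi> s t) has_vector_derivative \<Psi> s t) (at s)" if "\<Phi> \<in> span2 G" for \<Phi>
    using that
  proof induction
    case (add \<Phi> \<Psi>)
    then obtain \<Phi>' \<Psi>' where *: "\<Phi>' \<in> span2 G" "\<forall>s t. ((\<lambda>s. \<Phi> s t) has_vector_derivative \<Phi>' s t) (at s)"
      "\<Psi>' \<in> span2 G" "\<forall>s t. ((\<lambda>s. \<Psi> s t) has_vector_derivative \<Psi>' s t) (at s)" by blast
    then show ?case
      by (intro bexI[OF _ span2.add[OF *(1,3)]]) (simp_all add: has_vector_derivative_add)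
  qed (rule assms)
  have 5: "\<exists>\<Psi>\<in>span2 G. \<forall>s t. (\<Phi> s has_vector_derivative \<Psi> s t) (at t)" if "\<Phi> \<in> span2 G" for \<Phi>
    using that
  proof induction
    case (add \<Phi> \<Psi>)
    then obtain \<Phi>' \<Psi>' where *: "\<Phi>' \<in> span2 G" "\<forall>s t. (\<Phi> s has_vector_derivative \<Phi>' s t) (at t)"
      "\<Psi>' \<in> span2 G" "\<forall>s t. (\<Psi> s has_vector_derivative \<Psi>' s t) (at t)" by blast
    then show ?case
      by (intro bexI[OF _ span2.add[OF *(1,3)]]) (simp_all add: has_vector_derivative_add)
  qed (rule assms)
  show ?thesis
    unfolding schwartz2_def
    by (rule subsetI, rule CollectI, rule exI[of _ "span2 G"]) (intro conjI ballI 1 2 3 4 5; assumption)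
qed

lemma span2_subset_schwartz2_indexed:
  assumes "\<And>p. p \<in> P \<Longrightarrow> \<exists>C. \<forall>s t. norm (\<Phi> p s t) \<le> C"
    and "\<And>p. p \<in> P \<Longrightarrow> (\<lambda>s t. s *\<^sub>R \<Phi> p s t) \<in> span2 (\<Phi> ` P)"
    and "\<And>p. p \<in> P \<Longrightarrow> (\<lambda>s t. t *\<^sub>R \<Phi> p s t) \<in> span2 (\<Phi> ` P)"
    and "\<And>p. p \<in> P \<Longrightarrow> \<exists>\<Psi>\<in>span2 (\<Phi> ` P). \<forall>s t. ((\<lambda>s. \<Phi> p s t) has_vector_derivative \<Psi> s t) (at s)"
    and "\<And>p. p \<in> P \<Longrightarrow> \<exists>\<Psi>\<in>span2 (\<Phi> ` P). \<forall>s t. (\<Phi> p s has_vector_derivative \<Psi> s t) (at t)"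
  shows "span2 (\<Phi> ` P) \<subseteq> schwartz2"
  by (rule span2_subset_schwartz2) (use assms in blast)+

text \<open>Two members of \<open>schwartz2\<close> may come from different invariant sets. The sums
  of scalar multiples of all members form one invariant set that contains both, which yields closure
  under sums and multiples.\<close>

lemma schwartz2_lincomb_span:
  "span2 ((\<lambda>(z, \<Phi>) s t. z * \<Phi> s t) ` (UNIV \<times> schwartz2)) \<subseteq> schwartz2"
proof (rule span2_subset_schwartz2_indexed)
  let ?U = "\<lambda>(z, \<Phi>) s t. z * \<Phi> s t :: complex"
  have base: "(\<lambda>s t. z * \<Phi> s t) \<in> span2 (?U ` (UNIV \<times> schwartz2))" if "\<Phi> \<in> schwartz2" for z \<Phi>
    using that by (intro span2.base image_eqI[of _ _ "(z, \<Phi>)"]) auto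
  fix p :: "complex \<times> (real \<Rightarrow> real \<Rightarrow> complex)" assume "p \<in> UNIV \<times> schwartz2"
  then obtain z \<Phi> where p: "p = (z, \<Phi>)" "\<Phi> \<in> schwartz2" by auto
  obtain C where "\<And>s t. norm (\<Phi> s t) \<le> C"
    using schwartz2_bounded[OF p(2)] by blast
  then have "norm (z * \<Phi> s t) \<le> norm z * C" for s t
    by (simp add: norm_mult mult_left_mono)
  then show "\<exists>C. \<forall>s t. norm (?U p s t) \<le> C"
    by (auto simp: p)
  show "(\<lambda>s t. s *\<^sub>R ?U p s t) \<in> span2 (?U ` (UNIV \<times> schwartz2))"
    using base[OF schwartz2_mult1[OF p(2)]] by (simp add: p)
  show "(\<lambda>s t. t *\<^sub>R ?U p s t) \<in> span2 (?U ` (UNIV \<times> schwartz2))"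
    using base[OF schwartz2_mult2[OF p(2)]] by (simp add: p)
  obtain \<Psi> where "\<Psi> \<in> schwartz2" "\<And>s t. ((\<lambda>s. \<Phi> s t) has_vector_derivative \<Psi> s t) (at s)"
    using schwartz2_deriv1[OF p(2)] by blast
  then show "\<exists>\<Psi>\<in>span2 (?U ` (UNIV \<times> schwartz2)). \<forall>s t. ((\<lambda>s. ?U p s t) has_vector_derivative \<Psi> s t) (at s)"
    using base[of \<Psi> z] by (intro bexI[of _ "\<lambda>s t. z * \<Psi> s t"]) (simp_all add: p has_vector_derivative_mult_right)
  obtain \<Psi> where "\<Psi> \<in> schwartz2" "\<And>s t. (\<Phi> s has_vector_derivative \<Psi> s t) (at t)"
    using schwartz2_deriv2[OF p(2)] by blast
  then show "\<exists>\<Psi>\<in>span2 (?U ` (UNIV \<times> schwartz2)). \<forall>s t. (?U p s has_vector_derivative \<Psi> s t) (at t)"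
    using base[of \<Psi> z] by (intro bexI[of _ "\<lambda>s t. z * \<Psi> s t"]) (simp_all add: p has_vector_derivative_mult_right)
qed

lemma schwartz2_cmult: "\<Phi> \<in> schwartz2 \<Longrightarrow> (\<lambda>s t. z * \<Phi> s t) \<in> schwartz2"
  by (rule subsetD[OF schwartz2_lincomb_span], rule span2.base, rule image_eqI[of _ _ "(z, \<Phi>)"]) auto

lemma schwartz2_add:
  assumes "\<Phi> \<in> schwartz2" "\<Psi> \<in> schwartz2" shows "(\<lambda>s t. \<Phi> s t + \<Psi> s t) \<in> schwartz2"
proof -
  have "\<Phi> \<in> span2 ((\<lambda>(z, \<Phi>) s t. z * \<Phi> s t) ` (UNIV \<times> schwartz2))" if "\<Phi> \<in> schwartz2" for \<Phi>
    using that by (intro span2.base image_eqI[of _ _ "(1, \<Phi>)"]) auto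
  from span2.add[OF this this, OF assms] show ?thesis
    using schwartz2_lincomb_span by blast
qed

text \<open>The integrand of Fourier inversion times a window, with s as frequency. The plane wave
  alone does not decay in s; \<beta>, later a reflected Fourier transform, supplies that decay.
  Differentiating the wave produces a factor s or t, which is given to \<beta> or \<alpha>.\<close>

lemma schwartz2_wave:
  assumes "\<alpha> \<in> schwartz" "\<beta> \<in> schwartz"
  shows "(\<lambda>s t. \<alpha> t * exp (- (\<i> * of_real (2 * pi * s * t))) * \<beta> s) \<in> schwartz2"
proof -
  let ?U = "\<lambda>p s t. fst p t * exp (- (\<i> * of_real (2 * pi * s * t))) * snd p s :: complex"
  let ?S = "span2 (?U ` (schwartz \<times> schwartz))"
  have base: "(\<lambda>s t. \<alpha> t * exp (- (\<i> * of_real (2 * pi * s * t))) * \<beta> s) \<in> ?S"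
    if "\<alpha> \<in> schwartz" "\<beta> \<in> schwartz" for \<alpha> \<beta>
    using that by (intro span2.base image_eqI[of _ _ "(\<alpha>, \<beta>)"]) auto
  have "?S \<subseteq> schwartz2"
  proof (rule span2_subset_schwartz2_indexed)
    fix p :: "(real \<Rightarrow> complex) \<times> (real \<Rightarrow> complex)" assume "p \<in> schwartz \<times> schwartz"
    then obtain \<alpha> \<beta> where p: "p = (\<alpha>, \<beta>)" "\<alpha> \<in> schwartz" "\<beta> \<in> schwartz" by auto
    let ?e = "\<lambda>s t. exp (- (\<i> * complex_of_real (2 * pi * s * t)))"
    have "norm (?U p s t) \<le> schwartz_seminorm 0 0 \<alpha> * schwartz_seminorm 0 0 \<beta>" for s t
      unfolding p(1) norm_mult norm_cis fst_conv snd_conv mult_1_right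
      by (intro mult_mono norm_le_seminorm0 seminorm_nonneg norm_ge_zero p(2,3))
    then show "\<exists>C. \<forall>s t. norm (?U p s t) \<le> C" by blast
    show "(\<lambda>s t. s *\<^sub>R ?U p s t) \<in> ?S"
      using base[OF p(2) schwartz_mult[OF p(3)]] by (simp add: p)
    show "(\<lambda>s t. t *\<^sub>R ?U p s t) \<in> ?S"
      using base[OF schwartz_mult[OF p(2)] p(3)] by (simp add: p)
    have e: "((\<lambda>s. ?e s t) has_vector_derivative - (2 * pi * \<i>) * of_real t * ?e s t) (at s)" for s t
    proof -
      have "((\<lambda>s. - (2 * pi * s * t)) has_real_derivative - (2 * pi * t)) (at s)"
        by (auto intro!: derivative_eq_intros)
      from has_vector_derivative_cis[OF this] show ?thesis by (simp add: mult_ac)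
    qed
    have e': "(?e s has_vector_derivative - (2 * pi * \<i>) * of_real s * ?e s t) (at t)" for s t
      using e[where s = t and t = s] by (simp add: mult.commute mult.left_commute)
    have d1: "((\<lambda>s. ?U p s t) has_vector_derivative
        \<alpha> t * ?e s t * deriv1 \<beta> s + (- (2 * pi * \<i>) * (t *\<^sub>R \<alpha> t)) * ?e s t * \<beta> s) (at s)" for s t
      using has_vector_derivative_mult[OF has_vector_derivative_mult_right[OF e, of "\<alpha> t"] schwartz_has_deriv[OF p(3)], of t s]
      by (simp add: p scaleR_conv_of_real mult_ac)
    show "\<exists>\<Psi>\<in>?S. \<forall>s t. ((\<lambda>s. ?U p s t) has_vector_derivative \<Psi> s t) (at s)"
      by (rule bexI[OF _ span2.add[OF base base]], intro allI, rule d1)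
        (intro schwartz_deriv schwartz_cmult schwartz_mult p)+
    have d2: "(?U p s has_vector_derivative
        deriv1 \<alpha> t * ?e s t * \<beta> s + (- (2 * pi * \<i>) * \<alpha> t) * ?e s t * (s *\<^sub>R \<beta> s)) (at t)" for s t
      using has_vector_derivative_mult_left[OF has_vector_derivative_mult[OF schwartz_has_deriv[OF p(2), of t] e'[of s t]], where a = "\<beta> s"]
      by (simp add: p scaleR_conv_of_real algebra_simps)
    show "\<exists>\<Psi>\<in>?S. \<forall>s t. (?U p s has_vector_derivative \<Psi> s t) (at t)"
      by (rule bexI[OF _ span2.add[OF base base]], intro allI, rule d2)
        (intro schwartz_deriv schwartz_cmult schwartz_mult p)+
  qed
  with base[OF assms] show ?thesis by blast
qed

lemma has_vector_derivative_translate: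
  assumes "\<alpha> \<in> schwartz"
  shows "((\<lambda>s. \<alpha> (t - s)) has_vector_derivative (-1) * deriv1 \<alpha> (t - s)) (at s)"
    and "((\<lambda>t. \<alpha> (t - s)) has_vector_derivative deriv1 \<alpha> (t - s)) (at t)"
  using has_vector_derivative_affine[OF assms, of "-1" t s] has_vector_derivative_affine[OF assms, of 1 "-s" t]
  by simp_all

text \<open>The first family is the partition of a Schwartz function by translates of a window. The
  second, with the other factor depending on the parameter, is used for continuity in the position
  of the window.\<close>

lemma schwartz2_translate:
  assumes "\<alpha> \<in> schwartz" "\<beta> \<in> schwartz"
  shows "(\<lambda>s t. \<alpha> (t - s) * \<beta> t) \<in> schwartz2" and "(\<lambda>s t. \<alpha> (t - s) * \<beta> s) \<in> schwartz2"
proof -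
  let ?U = "\<lambda>p s t. fst p (t - s) * snd p t :: complex"
  let ?S = "span2 (?U ` (schwartz \<times> schwartz))"
  have base: "(\<lambda>s t. \<alpha> (t - s) * \<beta> t) \<in> ?S" if "\<alpha> \<in> schwartz" "\<beta> \<in> schwartz" for \<alpha> \<beta>
    using that by (intro span2.base image_eqI[of _ _ "(\<alpha>, \<beta>)"]) auto
  have "?S \<subseteq> schwartz2"
  proof (rule span2_subset_schwartz2_indexed)
    fix p :: "(real \<Rightarrow> complex) \<times> (real \<Rightarrow> complex)" assume "p \<in> schwartz \<times> schwartz"
    then obtain \<alpha> \<beta> where p: "p = (\<alpha>, \<beta>)" "\<alpha> \<in> schwartz" "\<beta> \<in> schwartz" by auto
    have "norm (?U p s t) \<le> schwartz_seminorm 0 0 \<alpha> * schwartz_seminorm 0 0 \<beta>" for s t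
      unfolding p(1) norm_mult fst_conv snd_conv
      by (intro mult_mono norm_le_seminorm0 seminorm_nonneg norm_ge_zero p(2,3))
    then show "\<exists>C. \<forall>s t. norm (?U p s t) \<le> C" by blast
    \<comment> \<open>Decay in s comes from s = t - (t - s): the factor t goes to \<beta>, the
      factor t - s to \<alpha>.\<close>
    have "(\<lambda>s t. \<alpha> (t - s) * (t *\<^sub>R \<beta> t) + (-1) * ((t - s) *\<^sub>R \<alpha> (t - s)) * \<beta> t) \<in> ?S"
      by (rule span2.add[OF base base]) (intro schwartz_cmult schwartz_mult p)+
    then show "(\<lambda>s t. s *\<^sub>R ?U p s t) \<in> ?S"
      by (simp add: p scaleR_conv_of_real algebra_simps)
    show "(\<lambda>s t. t *\<^sub>R ?U p s t) \<in> ?S"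
      using base[OF p(2) schwartz_mult[OF p(3)]] by (simp add: p)
    have d1: "((\<lambda>s. ?U p s t) has_vector_derivative (-1) * deriv1 \<alpha> (t - s) * \<beta> t) (at s)" for s t
      using has_vector_derivative_mult[OF has_vector_derivative_translate(1)[OF p(2)] has_vector_derivative_const]
      by (simp add: p)
    show "\<exists>\<Psi>\<in>?S. \<forall>s t. ((\<lambda>s. ?U p s t) has_vector_derivative \<Psi> s t) (at s)"
      by (rule bexI[OF _ base], intro allI, rule d1) (intro schwartz_deriv schwartz_cmult p)+
    have d2: "(?U p s has_vector_derivative
        \<alpha> (t - s) * deriv1 \<beta> t + deriv1 \<alpha> (t - s) * \<beta> t) (at t)" for s t
      using has_vector_derivative_mult[OF has_vector_derivative_translate(2)[OF p(2)] schwartz_has_deriv[OF p(3)]]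
      by (simp add: p)
    show "\<exists>\<Psi>\<in>?S. \<forall>s t. (?U p s has_vector_derivative \<Psi> s t) (at t)"
      by (rule bexI[OF _ span2.add[OF base base]], intro allI, rule d2)
        (intro schwartz_deriv p)+
  qed
  with base[OF assms] show "(\<lambda>s t. \<alpha> (t - s) * \<beta> t) \<in> schwartz2" by blast
next
  let ?U = "\<lambda>p s t. fst p (t - s) * snd p s :: complex"
  let ?S = "span2 (?U ` (schwartz \<times> schwartz))"
  have base: "(\<lambda>s t. \<alpha> (t - s) * \<beta> s) \<in> ?S" if "\<alpha> \<in> schwartz" "\<beta> \<in> schwartz" for \<alpha> \<beta>
    using that by (intro span2.base image_eqI[of _ _ "(\<alpha>, \<beta>)"]) auto
  have "?S \<subseteq> schwartz2"
  proof (rule span2_subset_schwartz2_indexed)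
    fix p :: "(real \<Rightarrow> complex) \<times> (real \<Rightarrow> complex)" assume "p \<in> schwartz \<times> schwartz"
    then obtain \<alpha> \<beta> where p: "p = (\<alpha>, \<beta>)" "\<alpha> \<in> schwartz" "\<beta> \<in> schwartz" by auto
    have "norm (?U p s t) \<le> schwartz_seminorm 0 0 \<alpha> * schwartz_seminorm 0 0 \<beta>" for s t
      unfolding p(1) norm_mult fst_conv snd_conv
      by (intro mult_mono norm_le_seminorm0 seminorm_nonneg norm_ge_zero p(2,3))
    then show "\<exists>C. \<forall>s t. norm (?U p s t) \<le> C" by blast
    \<comment> \<open>Here t = s + (t - s), with s given to \<beta> and t - s to \<alpha>.\<close>
    have "(\<lambda>s t. \<alpha> (t - s) * (s *\<^sub>R \<beta> s) + ((t - s) *\<^sub>R \<alpha> (t - s)) * \<beta> s) \<in> ?S"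
      by (rule span2.add[OF base base]) (intro schwartz_cmult schwartz_mult p)+
    then show "(\<lambda>s t. t *\<^sub>R ?U p s t) \<in> ?S"
      by (simp add: p scaleR_conv_of_real algebra_simps)
    show "(\<lambda>s t. s *\<^sub>R ?U p s t) \<in> ?S"
      using base[OF p(2) schwartz_mult[OF p(3)]] by (simp add: p)
    have d1: "((\<lambda>s. ?U p s t) has_vector_derivative
        \<alpha> (t - s) * deriv1 \<beta> s + (-1) * deriv1 \<alpha> (t - s) * \<beta> s) (at s)" for s t
      using has_vector_derivative_mult[OF has_vector_derivative_translate(1)[OF p(2)] schwartz_has_deriv[OF p(3)]]
      by (simp add: p)
    show "\<exists>\<Psi>\<in>?S. \<forall>s t. ((\<lambda>s. ?U p s t) has_vector_derivative \<Psi> s t) (at s)"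
      by (rule bexI[OF _ span2.add[OF base base]], intro allI, rule d1) (intro schwartz_deriv schwartz_cmult p)+
    have d2: "(?U p s has_vector_derivative deriv1 \<alpha> (t - s) * \<beta> s) (at t)" for s t
      using has_vector_derivative_mult[OF has_vector_derivative_translate(2)[OF p(2)] has_vector_derivative_const]
      by (simp add: p)
    show "\<exists>\<Psi>\<in>?S. \<forall>s t. (?U p s has_vector_derivative \<Psi> s t) (at t)"
      by (rule bexI[OF _ base], intro allI, rule d2) (intro schwartz_deriv p)+
  qed
  with base[OF assms] show "(\<lambda>s t. \<alpha> (t - s) * \<beta> s) \<in> schwartz2" by blast
qed

lemma schwartz2_section:
  "\<Phi> \<in> schwartz2 \<Longrightarrow> \<Phi> s \<in> schwartz"
proof (rule schwartz_coinduct[where U = "\<lambda>\<Phi>. \<Phi> s" and P = schwartz2 and p = \<Phi>], goal_cases)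
  case (2 \<Phi>)
  then show ?case using schwartz2_bounded[of \<Phi>] by (auto simp: bounded_iff)
next
  case (3 \<Phi>)
  then show ?case using schwartz2_mult2[of \<Phi>] by (intro bexI[of _ "\<lambda>s t. t *\<^sub>R \<Phi> s t"]) auto
next
  case (4 \<Phi>)
  then show ?case using schwartz2_deriv2[of \<Phi>] by blast
qed

text \<open>The product is the section at s = 0 of the translated family, so the product rule for it
  has already been dealt with there.\<close>

lemma schwartz_prod [simp]:
  assumes "\<alpha> \<in> schwartz" "\<beta> \<in> schwartz" shows "(\<lambda>t. \<alpha> t * \<beta> t) \<in> schwartz"
  using schwartz2_section[OF schwartz2_translate(1)[OF assms], of 0] by simp

text \<open>Multiplying by 1 + s^2 stays in \<open>schwartz2\<close>, and boundedness of the product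
  is the claimed decay, uniformly in t.\<close>

lemma schwartz2_decay1:
  assumes "\<Phi> \<in> schwartz2" shows "\<exists>C\<ge>0. \<forall>s t. norm (\<Phi> s t) \<le> C / (1 + s\<^sup>2)"
proof -
  have "(\<lambda>s t. \<Phi> s t + s *\<^sub>R (s *\<^sub>R \<Phi> s t)) \<in> schwartz2"
    by (intro schwartz2_add[OF assms] schwartz2_mult1 assms)
  then obtain C where C: "norm (\<Phi> s t + s *\<^sub>R (s *\<^sub>R \<Phi> s t)) \<le> C" for s t
    using schwartz2_bounded by blast
  have "norm (\<Phi> s t) \<le> C / (1 + s\<^sup>2)" for s t
  proof -
    have pos: "0 < 1 + s\<^sup>2" by (simp add: add_pos_nonneg)
    have "(1 + s\<^sup>2) * norm (\<Phi> s t) = norm ((1 + s\<^sup>2) *\<^sub>R \<Phi> s t)"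
      using pos by simp
    also have "\<dots> \<le> C"
      using C[of s t] by (simp add: scaleR_add_left power2_eq_square)
    finally show ?thesis using pos by (simp add: field_simps)
  qed
  moreover have "C \<ge> 0" using C[of 0 0] norm_ge_zero order_trans by blast
  ultimately show ?thesis by blast
qed

lemma schwartz2_decay2:
  assumes "\<Phi> \<in> schwartz2" shows "\<exists>C\<ge>0. \<forall>s t. norm (\<Phi> s t) \<le> C / (1 + t\<^sup>2)"
proof -
  have "(\<lambda>s t. \<Phi> s t + t *\<^sub>R (t *\<^sub>R \<Phi> s t)) \<in> schwartz2"
    by (intro schwartz2_add[OF assms] schwartz2_mult2 assms)
  then obtain C where C: "norm (\<Phi> s t + t *\<^sub>R (t *\<^sub>R \<Phi> s t)) \<le> C" for s t
    using schwartz2_bounded by blast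
  have "norm (\<Phi> s t) \<le> C / (1 + t\<^sup>2)" for s t
  proof -
    have pos: "0 < 1 + t\<^sup>2" by (simp add: add_pos_nonneg)
    have "(1 + t\<^sup>2) * norm (\<Phi> s t) = norm ((1 + t\<^sup>2) *\<^sub>R \<Phi> s t)"
      using pos by simp
    also have "\<dots> \<le> C"
      using C[of s t] by (simp add: scaleR_add_left power2_eq_square)
    finally show ?thesis using pos by (simp add: field_simps)
  qed
  moreover have "C \<ge> 0" using C[of 0 0] norm_ge_zero order_trans by blast
  ultimately show ?thesis by blast
qed

lemma schwartz2_measurable:
  assumes "\<Phi> \<in> schwartz2" shows "(\<lambda>s. \<Phi> s t) \<in> borel_measurable borel"
proof -
  obtain \<Psi> where "\<And>s t. ((\<lambda>s. \<Phi> s t) has_vector_derivative \<Psi> s t) (at s)"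
    using schwartz2_deriv1[OF assms] by blast
  then have "continuous_on UNIV (\<lambda>s. \<Phi> s t)"
    by (meson continuous_at_imp_continuous_on has_vector_derivative_continuous)
  then show ?thesis by (rule borel_measurable_continuous_onI)
qed

section \<open>Partial integrals of families under tempered functionals\<close>

definition weighted_integral :: "(real \<Rightarrow> real) \<Rightarrow> (real \<Rightarrow> real \<Rightarrow> complex) \<Rightarrow> real \<Rightarrow> complex" where
  "weighted_integral \<theta> \<Phi> t = (\<integral>s. \<theta> s *\<^sub>R \<Phi> s t \<partial>lborel)"

text \<open>The weights that occur are indicators of half-lines, intervals and the whole line. The
  bound 1 makes every majorant of a family also one of the weighted family, so the constants do not
  depend on the weight.\<close>

definition unit_bounded :: "(real \<Rightarrow> real) set" where
  "unit_bounded = {\<theta>. \<theta> \<in> borel_measurable borel \<and> (\<forall>s. \<bar>\<theta> s\<bar> \<le> 1)}"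

lemma weighted_integrable:
  assumes "\<Phi> \<in> schwartz2" "\<theta> \<in> unit_bounded"
  shows "integrable lborel (\<lambda>s. \<theta> s *\<^sub>R \<Phi> s t)"
proof -
  obtain C where C: "0 \<le> C" "\<And>s t. norm (\<Phi> s t) \<le> C / (1 + s\<^sup>2)"
    using schwartz2_decay1[OF assms(1)] by blast
  show ?thesis
  proof (rule Bochner_Integration.integrable_bound)
    show "integrable lborel (\<lambda>s. C * (1 / (1 + s\<^sup>2)))"
      by (intro integrable_mult_right integrable_k0)
    have "norm (\<theta> s *\<^sub>R \<Phi> s t) \<le> C * (1 / (1 + s\<^sup>2))" for s
    proof -
      have "\<bar>\<theta> s\<bar> * norm (\<Phi> s t) \<le> 1 * (C / (1 + s\<^sup>2))"
        by (intro mult_mono C) (use assms(2) in \<open>auto simp: unit_bounded_def\<close>)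
      then show ?thesis by simp
    qed
    then show "AE s in lborel. norm (\<theta> s *\<^sub>R \<Phi> s t) \<le> norm (C * (1 / (1 + s\<^sup>2)))"
      using C(1) by (intro always_eventually allI) simp
    show "(\<lambda>s. \<theta> s *\<^sub>R \<Phi> s t) \<in> borel_measurable lborel"
      using assms(2) schwartz2_measurable[OF assms(1)] by (auto simp: unit_bounded_def)
  qed
qed

lemma weighted_integral_deriv:
  assumes \<Phi>: "\<Phi> \<in> schwartz2" "\<theta> \<in> unit_bounded" and \<Psi>: "\<Psi> \<in> schwartz2"
    and d: "\<And>s t. (\<Phi> s has_vector_derivative \<Psi> s t) (at t)"
  shows "(weighted_integral \<theta> \<Phi> has_vector_derivative weighted_integral \<theta> \<Psi> t) (at t)"
proof -
  obtain \<Xi> where \<Xi>: "\<Xi> \<in> schwartz2" "\<And>s t. (\<Psi> s has_vector_derivative \<Xi> s t) (at t)"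
    using schwartz2_deriv2[OF \<Psi>] by blast
  obtain C where C: "0 \<le> C" "\<And>s t. norm (\<Xi> s t) \<le> C / (1 + s\<^sup>2)"
    using schwartz2_decay1[OF \<Xi>(1)] by blast
  show ?thesis
    unfolding weighted_integral_def[abs_def]
  proof (rule deriv_under_integral)
    show "integrable lborel (\<lambda>s. C * (1 / (1 + s\<^sup>2)))"
      by (intro integrable_mult_right integrable_k0)
    show "((\<lambda>t. \<theta> s *\<^sub>R \<Phi> s t) has_vector_derivative \<theta> s *\<^sub>R \<Psi> s t) (at t)"
      "((\<lambda>t. \<theta> s *\<^sub>R \<Psi> s t) has_vector_derivative \<theta> s *\<^sub>R \<Xi> s t) (at t)" for s t
      using bounded_linear.has_vector_derivative[OF bounded_linear_scaleR_right d]
        bounded_linear.has_vector_derivative[OF bounded_linear_scaleR_right \<Xi>(2)] by blast+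
    show "norm (\<theta> s *\<^sub>R \<Xi> s t) \<le> C * (1 / (1 + s\<^sup>2))" for s t
    proof -
      have "\<bar>\<theta> s\<bar> * norm (\<Xi> s t) \<le> 1 * (C / (1 + s\<^sup>2))"
        by (intro mult_mono C) (use assms(2) in \<open>auto simp: unit_bounded_def\<close>)
      then show ?thesis by simp
    qed
  qed (intro weighted_integrable \<Phi> \<Psi>)+
qed

lemma norm_weighted_integral_le:
  assumes "\<And>s. norm (\<theta> s *\<^sub>R \<Phi> s t) \<le> w s" "integrable lborel w"
  shows "norm (weighted_integral \<theta> \<Phi> t) \<le> (\<integral>s. w s \<partial>lborel)"
proof -
  have "norm (weighted_integral \<theta> \<Phi> t) \<le> (\<integral>s. norm (\<theta> s *\<^sub>R \<Phi> s t) \<partial>lborel)"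
    unfolding weighted_integral_def by (rule integral_norm_bound)
  also have "\<dots> \<le> (\<integral>s. w s \<partial>lborel)"
    using assms by (intro Bochner_Integration.integral_mono') (auto intro: order_trans[OF norm_ge_zero] simp del: norm_scaleR)
  finally show ?thesis .
qed

lemma weighted_integral_schwartz:
  assumes "\<Phi> \<in> schwartz2" and \<theta>: "\<theta> \<in> unit_bounded"
  shows "weighted_integral \<theta> \<Phi> \<in> schwartz"
  using assms(1)
proof (rule schwartz_coinduct[where U = "weighted_integral \<theta>"], goal_cases)
  case (1 \<Phi>)
  obtain C where C: "0 \<le> C" "\<And>s t. norm (\<Phi> s t) \<le> C / (1 + s\<^sup>2)"
    using schwartz2_decay1[OF 1] by blast
  have "norm (\<theta> s *\<^sub>R \<Phi> s t) \<le> C * (1 / (1 + s\<^sup>2))" for s t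
  proof -
    have "\<bar>\<theta> s\<bar> * norm (\<Phi> s t) \<le> 1 * (C / (1 + s\<^sup>2))"
      by (intro mult_mono C) (use \<theta> in \<open>auto simp: unit_bounded_def\<close>)
    then show ?thesis by simp
  qed
  then have "norm (weighted_integral \<theta> \<Phi> t) \<le> (\<integral>s. C * (1 / (1 + s\<^sup>2)) \<partial>lborel)" for t
    by (intro norm_weighted_integral_le integrable_mult_right integrable_k0)
  then show ?case
    unfolding bounded_iff by blast
next
  case (2 \<Phi>)
  have "weighted_integral \<theta> (\<lambda>s t. t *\<^sub>R \<Phi> s t) t = t *\<^sub>R weighted_integral \<theta> \<Phi> t" for t
    unfolding weighted_integral_def scaleR_left_commute[of _ t] using weighted_integrable[OF 2 \<theta>] by (intro integral_scaleR_right)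
  then show ?case
    using schwartz2_mult2[OF 2] by (intro bexI[of _ "\<lambda>s t. t *\<^sub>R \<Phi> s t"]) auto
next
  case (3 \<Phi>)
  obtain \<Psi> where "\<Psi> \<in> schwartz2" "\<And>s t. (\<Phi> s has_vector_derivative \<Psi> s t) (at t)"
    using schwartz2_deriv2[OF 3] by blast
  with weighted_integral_deriv[OF 3 \<theta> this] show ?case by blast
qed

text \<open>One kernel \<Psi> represents t^k times the n-th derivative both for the sections and for
  all weighted integrals. Seminorm estimates for either thus reduce to pointwise estimates of a
  member of \<open>schwartz2\<close>.\<close>

lemma schwartz2_seminorm_kernel:
  assumes "\<Phi> \<in> schwartz2"
  obtains \<Psi> where "\<Psi> \<in> schwartz2" "\<And>s t. t ^ k *\<^sub>R nderiv n (\<Phi> s) t = \<Psi> s t"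
    "\<And>\<theta> t. \<theta> \<in> unit_bounded \<Longrightarrow> t ^ k *\<^sub>R nderiv n (weighted_integral \<theta> \<Phi>) t = weighted_integral \<theta> \<Psi> t"
proof -
  have "\<exists>\<Psi>\<in>schwartz2. (\<forall>s. nderiv n (\<Phi> s) = \<Psi> s) \<and>
      (\<forall>\<theta>\<in>unit_bounded. nderiv n (weighted_integral \<theta> \<Phi>) = weighted_integral \<theta> \<Psi>)"
  proof (induction n)
    case (Suc n)
    then obtain \<Psi> where \<Psi>: "\<Psi> \<in> schwartz2" "\<forall>s. nderiv n (\<Phi> s) = \<Psi> s"
      "\<forall>\<theta>\<in>unit_bounded. nderiv n (weighted_integral \<theta> \<Phi>) = weighted_integral \<theta> \<Psi>" by blast
    obtain \<Xi> where \<Xi>: "\<Xi> \<in> schwartz2" "\<And>s t. (\<Psi> s has_vector_derivative \<Xi> s t) (at t)"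
      using schwartz2_deriv2[OF \<Psi>(1)] by blast
    have "nderiv (Suc n) (\<Phi> s) t = \<Xi> s t" for s t
      unfolding nderiv_Suc using vector_derivative_at[OF \<Xi>(2)] \<Psi>(2) by simp
    moreover have "nderiv (Suc n) (weighted_integral \<theta> \<Phi>) t = weighted_integral \<theta> \<Xi> t"
      if "\<theta> \<in> unit_bounded" for \<theta> t
      unfolding nderiv_Suc using vector_derivative_at[OF weighted_integral_deriv[OF \<Psi>(1) that \<Xi>]] \<Psi>(3) that by simp
    ultimately show ?case using \<Xi>(1) by blast
  qed (use assms in auto)
  then obtain \<Psi> where \<Psi>: "\<Psi> \<in> schwartz2" "\<forall>s. nderiv n (\<Phi> s) = \<Psi> s"
      "\<forall>\<theta>\<in>unit_bounded. nderiv n (weighted_integral \<theta> \<Phi>) = weighted_integral \<theta> \<Psi>" by blast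
  have "(\<lambda>s t. t ^ k *\<^sub>R \<Psi> s t) \<in> schwartz2"
  proof (induction k)
    case (Suc k)
    from schwartz2_mult2[OF this] show ?case by simp
  qed (use \<Psi> in simp)
  moreover have "t ^ k *\<^sub>R weighted_integral \<theta> \<Psi> t = weighted_integral \<theta> (\<lambda>s t. t ^ k *\<^sub>R \<Psi> s t) t"
    if "\<theta> \<in> unit_bounded" for \<theta> t
    unfolding weighted_integral_def scaleR_left_commute[of _ "t ^ k"]
    using weighted_integrable[OF \<Psi>(1) that] by (intro integral_scaleR_right[symmetric])
  ultimately show ?thesis
    using \<Psi> by (intro that[of "\<lambda>s t. t ^ k *\<^sub>R \<Psi> s t"]) auto
qed

text \<open>Only finitely many seminorms enter a dominated functional, so bounds of order
  \<open>a i\<close> for each single seminorm, with constants uniform in i, add up to one such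
  bound. This is how rates in a parameter pass through a tempered functional.\<close>

lemma dominated_family:
  assumes q: "dominated q" and F: "\<And>i. i \<in> I \<Longrightarrow> F i \<in> schwartz" and a: "\<And>i. i \<in> I \<Longrightarrow> 0 \<le> a i"
    and K: "\<And>k n. \<exists>K. \<forall>i\<in>I. schwartz_seminorm k n (F i) \<le> K * a i"
  shows "\<exists>K\<ge>0. \<forall>i\<in>I. q (F i) \<le> K * a i"
proof -
  obtain C N where C: "0 \<le> C"
    "\<And>\<phi>. \<phi> \<in> schwartz \<Longrightarrow> q \<phi> \<le> C * (\<Sum>k\<le>N. \<Sum>n\<le>N. schwartz_seminorm k n \<phi>)"
    using q unfolding dominated_def by blast
  obtain K where K: "\<And>k n i. i \<in> I \<Longrightarrow> schwartz_seminorm k n (F i) \<le> K k n * a i"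
    using assms(4) by metis
  have "q (F i) \<le> (C * (\<Sum>k\<le>N. \<Sum>n\<le>N. \<bar>K k n\<bar>)) * a i" if i: "i \<in> I" for i
  proof -
    have "q (F i) \<le> C * (\<Sum>k\<le>N. \<Sum>n\<le>N. schwartz_seminorm k n (F i))"
      by (rule C(2)[OF F[OF i]])
    also have "\<dots> \<le> C * (\<Sum>k\<le>N. \<Sum>n\<le>N. \<bar>K k n\<bar> * a i)"
      by (intro mult_left_mono sum_mono C(1) order_trans[OF K[OF i]] mult_right_mono a i) simp
    also have "\<dots> = (C * (\<Sum>k\<le>N. \<Sum>n\<le>N. \<bar>K k n\<bar>)) * a i"
      by (simp add: sum_distrib_right mult.assoc)
    finally show ?thesis .
  qed
  moreover have "0 \<le> C * (\<Sum>k\<le>N. \<Sum>n\<le>N. \<bar>K k n\<bar>)"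
    by (intro mult_nonneg_nonneg C sum_nonneg) simp
  ultimately show ?thesis by blast
qed

lemma weighted_seminorm_le:
  assumes "\<And>t. t ^ k *\<^sub>R nderiv n \<phi> t = weighted_integral \<theta> \<Psi> t"
    and "\<And>s t. norm (\<theta> s *\<^sub>R \<Psi> s t) \<le> w s" "integrable lborel w"
  shows "schwartz_seminorm k n \<phi> \<le> (\<integral>s. w s \<partial>lborel)"
  by (rule seminorm_le) (use norm_weighted_integral_le[OF assms(2,3)] in \<open>simp only: assms(1)\<close>)

text \<open>A weight supported where |s| is at least |u| gives a contribution of order 1 / (1 +
  u^2). Applied to half-lines, it yields the limits of the antiderivative at both
  infinities.\<close>

lemma tempered_weighted_bound:
  assumes T: "T \<in> tempered" and \<Phi>: "\<Phi> \<in> schwartz2"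
  shows "\<exists>K\<ge>0. \<forall>\<theta> u. \<theta> \<in> unit_bounded \<longrightarrow> (\<forall>s. \<theta> s \<noteq> 0 \<longrightarrow> u\<^sup>2 \<le> s\<^sup>2) \<longrightarrow>
    norm (T (weighted_integral \<theta> \<Phi>)) \<le> K * (1 / (1 + u\<^sup>2))"
proof -
  let ?I = "{(\<theta>, u::real). \<theta> \<in> unit_bounded \<and> (\<forall>s. \<theta> s \<noteq> 0 \<longrightarrow> u\<^sup>2 \<le> s\<^sup>2)}"
  let ?F = "\<lambda>p. weighted_integral (fst p) \<Phi>"
  let ?a = "\<lambda>p. 1 / (1 + (snd p)\<^sup>2)"
  have "\<exists>K\<ge>0. \<forall>i\<in>?I. norm (T (?F i)) \<le> K * ?a i"
  proof (rule dominated_family[OF tempered_dominated[OF T]])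
    show "?F i \<in> schwartz" if "i \<in> ?I" for i
      using that weighted_integral_schwartz[OF \<Phi>] by auto
    fix k n
    obtain \<Psi> where \<Psi>: "\<Psi> \<in> schwartz2" "\<And>s t. t ^ k *\<^sub>R nderiv n (\<Phi> s) t = \<Psi> s t"
      "\<And>\<theta> t. \<theta> \<in> unit_bounded \<Longrightarrow> t ^ k *\<^sub>R nderiv n (weighted_integral \<theta> \<Phi>) t = weighted_integral \<theta> \<Psi> t"
      by (rule schwartz2_seminorm_kernel[OF \<Phi>, where k = k and n = n], rule that)
    \<comment> \<open>The kernel decays like the square of 1 / (1 + s^2). One factor keeps the
      integral finite; the other is at most 1 / (1 + u^2) on the support of the weight.\<close>
    have "(\<lambda>s t. \<Psi> s t + s *\<^sub>R (s *\<^sub>R \<Psi> s t)) \<in> schwartz2"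
      by (intro schwartz2_add[OF \<Psi>(1)] schwartz2_mult1 \<Psi>)
    then obtain C where C: "C \<ge> 0" "\<And>s t. norm (\<Psi> s t + s *\<^sub>R (s *\<^sub>R \<Psi> s t)) \<le> C / (1 + s\<^sup>2)"
      using schwartz2_decay1 by blast
    have bd: "norm (\<theta> s *\<^sub>R \<Psi> s t) \<le> (C / (1 + u\<^sup>2)) * (1 / (1 + s\<^sup>2))" if "(\<theta>, u) \<in> ?I" for \<theta> u s t
    proof (cases "\<theta> s = 0")
      case False
      have pos: "0 < 1 + u\<^sup>2" by (simp add: add_pos_nonneg)
      have pos': "0 < 1 + s\<^sup>2" by (simp add: add_pos_nonneg)
      have "(1 + u\<^sup>2) * norm (\<Psi> s t) \<le> (1 + s\<^sup>2) * norm (\<Psi> s t)"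
        using that False by (intro mult_right_mono) auto
      also have "\<dots> = norm ((1 + s\<^sup>2) *\<^sub>R \<Psi> s t)"
        using pos' by simp
      also have "\<dots> \<le> C / (1 + s\<^sup>2)"
        using C(2)[of s t] by (simp add: scaleR_add_left power2_eq_square)
      finally have "norm (\<Psi> s t) \<le> C / (1 + s\<^sup>2) / (1 + u\<^sup>2)"
        by (subst pos_le_divide_eq[OF pos]) (simp only: mult.commute)
      then have "norm (\<Psi> s t) \<le> (C / (1 + u\<^sup>2)) * (1 / (1 + s\<^sup>2))"
        by (simp add: mult.commute)
      moreover have "\<bar>\<theta> s\<bar> * norm (\<Psi> s t) \<le> 1 * norm (\<Psi> s t)"
        using that by (intro mult_right_mono) (auto simp: unit_bounded_def)
      ultimately show ?thesis by simp
    qed (use C(1) in simp)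
    have "schwartz_seminorm k n (?F i) \<le> (C * (\<integral>s. 1 / (1 + s\<^sup>2) \<partial>lborel)) * ?a i" if i: "i \<in> ?I" for i
    proof -
      obtain \<theta> u where u: "i = (\<theta>, u)" "(\<theta>, u) \<in> ?I" using i by (cases i) auto
      have "schwartz_seminorm k n (weighted_integral \<theta> \<Phi>) \<le> (\<integral>s. (C / (1 + u\<^sup>2)) * (1 / (1 + s\<^sup>2)) \<partial>lborel)"
        using u by (intro weighted_seminorm_le[OF \<Psi>(3) bd] integrable_mult_right integrable_k0) auto
      then show ?thesis by (simp only: integral_mult_right_zero u fst_conv snd_conv) (simp add: mult_ac)
    qed
    then show "\<exists>K. \<forall>i\<in>?I. schwartz_seminorm k n (?F i) \<le> K * ?a i" by blast
  qed simp
  then show ?thesis by auto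
qed

lemma schwartz2_lipschitz1:
  assumes "\<Psi> \<in> schwartz2" shows "\<exists>L\<ge>0. \<forall>s s' t. norm (\<Psi> s t - \<Psi> s' t) \<le> L * \<bar>s - s'\<bar>"
proof -
  obtain \<Xi> where \<Xi>: "\<Xi> \<in> schwartz2" "\<And>s t. ((\<lambda>s. \<Psi> s t) has_vector_derivative \<Xi> s t) (at s)"
    using schwartz2_deriv1[OF assms] by blast
  obtain L where L: "\<And>s t. norm (\<Xi> s t) \<le> L"
    using schwartz2_bounded[OF \<Xi>(1)] by blast
  have "norm (\<Psi> s t - \<Psi> s' t) \<le> L * \<bar>s - s'\<bar>" for s s' t
    by (rule lipschitz_of_vector_derivative_bound[OF \<Xi>(2) L])
  moreover have "L \<ge> 0" using L[of 0 0] norm_ge_zero order_trans by blast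
  ultimately show ?thesis by blast
qed

lemma nderiv_diff:
  assumes "\<phi> \<in> schwartz" "\<psi> \<in> schwartz"
  shows "nderiv n (\<lambda>t. \<phi> t - \<psi> t) = (\<lambda>t. nderiv n \<phi> t - nderiv n \<psi> t)"
  using nderiv_add[OF assms(1) schwartz_cmult[OF assms(2), of "-1"], of n] nderiv_cmult[OF assms(2), of n "-1"]
  by simp

lemma tempered_section_bound:
  assumes T: "T \<in> tempered" and \<Phi>: "\<Phi> \<in> schwartz2"
  shows "\<exists>K\<ge>0. \<forall>s. norm (T (\<Phi> s)) \<le> K * (1 / (1 + s\<^sup>2))"
proof -
  have "\<exists>K\<ge>0. \<forall>s\<in>UNIV. norm (T (\<Phi> s)) \<le> K * (1 / (1 + s\<^sup>2))"
  proof (rule dominated_family[OF tempered_dominated[OF T]])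
    fix k n
    obtain \<Psi> where \<Psi>: "\<Psi> \<in> schwartz2" "\<And>s t. t ^ k *\<^sub>R nderiv n (\<Phi> s) t = \<Psi> s t"
      "\<And>\<theta> t. \<theta> \<in> unit_bounded \<Longrightarrow> t ^ k *\<^sub>R nderiv n (weighted_integral \<theta> \<Phi>) t = weighted_integral \<theta> \<Psi> t"
      by (rule schwartz2_seminorm_kernel[OF \<Phi>, where k = k and n = n], rule that)
    obtain C where "\<And>s t. norm (\<Psi> s t) \<le> C / (1 + s\<^sup>2)"
      using schwartz2_decay1[OF \<Psi>(1)] by blast
    then have "schwartz_seminorm k n (\<Phi> s) \<le> C * (1 / (1 + s\<^sup>2))" for s
      by (intro seminorm_le) (simp only: \<Psi>(2) times_divide_eq_right mult_1_right)
    then show "\<exists>K. \<forall>s\<in>UNIV. schwartz_seminorm k n (\<Phi> s) \<le> K * (1 / (1 + s\<^sup>2))" by blast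
  qed (use schwartz2_section[OF \<Phi>] in auto)
  then show ?thesis by simp
qed

text \<open>Every kernel \<Psi> belonging to a seminorm is Lipschitz in s uniformly in t, so each
  seminorm of the difference of two sections is of order |s - s'|.\<close>

lemma tempered_section_lipschitz:
  assumes T: "T \<in> tempered" and \<Phi>: "\<Phi> \<in> schwartz2"
  shows "\<exists>K\<ge>0. \<forall>s s'. norm (T (\<Phi> s) - T (\<Phi> s')) \<le> K * \<bar>s - s'\<bar>"
proof -
  have "\<exists>K\<ge>0. \<forall>p\<in>UNIV. norm (T (\<lambda>t. \<Phi> (fst p) t - \<Phi> (snd p) t)) \<le> K * \<bar>fst p - snd p\<bar>"
  proof (rule dominated_family[OF tempered_dominated[OF T]])
    fix k n
    obtain \<Psi> where \<Psi>: "\<Psi> \<in> schwartz2" "\<And>s t. t ^ k *\<^sub>R nderiv n (\<Phi> s) t = \<Psi> s t"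
      "\<And>\<theta> t. \<theta> \<in> unit_bounded \<Longrightarrow> t ^ k *\<^sub>R nderiv n (weighted_integral \<theta> \<Phi>) t = weighted_integral \<theta> \<Psi> t"
      by (rule schwartz2_seminorm_kernel[OF \<Phi>, where k = k and n = n], rule that)
    obtain L where L: "\<And>s s' t. norm (\<Psi> s t - \<Psi> s' t) \<le> L * \<bar>s - s'\<bar>"
      using schwartz2_lipschitz1[OF \<Psi>(1)] by blast
    have "schwartz_seminorm k n (\<lambda>t. \<Phi> s t - \<Phi> s' t) \<le> L * \<bar>s - s'\<bar>" for s s'
      by (rule seminorm_le)
        (simp only: nderiv_diff[OF schwartz2_section[OF \<Phi>] schwartz2_section[OF \<Phi>]] scaleR_diff_right \<Psi>(2) L)
    then show "\<exists>K. \<forall>p\<in>UNIV. schwartz_seminorm k n (\<lambda>t. \<Phi> (fst p) t - \<Phi> (snd p) t) \<le> K * \<bar>fst p - snd p\<bar>" by blast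
  qed (use schwartz2_section[OF \<Phi>] in auto)
  then show ?thesis
    by (simp add: tempered_diff[OF T schwartz2_section[OF \<Phi>] schwartz2_section[OF \<Phi>]])
qed

lemma isCont_tempered_section:
  assumes T: "T \<in> tempered" and \<Phi>: "\<Phi> \<in> schwartz2"
  shows "isCont (\<lambda>s. T (\<Phi> s)) u"
proof -
  obtain K where K: "\<And>s s'. norm (T (\<Phi> s) - T (\<Phi> s')) \<le> K * \<bar>s - s'\<bar>"
    using tempered_section_lipschitz[OF T \<Phi>] by blast
  have "((\<lambda>s. K * \<bar>s - u\<bar>) \<longlongrightarrow> K * \<bar>u - u\<bar>) (at u)"
    by (intro tendsto_intros)
  then have "((\<lambda>s. K * \<bar>s - u\<bar>) \<longlongrightarrow> 0) (at u)" by simp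
  then have "((\<lambda>s. T (\<Phi> s) - T (\<Phi> u)) \<longlongrightarrow> 0) (at u)"
    by (rule Lim_null_comparison[rotated]) (intro always_eventually allI K)
  then show ?thesis unfolding isCont_def by (rule LIM_zero_cancel)
qed

lemma unit_bounded_indicator: "A \<in> sets borel \<Longrightarrow> indicator A \<in> unit_bounded"
  by (auto simp: unit_bounded_def indicator_def)

text \<open>On an interval of length v - u the kernels differ from their value at w by at most L (v
  - u), and integrating gives the square. The base point w may be any point of the interval, so that
  increments to the right and to the left of a point are both covered.\<close>

lemma tempered_local_bound:
  assumes T: "T \<in> tempered" and \<Phi>: "\<Phi> \<in> schwartz2"
  shows "\<exists>K\<ge>0. \<forall>u w v. u \<le> w \<longrightarrow> w \<le> v \<longrightarrow>
    norm (T (weighted_integral (indicator {u<..v}) \<Phi>) - of_real (v - u) * T (\<Phi> w)) \<le> K * (v - u)\<^sup>2"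
proof -
  let ?I = "{(u, w, v). u \<le> w \<and> w \<le> (v::real)}"
  let ?J = "\<lambda>u v. weighted_integral (indicator {u<..v})"
  let ?F = "\<lambda>(u, w, v) t. ?J u v \<Phi> t - of_real (v - u) * \<Phi> w t"
  let ?a = "\<lambda>(u, w, v::real). (v - u)\<^sup>2"
  note ub = unit_bounded_indicator[OF greaterThanAtMost_borel]
  have J: "?J u v \<Phi> \<in> schwartz" for u v
    by (rule weighted_integral_schwartz[OF \<Phi> ub])
  have *: "\<exists>K\<ge>0. \<forall>i\<in>?I. norm (T (?F i)) \<le> K * ?a i"
  proof (rule dominated_family[OF tempered_dominated[OF T]])
    show "?F i \<in> schwartz" for i
      using J schwartz2_section[OF \<Phi>] by (cases i) auto
    fix k n
    obtain \<Psi> where \<Psi>: "\<Psi> \<in> schwartz2" "\<And>s t. t ^ k *\<^sub>R nderiv n (\<Phi> s) t = \<Psi> s t"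
      "\<And>\<theta> t. \<theta> \<in> unit_bounded \<Longrightarrow> t ^ k *\<^sub>R nderiv n (weighted_integral \<theta> \<Phi>) t = weighted_integral \<theta> \<Psi> t"
      by (rule schwartz2_seminorm_kernel[OF \<Phi>, where k = k and n = n], rule that)
    obtain L where L: "L \<ge> 0" "\<And>s s' t. norm (\<Psi> s t - \<Psi> s' t) \<le> L * \<bar>s - s'\<bar>"
      using schwartz2_lipschitz1[OF \<Psi>(1)] by blast
    have "schwartz_seminorm k n (?F (u, w, v)) \<le> L * (v - u)\<^sup>2" if "u \<le> w" "w \<le> v" for u w v
    proof (rule seminorm_le)
      fix t
      have fin: "integrable lborel (indicator {u<..v} :: real \<Rightarrow> real)"
        by (intro integrable_real_indicator emeasure_bounded_finite) auto
      have "nderiv n (?F (u, w, v)) t = nderiv n (?J u v \<Phi>) t - of_real (v - u) * nderiv n (\<Phi> w) t"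
        using nderiv_diff[OF J schwartz_cmult[OF schwartz2_section[OF \<Phi>]], of n u v "of_real (v - u)" w]
          nderiv_cmult[OF schwartz2_section[OF \<Phi>], of n "of_real (v - u)" w] by simp
      then have "t ^ k *\<^sub>R nderiv n (?F (u, w, v)) t = ?J u v \<Psi> t - (v - u) *\<^sub>R \<Psi> w t"
        by (simp only: scaleR_diff_right scaleR_conv_of_real[of "v - u"] \<Psi>(2) \<Psi>(3)[OF ub] flip: mult_scaleR_right)
      also have "\<dots> = (\<integral>s. indicator {u<..v} s *\<^sub>R \<Psi> s t \<partial>lborel) - (\<integral>s. indicator {u<..v} s *\<^sub>R \<Psi> w t \<partial>lborel)"
        using that by (simp add: weighted_integral_def)
      also have "\<dots> = (\<integral>s. indicator {u<..v} s *\<^sub>R \<Psi> s t - indicator {u<..v} s *\<^sub>R \<Psi> w t \<partial>lborel)"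
        using fin by (intro Bochner_Integration.integral_diff[symmetric] weighted_integrable \<Psi> ub integrable_scaleR_left)
      finally have "norm (t ^ k *\<^sub>R nderiv n (?F (u, w, v)) t) \<le>
          (\<integral>s. norm (indicator {u<..v} s *\<^sub>R \<Psi> s t - indicator {u<..v} s *\<^sub>R \<Psi> w t) \<partial>lborel)"
        by (simp only: integral_norm_bound)
      also have "\<dots> \<le> (\<integral>s. indicator {u<..v} s * (L * (v - u)) \<partial>lborel)"
      proof (rule Bochner_Integration.integral_mono')
        show "integrable lborel (\<lambda>s. indicator {u<..v} s * (L * (v - u)))"
          using fin by simp
        show "norm (indicator {u<..v} s *\<^sub>R \<Psi> s t - indicator {u<..v} s *\<^sub>R \<Psi> w t) \<le> indicator {u<..v} s * (L * (v - u))" for s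
        proof (cases "s \<in> {u<..v}")
          case True
          then have "norm (\<Psi> s t - \<Psi> w t) \<le> L * (v - u)"
            using that by (intro order_trans[OF L(2)] mult_left_mono L) auto
          with True show ?thesis by simp
        qed simp
      qed (use L that in auto)
      also have "\<dots> = L * (v - u)\<^sup>2"
        using that by (simp add: power2_eq_square)
      finally show "norm (t ^ k *\<^sub>R nderiv n (?F (u, w, v)) t) \<le> L * (v - u)\<^sup>2" .
    qed
    then show "\<exists>K. \<forall>i\<in>?I. schwartz_seminorm k n (?F i) \<le> K * ?a i" by (intro exI[of _ L]) auto
  qed auto
  have F: "T (?F (u, w, v)) = T (?J u v \<Phi>) - of_real (v - u) * T (\<Phi> w)" for u w v
    using tempered_diff[OF T J schwartz_cmult[OF schwartz2_section[OF \<Phi>]], of u v "of_real (v - u)" w]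
      tempered_cmult[OF T schwartz2_section[OF \<Phi>], of "of_real (v - u)" w] by simp
  from * obtain K where K: "K \<ge> 0 \<and> (\<forall>i\<in>?I. norm (T (?F i)) \<le> K * ?a i)" by (rule exE)
  have "norm (T (?J u v \<Phi>) - of_real (v - u) * T (\<Phi> w)) \<le> K * (v - u)\<^sup>2" if "u \<le> w" "w \<le> v" for u w v
    using bspec[OF conjunct2[OF K], of "(u, w, v)"] that unfolding F by simp
  then show ?thesis
    by (intro exI[of _ K] conjI conjunct1[OF K] allI impI)
qed

lemma weighted_integral_diff:
  assumes "\<Phi> \<in> schwartz2" "\<theta> \<in> unit_bounded" "\<theta>' \<in> unit_bounded"
  shows "weighted_integral (\<lambda>s. \<theta> s - \<theta>' s) \<Phi> = (\<lambda>t. weighted_integral \<theta> \<Phi> t - weighted_integral \<theta>' \<Phi> t)"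
  unfolding weighted_integral_def scaleR_diff_left
  using weighted_integrable[OF assms(1,2)] weighted_integrable[OF assms(1,3)] by (intro ext Bochner_Integration.integral_diff)

text \<open>The tempered functional is only defined on Schwartz functions, so it cannot simply be moved
  under a Bochner integral; instead \<open>u \<mapsto> T (\<integral>\<^sub>s\<^sub>\<le>\<^sub>u \<Phi> s)\<close> is recognised as an antiderivative of
  \<open>u \<mapsto> T (\<Phi> u)\<close>.\<close>

theorem tempered_interchange:
  assumes T: "T \<in> tempered" and \<Phi>: "\<Phi> \<in> schwartz2"
  shows "T (\<lambda>t. \<integral>s. \<Phi> s t \<partial>lborel) = (\<integral>s. T (\<Phi> s) \<partial>lborel)"
proof -
  let ?J = "\<lambda>A. weighted_integral (indicator A) \<Phi>"
  have J: "?J A \<in> schwartz" if "A \<in> sets borel" for A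
    by (rule weighted_integral_schwartz[OF \<Phi> unit_bounded_indicator[OF that]])
  define G where "G = (\<lambda>u. T (?J {..u}))"
  have diff: "T (?J A) - T (?J B) = T (?J (A - B))" if "A \<in> sets borel" "B \<in> sets borel" "B \<subseteq> A" for A B
  proof -
    have "(\<lambda>s. indicator A s - indicator B s :: real) = indicator (A - B)"
      using that(3) by (auto simp: indicator_def fun_eq_iff)
    then have "?J (A - B) = (\<lambda>t. ?J A t - ?J B t)"
      using weighted_integral_diff[OF \<Phi> unit_bounded_indicator unit_bounded_indicator, OF that(1,2)] by simp
    then show ?thesis using tempered_diff[OF T J J, OF that(1,2)] by simp
  qed
  note cont = isCont_tempered_section[OF T \<Phi>]
  have int: "integrable lborel (\<lambda>s. T (\<Phi> s))"
  proof -
    obtain K where K: "K \<ge> 0" "\<And>s. norm (T (\<Phi> s)) \<le> K * (1 / (1 + s\<^sup>2))"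
      using tempered_section_bound[OF T \<Phi>] by blast
    have "(\<lambda>s. T (\<Phi> s)) \<in> borel_measurable borel"
      by (intro borel_measurable_continuous_onI continuous_at_imp_continuous_on ballI cont)
    then show ?thesis
      using K by (intro Bochner_Integration.integrable_bound[OF integrable_mult_right[OF integrable_k0, of K]])
        (auto intro!: always_eventually)
  qed
  have deriv: "(G has_vector_derivative T (\<Phi> u)) (at u)" for u
  proof -
    obtain K where "K \<ge> 0 \<and> (\<forall>u w v. u \<le> w \<longrightarrow> w \<le> v \<longrightarrow>
        norm (T (?J {u<..v}) - of_real (v - u) * T (\<Phi> w)) \<le> K * (v - u)\<^sup>2)"
      using tempered_local_bound[OF T \<Phi>] by (rule exE)
    note K = this[THEN conjunct2, rule_format]
    show ?thesis
    proof (rule has_vector_derivative_quadratic)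
      fix v
      show "norm (G v - G u - (v - u) *\<^sub>R T (\<Phi> u)) \<le> K * (v - u)\<^sup>2"
      proof (cases "u \<le> v")
        case True
        then have "{..v} - {..u} = {u<..v}" by auto
        with True have "G v - G u = T (?J {u<..v})"
          unfolding G_def by (subst diff) auto
        with K[of u u v] True show ?thesis by (simp add: scaleR_conv_of_real)
      next
        case False
        then have "{..u} - {..v} = {v<..u}" by auto
        with False have "G u - G v = T (?J {v<..u})"
          unfolding G_def by (subst diff) auto
        moreover have "norm (G v - G u - (v - u) *\<^sub>R T (\<Phi> u)) = norm (G u - G v - (u - v) *\<^sub>R T (\<Phi> u))"
          by (subst norm_minus_commute) (simp add: algebra_simps)
        \<comment> \<open>The base point u is now the right end of the interval, one of the choices
          that the local bound admits.\<close>
        moreover have "norm (T (?J {v<..u}) - of_real (u - v) * T (\<Phi> u)) \<le> K * (v - u)\<^sup>2"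
          using K[of v u u] False by (simp only: power2_commute[of v u] not_le less_imp_le order_refl)
        ultimately show ?thesis
          by (simp only: scaleR_conv_of_real of_real_diff)
      qed
    qed
  qed
  obtain K where "K \<ge> 0 \<and> (\<forall>\<theta> u. \<theta> \<in> unit_bounded \<longrightarrow> (\<forall>s. \<theta> s \<noteq> 0 \<longrightarrow> u\<^sup>2 \<le> s\<^sup>2) \<longrightarrow>
      norm (T (weighted_integral \<theta> \<Phi>)) \<le> K * (1 / (1 + u\<^sup>2)))"
    using tempered_weighted_bound[OF T \<Phi>] by (rule exE)
  note K = this[THEN conjunct1] this[THEN conjunct2, rule_format]
  have sq: "u\<^sup>2 \<le> s\<^sup>2" if "\<bar>u\<bar> \<le> \<bar>s\<bar>" for u s :: real
    using that by (simp add: abs_le_square_iff)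
  \<comment> \<open>For u \<le> 0 the half-line s \<le> u lies in the region where u^2 is at most
    s^2, so the weighted bound applies directly to G.\<close>
  have bot: "(G \<longlongrightarrow> 0) at_bot"
  proof (rule Lim_null_comparison[OF _ tendsto_k0(2)])
    have "norm (G u) \<le> K / (1 + u\<^sup>2)" if "u \<le> 0" for u
    proof -
      have "u\<^sup>2 \<le> s\<^sup>2" if "indicator {..u} s \<noteq> (0::real)" for s
        by (rule sq) (use that \<open>u \<le> 0\<close> in \<open>simp add: indicator_def split: if_splits\<close>)
      from K(2)[OF unit_bounded_indicator this] show ?thesis
        by (simp add: G_def)
    qed
    then show "\<forall>\<^sub>F u in at_bot. norm (G u) \<le> K / (1 + u\<^sup>2)"
      using eventually_le_at_bot[of 0] by (rule eventually_mono[rotated])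
  qed
  \<comment> \<open>The difference is the contribution of the tail s > u, again controlled by the
    weighted bound once u is nonnegative.\<close>
  have "((\<lambda>u. T (?J UNIV) - G u) \<longlongrightarrow> 0) at_top"
  proof (rule Lim_null_comparison[OF _ tendsto_k0(1)])
    have "norm (T (?J UNIV) - G u) \<le> K / (1 + u\<^sup>2)" if "u \<ge> 0" for u
    proof -
      have "u\<^sup>2 \<le> s\<^sup>2" if "indicator (UNIV - {..u}) s \<noteq> (0::real)" for s
        by (rule sq) (use that \<open>u \<ge> 0\<close> in \<open>simp add: indicator_def split: if_splits\<close>)
      from K(2)[OF unit_bounded_indicator this] show ?thesis
        unfolding G_def by (subst diff) auto
    qed
    then show "\<forall>\<^sub>F u in at_top. norm (T (?J UNIV) - G u) \<le> K / (1 + u\<^sup>2)"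
      using eventually_ge_at_top[of 0] by (rule eventually_mono[rotated])
  qed
  from tendsto_diff[OF tendsto_const this, of "T (?J UNIV)"]
  have top: "(G \<longlongrightarrow> T (?J UNIV)) at_top" by simp
  have "(\<integral>s. T (\<Phi> s) \<partial>lborel) = T (?J UNIV) - 0"
    by (rule integral_of_derivative[OF deriv cont int bot top])
  then show ?thesis by (simp add: weighted_integral_def[abs_def])
qed

section \<open>Fourier inversion\<close>

text \<open>Up to the factor 1 / sqrt (2 pi) the Gaussian density is its own characteristic
  function. This self-duality is the only explicit transform behind Fourier inversion.\<close>

lemma std_normal_density_char:
  "complex_of_real (std_normal_density x) =
    of_real (1 / sqrt (2 * pi)) * (\<integral>y. exp (- (\<i> * of_real (x * y))) \<partial>std_normal_distribution)"
proof -
  have "(\<integral>y. exp (- (\<i> * of_real (x * y))) \<partial>std_normal_distribution) = char std_normal_distribution (- x)"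
    by (simp add: char_def)
  then show ?thesis
    by (simp only: char_std_normal_distribution) (simp add: normal_density_def)
qed

lemma fourier_affine:
  assumes "\<epsilon> > 0"
  shows "(\<integral>x. \<phi> (t + \<epsilon> * x) * exp (- (\<i> * of_real (x * y))) \<partial>lborel) =
    of_real (1 / \<epsilon>) * (fourier \<phi> (y / (2 * pi * \<epsilon>)) * exp (\<i> * of_real (2 * pi * (y / (2 * pi * \<epsilon>)) * t)))"
proof -
  let ?f = "\<lambda>u. \<phi> u * exp (- (\<i> * of_real ((u - t) / \<epsilon> * y)))"
  have "(\<integral>x. \<phi> (t + \<epsilon> * x) * exp (- (\<i> * of_real (x * y))) \<partial>lborel) = (\<integral>x. ?f (t + \<epsilon> * x) \<partial>lborel)"
    using assms by simp
  also have "\<dots> = of_real (1 / \<epsilon>) * (\<integral>u. ?f u \<partial>lborel)"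
    using assms lborel_integral_real_affine[of \<epsilon> ?f t] by (simp add: scaleR_conv_of_real)
  also have "(\<lambda>u. ?f u) = (\<lambda>u. \<phi> u * exp (- (\<i> * of_real (2 * pi * (y / (2 * pi * \<epsilon>)) * u))) *
      exp (\<i> * of_real (2 * pi * (y / (2 * pi * \<epsilon>)) * t)))"
    using assms by (auto simp: mult.assoc diff_divide_distrib algebra_simps simp flip: exp_add)
  finally show ?thesis
    by (simp only: fourier_def integral_mult_left_zero)
qed

text \<open>Writing the density on the left as a Fourier integral over a normal variable and
  exchanging integrals turns the average of \<phi> near t into the inversion integral with a
  Gaussian damping factor.\<close>

lemma fourier_gaussian_regularisation:
  assumes \<phi>: "\<phi> \<in> schwartz" and \<epsilon>: "\<epsilon> > 0"
  shows "(\<integral>x. std_normal_density x *\<^sub>R \<phi> (t + \<epsilon> * x) \<partial>lborel) =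
    (\<integral>\<omega>. exp (- (2 * pi * \<epsilon> * \<omega>)\<^sup>2 / 2) *\<^sub>R (fourier \<phi> \<omega> * exp (\<i> * of_real (2 * pi * \<omega> * t))) \<partial>lborel)"
proof -
  let ?N = "std_normal_distribution"
  interpret N: real_distribution ?N
    by (rule real_dist_normal_dist)
  interpret P: pair_sigma_finite lborel ?N ..
  let ?c = "complex_of_real (1 / sqrt (2 * pi))"
  let ?e = "\<lambda>x y. exp (- (\<i> * complex_of_real (x * y)))"
  let ?h = "\<lambda>\<omega>. fourier \<phi> \<omega> * exp (\<i> * complex_of_real (2 * pi * \<omega> * t))"
  have [measurable]: "\<phi> \<in> borel_measurable borel"
    by (rule schwartz_measurable[OF \<phi>])
  have [measurable]: "fourier \<phi> \<in> borel_measurable borel"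
    by (rule schwartz_measurable[OF contop_schwartz[OF contop_fourier \<phi>]])
  have int: "integrable lborel (\<lambda>x. \<phi> (t + \<epsilon> * x))"
    by (rule lborel_integrable_real_affine[OF integrable_schwartz[OF \<phi>]]) (use \<epsilon> in simp)
  have "(\<integral>x. std_normal_density x *\<^sub>R \<phi> (t + \<epsilon> * x) \<partial>lborel) =
      (\<integral>x. ?c * (\<integral>y. \<phi> (t + \<epsilon> * x) * ?e x y \<partial>?N) \<partial>lborel)"
    by (simp only: scaleR_conv_of_real std_normal_density_char integral_mult_right_zero mult_ac)
  also have "\<dots> = ?c * (\<integral>x. (\<integral>y. \<phi> (t + \<epsilon> * x) * ?e x y \<partial>?N) \<partial>lborel)"
    by (rule integral_mult_right_zero)
  also have "(\<integral>x. (\<integral>y. \<phi> (t + \<epsilon> * x) * ?e x y \<partial>?N) \<partial>lborel) = (\<integral>y. (\<integral>x. \<phi> (t + \<epsilon> * x) * ?e x y \<partial>lborel) \<partial>?N)"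
  proof (rule P.Fubini_integral[symmetric], rule P.Fubini_integrable)
    show "(\<lambda>(x, y). \<phi> (t + \<epsilon> * x) * ?e x y) \<in> borel_measurable (lborel \<Otimes>\<^sub>M ?N)"
      by measurable
    \<comment> \<open>The phase has modulus one and the second measure is a probability, so
      integrability on the product reduces to that of \<phi>.\<close>
    have n: "norm (\<phi> (t + \<epsilon> * x) * ?e x y) = norm (\<phi> (t + \<epsilon> * x))" for x y
      by (simp only: norm_mult norm_cis mult_1_right)
    show "integrable lborel (\<lambda>x. \<integral>y. norm (case (x, y) of (x, y) \<Rightarrow> \<phi> (t + \<epsilon> * x) * ?e x y) \<partial>?N)"
      using int by (simp only: prod.case n) (simp add: N.prob_space)
    show "AE x in lborel. integrable ?N (\<lambda>y. case (x, y) of (x, y) \<Rightarrow> \<phi> (t + \<epsilon> * x) * ?e x y)"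
    proof (intro always_eventually allI)
      fix x
      show "integrable ?N (\<lambda>y. case (x, y) of (x, y) \<Rightarrow> \<phi> (t + \<epsilon> * x) * ?e x y)"
        unfolding prod.case
        by (rule N.integrable_const_bound[of _ "norm (\<phi> (t + \<epsilon> * x))"]) (auto simp only: n order_refl intro!: always_eventually, measurable)
    qed
  qed
  also have "\<dots> = (\<integral>y. of_real (1 / \<epsilon>) * ?h (y / (2 * pi * \<epsilon>)) \<partial>?N)"
    by (simp only: fourier_affine[OF \<epsilon>])
  also have "\<dots> = (\<integral>y. std_normal_density y *\<^sub>R (of_real (1 / \<epsilon>) * ?h (y / (2 * pi * \<epsilon>))) \<partial>lborel)"
    by (rule integral_density) (auto simp: normal_density_nonneg)
  \<comment> \<open>The substitution y = 2 pi \<epsilon> \<omega> restores the frequency at which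
    the transform of \<phi> is evaluated.\<close>
  also have "\<dots> = \<bar>2 * pi * \<epsilon>\<bar> *\<^sub>R (\<integral>\<omega>. std_normal_density (0 + 2 * pi * \<epsilon> * \<omega>) *\<^sub>R
      (of_real (1 / \<epsilon>) * ?h ((0 + 2 * pi * \<epsilon> * \<omega>) / (2 * pi * \<epsilon>))) \<partial>lborel)"
    by (rule lborel_integral_real_affine) (use \<epsilon> in simp)
  also have "\<dots> = of_real (2 * pi) * (\<integral>\<omega>. std_normal_density (2 * pi * \<epsilon> * \<omega>) *\<^sub>R ?h \<omega> \<partial>lborel)"
    using \<epsilon> by (simp add: scaleR_conv_of_real)
  also have "?c * \<dots> = (\<integral>\<omega>. (?c * of_real (2 * pi)) * (std_normal_density (2 * pi * \<epsilon> * \<omega>) *\<^sub>R ?h \<omega>) \<partial>lborel)"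
    by (simp only: integral_mult_right_zero mult.assoc)
  also have "\<dots> = (\<integral>\<omega>. exp (- (2 * pi * \<epsilon> * \<omega>)\<^sup>2 / 2) *\<^sub>R ?h \<omega> \<partial>lborel)"
  proof (rule Bochner_Integration.integral_cong[OF refl])
    fix \<omega>
    \<comment> \<open>The normalisation inside the density supplies the second factor 1 / sqrt (2
      pi), which cancels 2 pi.\<close>
    have "1 / sqrt (2 * pi) * (2 * pi) * std_normal_density (2 * pi * \<epsilon> * \<omega>) = exp (- (2 * pi * \<epsilon> * \<omega>)\<^sup>2 / 2)"
      by (simp add: normal_density_def field_simps flip: real_sqrt_mult)
    then show "(?c * of_real (2 * pi)) * (std_normal_density (2 * pi * \<epsilon> * \<omega>) *\<^sub>R ?h \<omega>) =
        exp (- (2 * pi * \<epsilon> * \<omega>)\<^sup>2 / 2) *\<^sub>R ?h \<omega>"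
      by (simp only: scaleR_conv_of_real flip: of_real_mult mult.assoc)
  qed
  finally show ?thesis .
qed

text \<open>Stated with the reflected transform, so that the exponential has the sign occurring in
  \<open>stft\<close>. Both sides of the regularised identity are sent to the limit as the width
  \<epsilon> of the Gaussian tends to zero.\<close>

lemma fourier_inversion:
  assumes \<phi>: "\<phi> \<in> schwartz"
  shows "(\<integral>\<omega>. fourier \<phi> (- \<omega>) * exp (- (\<i> * of_real (2 * pi * \<omega> * t))) \<partial>lborel) = \<phi> t"
proof -
  define \<epsilon> where "\<epsilon> = (\<lambda>n. inverse (real (Suc n)))"
  have \<epsilon>: "\<epsilon> \<longlonglongrightarrow> 0" "\<epsilon> n > 0" for n
    unfolding \<epsilon>_def by (rule LIMSEQ_inverse_real_of_nat) simp
  let ?h = "\<lambda>\<omega>. fourier \<phi> \<omega> * exp (\<i> * complex_of_real (2 * pi * \<omega> * t))"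
  let ?L = "\<lambda>n. \<integral>x. std_normal_density x *\<^sub>R \<phi> (t + \<epsilon> n * x) \<partial>lborel"
  have F: "fourier \<phi> \<in> schwartz"
    by (rule contop_schwartz[OF contop_fourier \<phi>])
  have [measurable]: "\<phi> \<in> borel_measurable borel" "fourier \<phi> \<in> borel_measurable borel"
    by (intro schwartz_measurable \<phi> F)+
  \<comment> \<open>The Gaussian average concentrates at t: \<phi> is continuous there and bounded
    by its supremum seminorm.\<close>
  have "?L \<longlonglongrightarrow> (\<integral>x. std_normal_density x *\<^sub>R \<phi> t \<partial>lborel)"
  proof (rule integral_dominated_convergence)
    show "integrable lborel (\<lambda>x. std_normal_density x * schwartz_seminorm 0 0 \<phi>)"
      by (intro integrable_mult_left integrable_normal_density) simp
    show "AE x in lborel. (\<lambda>n. std_normal_density x *\<^sub>R \<phi> (t + \<epsilon> n * x)) \<longlonglongrightarrow> std_normal_density x *\<^sub>R \<phi> t"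
    proof (intro always_eventually allI tendsto_scaleR tendsto_const)
      fix x
      have "isCont \<phi> t"
        using schwartz_continuous[OF \<phi>, of UNIV] by (simp add: continuous_on_eq_continuous_at)
      moreover have "(\<lambda>n. t + \<epsilon> n * x) \<longlonglongrightarrow> t"
        using tendsto_add[OF tendsto_const tendsto_mult[OF \<epsilon>(1) tendsto_const], of t x] by simp
      ultimately show "(\<lambda>n. \<phi> (t + \<epsilon> n * x)) \<longlonglongrightarrow> \<phi> t"
        by (rule isCont_tendsto_compose)
    qed
    show "AE x in lborel. norm (std_normal_density x *\<^sub>R \<phi> (t + \<epsilon> n * x)) \<le> std_normal_density x * schwartz_seminorm 0 0 \<phi>" for n
      using norm_le_seminorm0[OF \<phi>] by (intro always_eventually allI) (auto intro: mult_left_mono)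
  qed measurable
  then have 1: "?L \<longlonglongrightarrow> \<phi> t"
    by simp
  \<comment> \<open>The damping factors are at most 1 and tend to 1, so the integrable transform of
    \<phi> is a dominating function.\<close>
  have "(\<lambda>n. \<integral>\<omega>. exp (- (2 * pi * \<epsilon> n * \<omega>)\<^sup>2 / 2) *\<^sub>R ?h \<omega> \<partial>lborel) \<longlonglongrightarrow> (\<integral>\<omega>. ?h \<omega> \<partial>lborel)"
  proof (rule integral_dominated_convergence)
    show "integrable lborel (\<lambda>\<omega>. norm (fourier \<phi> \<omega>))"
      by (intro integrable_norm integrable_schwartz F)
    show "AE \<omega> in lborel. (\<lambda>n. exp (- (2 * pi * \<epsilon> n * \<omega>)\<^sup>2 / 2) *\<^sub>R ?h \<omega>) \<longlonglongrightarrow> ?h \<omega>"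
    proof (intro always_eventually allI)
      fix \<omega>
      have "(\<lambda>n. exp (- (2 * pi * \<epsilon> n * \<omega>)\<^sup>2 / 2) *\<^sub>R ?h \<omega>) \<longlonglongrightarrow> exp (- (2 * pi * 0 * \<omega>)\<^sup>2 / 2) *\<^sub>R ?h \<omega>"
        by (intro tendsto_intros \<epsilon>(1)) simp
      then show "(\<lambda>n. exp (- (2 * pi * \<epsilon> n * \<omega>)\<^sup>2 / 2) *\<^sub>R ?h \<omega>) \<longlonglongrightarrow> ?h \<omega>" by simp
    qed
    have "norm (exp (- (2 * pi * \<epsilon> n * \<omega>)\<^sup>2 / 2) *\<^sub>R ?h \<omega>) \<le> norm (fourier \<phi> \<omega>)" for n \<omega>
    proof -
      have "exp (- (2 * pi * \<epsilon> n * \<omega>)\<^sup>2 / 2) * norm (fourier \<phi> \<omega>) \<le> 1 * norm (fourier \<phi> \<omega>)"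
        by (intro mult_right_mono) simp_all
      then show ?thesis
        by (simp only: norm_scaleR norm_mult norm_cis mult_1_right mult_1_left abs_of_pos[OF exp_gt_zero])
    qed
    then show "AE \<omega> in lborel. norm (exp (- (2 * pi * \<epsilon> n * \<omega>)\<^sup>2 / 2) *\<^sub>R ?h \<omega>) \<le> norm (fourier \<phi> \<omega>)" for n
      by (intro always_eventually allI)
  qed measurable
  then have 2: "?L \<longlonglongrightarrow> (\<integral>\<omega>. ?h \<omega> \<partial>lborel)"
    by (simp only: fourier_gaussian_regularisation[OF \<phi> \<epsilon>(2)])
  have "\<phi> t = (\<integral>\<omega>. ?h \<omega> \<partial>lborel)"
    by (rule LIMSEQ_unique[OF 1 2])
  also have "\<dots> = (\<integral>\<omega>. ?h (- \<omega>) \<partial>lborel)"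
    using lborel_integral_real_affine[of "-1" ?h 0] by simp
  finally show ?thesis by simp
qed

section \<open>The change of window\<close>

text \<open>The modulation has frequency - \<omega>: because the pairing is bilinear, the functional
  is evaluated at the conjugate of the usual shifted window, and this conjugate is the shift, with
  opposite frequency, of the conjugate window.\<close>

definition tf_shift :: "real \<Rightarrow> real \<Rightarrow> (real \<Rightarrow> complex) \<Rightarrow> real \<Rightarrow> complex" where
  "tf_shift x \<omega> \<alpha> t = \<alpha> (t - x) * exp (- (\<i> * of_real (2 * pi * \<omega> * t)))"

lemma stft_eq_tf_shift: "stft g T x \<omega> = T (tf_shift x \<omega> (\<lambda>t. cnj (g t)))"
  by (simp add: stft_def tf_shift_def[abs_def])

lemma tf_shift_schwartz: "\<alpha> \<in> schwartz \<Longrightarrow> tf_shift x \<omega> \<alpha> \<in> schwartz"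
  unfolding tf_shift_def[abs_def] by (intro schwartz_modulate_exp schwartz_translate)

lemma schwartz_reflect: "\<phi> \<in> schwartz \<Longrightarrow> (\<lambda>t. \<phi> (- t)) \<in> schwartz"
  using contop_schwartz[OF contop_dilate[of "-1"], of \<phi>] by (simp add: dilate_def[abs_def])

theorem stft_reconstruction:
  assumes T: "T \<in> tempered" and g: "g \<in> schwartz" and \<phi>: "\<phi> \<in> schwartz"
  shows "of_real (\<integral>t. (norm (g t))\<^sup>2 \<partial>lborel) * T \<phi> =
    (\<integral>x. (\<integral>\<omega>. stft g T x \<omega> * fourier (\<lambda>t. g (t - x) * \<phi> t) (- \<omega>) \<partial>lborel) \<partial>lborel)"
proof -
  let ?N = "\<integral>t. (norm (g t))\<^sup>2 \<partial>lborel"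
  let ?\<Phi> = "\<lambda>x t. (cnj (g (t - x)) * g (t - x)) * \<phi> t"
  have S: "?\<Phi> \<in> schwartz2"
    by (rule schwartz2_translate(1)[OF schwartz_prod[OF schwartz_cnj[OF g] g] \<phi>])
  have "(\<integral>x. ?\<Phi> x t \<partial>lborel) = of_real ?N * \<phi> t" for t
  proof -
    have "cnj (g (t - x)) * g (t - x) = of_real ((norm (g (t + (- 1) * x)))\<^sup>2)" for x
      unfolding complex_norm_square by (simp add: mult.commute)
    then have "(\<integral>x. ?\<Phi> x t \<partial>lborel) = of_real (\<integral>x. (norm (g (t + (- 1) * x)))\<^sup>2 \<partial>lborel) * \<phi> t"
      by (simp only: integral_mult_left_zero integral_complex_of_real)
    also have "(\<integral>x. (norm (g (t + (- 1) * x)))\<^sup>2 \<partial>lborel) = ?N"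
      using lborel_integral_real_affine[of "-1" "\<lambda>t. (norm (g t))\<^sup>2" t] by simp
    finally show ?thesis .
  qed
  then have "(\<lambda>t. \<integral>x. ?\<Phi> x t \<partial>lborel) = (\<lambda>t. of_real ?N * \<phi> t)"
    by (rule ext)
  then have "of_real ?N * T \<phi> = T (\<lambda>t. \<integral>x. ?\<Phi> x t \<partial>lborel)"
    by (simp only: tempered_cmult[OF T \<phi>])
  also have "\<dots> = (\<integral>x. T (?\<Phi> x) \<partial>lborel)"
    by (rule tempered_interchange[OF T S])
  also have "\<dots> = (\<integral>x. (\<integral>\<omega>. stft g T x \<omega> * fourier (\<lambda>t. g (t - x) * \<phi> t) (- \<omega>) \<partial>lborel) \<partial>lborel)"
  proof (rule Bochner_Integration.integral_cong[OF refl])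
    fix x
    let ?\<alpha> = "\<lambda>t. cnj (g (t - x))" and ?f = "\<lambda>t. g (t - x) * \<phi> t"
    let ?\<psi> = "\<lambda>\<omega>. fourier ?f (- \<omega>)"
    let ?\<Psi> = "\<lambda>\<omega> t. ?\<alpha> t * exp (- (\<i> * of_real (2 * pi * \<omega> * t))) * ?\<psi> \<omega>"
    have f: "?f \<in> schwartz"
      by (intro schwartz_prod schwartz_translate g \<phi>)
    have \<alpha>: "?\<alpha> \<in> schwartz"
      by (intro schwartz_cnj schwartz_translate g)
    \<comment> \<open>For fixed x the conjugate window is kept as the factor in t, while the
      transform of the remaining product decays in \<omega> and so makes the family admissible for
      the interchange.\<close>
    have \<Psi>: "?\<Psi> \<in> schwartz2"
      by (intro schwartz2_wave \<alpha> schwartz_reflect contop_schwartz[OF contop_fourier f])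
    have "?\<Phi> x t = (\<integral>\<omega>. ?\<Psi> \<omega> t \<partial>lborel)" for t
    proof -
      have *: "(\<integral>\<omega>. ?\<Psi> \<omega> t \<partial>lborel) = ?\<alpha> t * (\<integral>\<omega>. ?\<psi> \<omega> * exp (- (\<i> * of_real (2 * pi * \<omega> * t))) \<partial>lborel)"
        unfolding integral_mult_right_zero[symmetric] by (simp only: mult_ac)
      show ?thesis
        unfolding * fourier_inversion[OF f] by (rule mult.assoc)
    qed
    then have "T (?\<Phi> x) = T (\<lambda>t. \<integral>\<omega>. ?\<Psi> \<omega> t \<partial>lborel)"
      by presburger
    also have "\<dots> = (\<integral>\<omega>. T (?\<Psi> \<omega>) \<partial>lborel)"
      by (rule tempered_interchange[OF T \<Psi>])
    also have "T (?\<Psi> \<omega>) = stft g T x \<omega> * ?\<psi> \<omega>" for \<omega>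
      using tempered_cmult[OF T schwartz_modulate_exp[OF \<alpha>], of "?\<psi> \<omega>" \<omega>]
      by (simp add: stft_def mult.commute)
    then have "(\<integral>\<omega>. T (?\<Psi> \<omega>) \<partial>lborel) = (\<integral>\<omega>. stft g T x \<omega> * ?\<psi> \<omega> \<partial>lborel)"
      by (rule arg_cong[OF ext])
    finally show "T (?\<Phi> x) = (\<integral>\<omega>. stft g T x \<omega> * ?\<psi> \<omega> \<partial>lborel)" .
  qed
  finally show ?thesis .
qed

text \<open>Each induction step gains one power in both variables. Applying 1 - D^2 / (4 pi^2) in t
  multiplies the transform by 1 + \<xi>^2, and multiplication by 1 + s^2 commutes with the
  transform; the modified family is again in \<open>schwartz2\<close>, which is why the induction
  runs over all families.\<close>

lemma schwartz2_fourier_decay: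
  assumes "\<Phi> \<in> schwartz2"
  shows "\<exists>C\<ge>0. \<forall>s \<xi>. norm (fourier (\<Phi> s) \<xi>) \<le> C / ((1 + s\<^sup>2) ^ M * (1 + \<xi>\<^sup>2) ^ M)"
  using assms
proof (induction M arbitrary: \<Phi>)
  case 0
  obtain C where C: "C \<ge> 0" "\<And>s t. norm (\<Phi> s t) \<le> C / (1 + t\<^sup>2)"
    using schwartz2_decay2[OF 0] by blast
  have "norm (fourier (\<Phi> s) \<xi>) \<le> (\<integral>t. C * (1 / (1 + t\<^sup>2)) \<partial>lborel)" for s \<xi>
  proof (rule order_trans[OF norm_fourier_le])
    show "(\<integral>t. norm (\<Phi> s t) \<partial>lborel) \<le> (\<integral>t. C * (1 / (1 + t\<^sup>2)) \<partial>lborel)"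
      using C by (intro integral_mono integrable_norm integrable_schwartz schwartz2_section 0
          integrable_mult_right integrable_k0) simp
  qed
  moreover have "0 \<le> (\<integral>t. C * (1 / (1 + t\<^sup>2)) \<partial>lborel)"
    using C(1) by (intro Bochner_Integration.integral_nonneg) simp
  ultimately show ?case by auto
next
  case (Suc M)
  obtain \<Phi>' where \<Phi>': "\<Phi>' \<in> schwartz2" "\<And>s t. (\<Phi> s has_vector_derivative \<Phi>' s t) (at t)"
    using schwartz2_deriv2[OF Suc.prems] by blast
  obtain \<Phi>'' where \<Phi>'': "\<Phi>'' \<in> schwartz2" "\<And>s t. (\<Phi>' s has_vector_derivative \<Phi>'' s t) (at t)"
    using schwartz2_deriv2[OF \<Phi>'(1)] by blast
  \<comment> \<open>Two derivatives multiply the transform by - 4 pi^2 \<xi>^2; this constant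
    normalises that factor to \<xi>^2.\<close>
  let ?z = "- 1 / complex_of_real (4 * pi\<^sup>2)"
  define \<Theta> where "\<Theta> = (\<lambda>s t. \<Phi> s t + ?z * \<Phi>'' s t)"
  define \<Psi> where "\<Psi> = (\<lambda>s t. \<Theta> s t + s *\<^sub>R (s *\<^sub>R \<Theta> s t))"
  have \<Theta>: "\<Theta> \<in> schwartz2"
    unfolding \<Theta>_def by (intro schwartz2_add schwartz2_cmult Suc.prems \<Phi>'')
  have \<Psi>: "\<Psi> \<in> schwartz2"
    unfolding \<Psi>_def by (intro schwartz2_add schwartz2_mult1 \<Theta>)
  have "fourier (\<Theta> s) \<xi> = of_real (1 + \<xi>\<^sup>2) * fourier (\<Phi> s) \<xi>" for s \<xi>
  proof -
    have "\<Phi>'' s = deriv1 (deriv1 (\<Phi> s))"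
      by (simp only: deriv1_eq[OF \<Phi>'(2)] deriv1_eq[OF \<Phi>''(2)])
    then have "fourier (\<Phi>'' s) \<xi> = - of_real (4 * pi\<^sup>2) * (of_real (\<xi>\<^sup>2) * fourier (\<Phi> s) \<xi>)"
      using fourier_deriv[OF schwartz2_section[OF Suc.prems], of s \<xi>]
        fourier_deriv[OF schwartz_deriv[OF schwartz2_section[OF Suc.prems]], of s \<xi>]
      by (simp add: power2_eq_square scaleR_conv_of_real)
    then have "?z * fourier (\<Phi>'' s) \<xi> = of_real (\<xi>\<^sup>2) * fourier (\<Phi> s) \<xi>"
      by simp
    moreover have "fourier (\<Theta> s) \<xi> = fourier (\<Phi> s) \<xi> + ?z * fourier (\<Phi>'' s) \<xi>"
      unfolding \<Theta>_def
      using fourier_add[OF schwartz2_section[OF Suc.prems] schwartz_cmult[OF schwartz2_section[OF \<Phi>''(1)]], of s ?z s \<xi>]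
      by (simp only: fourier_cmult)
    ultimately show ?thesis
      by (simp add: distrib_right)
  qed
  moreover have "fourier (\<Psi> s) \<xi> = of_real (1 + s\<^sup>2) * fourier (\<Theta> s) \<xi>" for s \<xi>
  proof -
    have "\<Psi> s = (\<lambda>t. of_real (1 + s\<^sup>2) * \<Theta> s t)"
      by (simp add: \<Psi>_def scaleR_conv_of_real power2_eq_square distrib_right mult.assoc)
    then show ?thesis by (simp only: fourier_cmult)
  qed
  ultimately have F: "fourier (\<Psi> s) \<xi> = of_real ((1 + s\<^sup>2) * (1 + \<xi>\<^sup>2)) * fourier (\<Phi> s) \<xi>" for s \<xi>
    by simp
  obtain C where C: "C \<ge> 0" "\<And>s \<xi>. norm (fourier (\<Psi> s) \<xi>) \<le> C / ((1 + s\<^sup>2) ^ M * (1 + \<xi>\<^sup>2) ^ M)"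
    using Suc.IH[OF \<Psi>] by blast
  have "norm (fourier (\<Phi> s) \<xi>) \<le> C / ((1 + s\<^sup>2) ^ Suc M * (1 + \<xi>\<^sup>2) ^ Suc M)" for s \<xi>
  proof -
    have pos: "0 < 1 + s\<^sup>2" "0 < 1 + \<xi>\<^sup>2" by (simp_all add: add_pos_nonneg)
    then have "norm (fourier (\<Psi> s) \<xi>) = ((1 + s\<^sup>2) * (1 + \<xi>\<^sup>2)) * norm (fourier (\<Phi> s) \<xi>)"
      unfolding F norm_mult norm_of_real by simp
    with C(2)[of s \<xi>] have "norm (fourier (\<Phi> s) \<xi>) * ((1 + s\<^sup>2) * (1 + \<xi>\<^sup>2)) \<le> C / ((1 + s\<^sup>2) ^ M * (1 + \<xi>\<^sup>2) ^ M)"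
      by (simp only: mult.commute)
    then have "norm (fourier (\<Phi> s) \<xi>) \<le> C / ((1 + s\<^sup>2) ^ M * (1 + \<xi>\<^sup>2) ^ M) / ((1 + s\<^sup>2) * (1 + \<xi>\<^sup>2))"
      by (subst pos_le_divide_eq[OF mult_pos_pos[OF pos]])
    also have "\<dots> = C / ((1 + s\<^sup>2) ^ Suc M * (1 + \<xi>\<^sup>2) ^ Suc M)"
      by (simp add: divide_divide_eq_left mult_ac)
    finally show ?thesis .
  qed
  with C(1) show ?case by blast
qed

text \<open>The factor \<open>\<beta>\<close> only supplies decay in \<open>s\<close>; a translate of \<open>\<gamma>\<close> does not vanish near \<open>u\<close> and is divided out.\<close>

lemma isCont_tempered_family:
  assumes T: "T \<in> tempered" and \<gamma>: "\<gamma> \<in> schwartz" "\<gamma> t0 \<noteq> 0"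
    and \<phi>: "\<And>s. \<phi> s \<in> schwartz"
    and S: "\<And>\<beta>. \<beta> \<in> schwartz \<Longrightarrow> (\<lambda>s t. \<phi> s t * \<beta> s) \<in> schwartz2"
  shows "isCont (\<lambda>s. T (\<phi> s)) u"
proof -
  let ?\<beta> = "\<lambda>s. \<gamma> (s - (u - t0))"
  have \<beta>: "?\<beta> \<in> schwartz"
    by (rule schwartz_translate[OF \<gamma>(1)])
  have cont: "isCont ?\<beta> u"
    using schwartz_continuous[OF \<beta>, of UNIV] by (simp add: continuous_on_eq_continuous_at)
  have ne: "?\<beta> u \<noteq> 0" using \<gamma>(2) by simp
  have T\<beta>: "T (\<lambda>t. \<phi> s t * ?\<beta> s) = ?\<beta> s * T (\<phi> s)" for s
    using tempered_cmult[OF T \<phi>, of "?\<beta> s" s] by (simp only: mult.commute)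
  have "isCont (\<lambda>s. ?\<beta> s * T (\<phi> s)) u"
    using isCont_tempered_section[OF T S[OF \<beta>], of u] by (simp only: T\<beta>)
  then have "((\<lambda>s. ?\<beta> s * T (\<phi> s) / ?\<beta> s) \<longlongrightarrow> ?\<beta> u * T (\<phi> u) / ?\<beta> u) (at u)"
    using cont ne by (intro tendsto_divide) (simp_all add: isCont_def)
  moreover have "\<forall>\<^sub>F s in at u. ?\<beta> s * T (\<phi> s) / ?\<beta> s = T (\<phi> s)"
    using tendsto_imp_eventually_ne[of ?\<beta> "?\<beta> u" "at u" 0] cont ne
    unfolding isCont_def by (auto elim!: eventually_mono)
  ultimately show ?thesis
    unfolding isCont_def using ne by (simp add: tendsto_cong)
qed

text \<open>The auxiliary \<gamma> only has to be nonzero somewhere, so the window itself may be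
  arbitrary. The result can then be used for the transformed window, with the original window as
  \<gamma>.\<close>

lemma isCont_stft:
  assumes T: "T \<in> tempered" and g: "g \<in> schwartz" and \<gamma>: "\<gamma> \<in> schwartz" "\<gamma> t0 \<noteq> 0"
  shows "isCont (\<lambda>x. stft g T x \<omega>) x" "isCont (\<lambda>\<omega>. stft g T x \<omega>) \<omega>"
proof -
  let ?e = "\<lambda>\<omega> t. exp (- (\<i> * complex_of_real (2 * pi * \<omega> * t)))"
  have \<alpha>: "(\<lambda>t. cnj (g t)) \<in> schwartz" "(\<lambda>t. cnj (g (t - x))) \<in> schwartz" for x
    by (intro schwartz_cnj schwartz_translate g)+
  show "isCont (\<lambda>\<omega>. stft g T x \<omega>) \<omega>"
    unfolding stft_def
    by (rule isCont_tempered_family[OF T \<gamma>]) (rule schwartz_modulate_exp[OF \<alpha>(2)], rule schwartz2_wave[OF \<alpha>(2)])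
  show "isCont (\<lambda>x. stft g T x \<omega>) x"
    unfolding stft_def
  proof (rule isCont_tempered_family[OF T \<gamma>])
    show "(\<lambda>t. cnj (g (t - x)) * ?e \<omega> t) \<in> schwartz" for x
      by (rule schwartz_modulate_exp[OF \<alpha>(2)])
    fix \<beta> :: "real \<Rightarrow> complex" assume \<beta>: "\<beta> \<in> schwartz"
    \<comment> \<open>The exponential is split as t = (t - s) + s, one part modulating the
      translated window and the other modulating \<beta>.\<close>
    have "cnj (g (t - s)) * ?e \<omega> t * \<beta> s = cnj (g (t - s)) * ?e \<omega> (t - s) * (\<beta> s * ?e \<omega> s)" for s t
      by (simp add: algebra_simps flip: exp_add)
    then show "(\<lambda>s t. cnj (g (t - s)) * ?e \<omega> t * \<beta> s) \<in> schwartz2"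
      using schwartz2_translate(2)[OF schwartz_modulate_exp[OF \<alpha>(1), of \<omega>] schwartz_modulate_exp[OF \<beta>, of \<omega>]]
      by (simp only:)
  qed
qed

section \<open>Joint measurability of the short-time Fourier transform\<close>

lemma floor_mult_divide_tendsto: "(\<lambda>n. of_int \<lfloor>real (Suc n) * x\<rfloor> / real (Suc n)) \<longlonglongrightarrow> x"
proof (rule LIMSEQ_I)
  fix e :: real assume "e > 0"
  then obtain N where N: "inverse (real (Suc N)) < e"
    using reals_Archimedean by blast
  have "norm (of_int \<lfloor>real (Suc n) * x\<rfloor> / real (Suc n) - x) < e" if "n \<ge> N" for n
  proof -
    have "\<bar>of_int \<lfloor>real (Suc n) * x\<rfloor> - real (Suc n) * x\<bar> \<le> 1"
      by linarith
    then have "\<bar>of_int \<lfloor>real (Suc n) * x\<rfloor> - real (Suc n) * x\<bar> / real (Suc n) \<le> 1 / real (Suc n)"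
      by (intro divide_right_mono) simp_all
    moreover have "\<bar>of_int \<lfloor>real (Suc n) * x\<rfloor> - real (Suc n) * x\<bar> / real (Suc n) =
        \<bar>of_int \<lfloor>real (Suc n) * x\<rfloor> / real (Suc n) - x\<bar>"
      by (subst abs_div_pos) (simp_all add: diff_divide_distrib)
    moreover have "1 / real (Suc n) \<le> inverse (real (Suc N))"
      using that by (simp add: inverse_eq_divide frac_le)
    ultimately show ?thesis using N by simp
  qed
  then show "\<exists>N. \<forall>n\<ge>N. norm (of_int \<lfloor>real (Suc n) * x\<rfloor> / real (Suc n) - x) < e" by blast
qed

text \<open>Rounding the first variable down to the grid of step 1 / (n + 1) leaves countably many
  functions of the second variable, each continuous. Continuity in the first variable makes these
  measurable approximations converge pointwise.\<close>

lemma borel_measurable_separately_continuous: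
  fixes f :: "real \<Rightarrow> real \<Rightarrow> complex"
  assumes "\<And>x \<omega>. isCont (\<lambda>x. f x \<omega>) x" "\<And>x \<omega>. isCont (\<lambda>\<omega>. f x \<omega>) \<omega>"
  shows "(\<lambda>z. f (fst z) (snd z)) \<in> borel_measurable borel"
proof (rule borel_measurable_LIMSEQ_metric)
  have [measurable]: "f x \<in> borel_measurable borel" for x
    using assms(2) by (intro borel_measurable_continuous_onI continuous_at_imp_continuous_on ballI)
  show "(\<lambda>z. f (of_int \<lfloor>real (Suc n) * fst z\<rfloor> / real (Suc n)) (snd z)) \<in> borel_measurable borel" for n
    unfolding borel_prod[symmetric]
    by (rule measurable_compose_countable[where f = "\<lambda>i z. f (of_int i / real (Suc n)) (snd z)"])
      measurable
  show "(\<lambda>n. f (of_int \<lfloor>real (Suc n) * fst z\<rfloor> / real (Suc n)) (snd z)) \<longlonglongrightarrow> f (fst z) (snd z)" for z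
    by (rule isCont_tendsto_compose[OF assms(1) floor_mult_divide_tendsto])
qed

lemma stft_measurable:
  assumes "T \<in> tempered" "g \<in> schwartz" "\<gamma> \<in> schwartz" "\<gamma> t0 \<noteq> 0"
  shows "(\<lambda>z. stft g T (fst z) (snd z)) \<in> borel_measurable borel"
  using isCont_stft[OF assms] by (intro borel_measurable_separately_continuous)

section \<open>A Jensen inequality for kernels\<close>

lemma v_weight_measurable: "(\<lambda>z. v_weight l (fst z) (snd z)) \<in> borel_measurable borel"
  unfolding v_weight_def borel_prod[symmetric] by measurable

lemma v_weight_pos: "v_weight l x \<omega> > 0"
  using add_pos_nonneg[OF add_pos_nonneg[OF zero_less_one zero_le_power2[of x]] zero_le_power2[of \<omega>]]
  unfolding v_weight_def by simp

text \<open>This is the statement that the convex function \<open>u powr r\<close> lies above its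
  tangent at a, cleared of subtraction. Scaling by s = u / a reduces it to the tangent at 1.\<close>

lemma powr_tangent:
  fixes r u a :: real
  assumes "1 \<le> r" "0 \<le> u" "0 \<le> a"
  shows "r * a powr (r - 1) * u \<le> u powr r + (r - 1) * a powr r"
\<comment> \<open>At a = 0 the left side vanishes even for r = 1, since \<open>0 powr 0\<close> is
  0.\<close>
proof (cases "a = 0")
  case False
  then have a: "a > 0" using assms by simp
  have *: "r * s \<le> s powr r + (r - 1)" if "s \<ge> 0" for s
  proof (cases "s = 0")
    case False
    with that have "s \<in> {0<..}" by simp
    moreover have "((\<lambda>x. x powr r) has_real_derivative r) (at 1 within {0<..})"
      by (auto intro!: derivative_eq_intros)
    ultimately have "s powr r - 1 powr r \<ge> r * (s - 1)"
      by (intro convex_on_imp_above_tangent[OF powr_convex[OF assms(1)]]) (auto simp: interior_open)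
    then show ?thesis by (simp add: algebra_simps)
  qed (use assms in simp)
  have "a powr r * (r * (u / a)) \<le> a powr r * ((u / a) powr r + (r - 1))"
    using a assms by (intro mult_left_mono *) auto
  moreover have "a powr r * (r * (u / a)) = r * a powr (r - 1) * u"
    using a by (simp add: powr_diff)
  moreover have "a powr r * (u / a) powr r = u powr r"
    using a assms by (simp add: powr_divide)
  ultimately show ?thesis by (simp add: algebra_simps)
qed (use assms in auto)

text \<open>The tangent inequality is integrated against the kernel k, which treats r = 1 along with
  r > 1. Only an upper estimate of H by the integral is assumed, as this is all that the
  reconstruction formula provides.\<close>

lemma jensen_kernel:
  fixes F k :: "'a \<Rightarrow> real"
  assumes r: "1 \<le> r" and [measurable]: "F \<in> borel_measurable M" "k \<in> borel_measurable M"
    and F: "\<And>z. 0 \<le> F z" and k: "\<And>z. 0 \<le> k z"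
    and m: "(\<integral>\<^sup>+z. ennreal (k z) \<partial>M) = ennreal m" "m > 0"
    and H: "0 \<le> H" "ennreal H \<le> (\<integral>\<^sup>+z. ennreal (F z * k z) \<partial>M)"
  shows "ennreal (H powr r) \<le> ennreal (m powr (r - 1)) * (\<integral>\<^sup>+z. ennreal (F z powr r * k z) \<partial>M)"
proof (cases "(\<integral>\<^sup>+z. ennreal (F z powr r * k z) \<partial>M) = \<infinity>")
  case True
  then show ?thesis using m(2) by (simp add: ennreal_mult_top)
next
  case False
  then obtain B where B: "B \<ge> 0" "(\<integral>\<^sup>+z. ennreal (F z powr r * k z) \<partial>M) = ennreal B"
    by (cases "(\<integral>\<^sup>+z. ennreal (F z powr r * k z) \<partial>M)") auto
  \<comment> \<open>At the tangent point H / m the term r a^(r - 1) H equals r a^r m; subtracting (r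
    - 1) a^r m leaves a^r m \<le> B, which is the claim rescaled.\<close>
  define a where "a = H / m"
  have a: "0 \<le> a" using H m by (simp add: a_def)
  let ?c = "r * a powr (r - 1)"
  have "ennreal (?c * H) = ennreal ?c * ennreal H"
    using r H by (intro ennreal_mult) auto
  also have "\<dots> \<le> ennreal ?c * (\<integral>\<^sup>+z. ennreal (F z * k z) \<partial>M)"
    by (intro mult_left_mono H) simp
  also have "\<dots> = (\<integral>\<^sup>+z. ennreal ?c * ennreal (F z * k z) \<partial>M)"
    by (intro nn_integral_cmult[symmetric]) measurable
  also have "\<dots> \<le> (\<integral>\<^sup>+z. ennreal (F z powr r * k z) + ennreal ((r - 1) * a powr r) * ennreal (k z) \<partial>M)"
  proof (intro nn_integral_mono)
    fix z
    have "?c * F z * k z \<le> (F z powr r + (r - 1) * a powr r) * k z"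
      by (intro mult_right_mono powr_tangent r F a k)
    then have "?c * (F z * k z) \<le> F z powr r * k z + ((r - 1) * a powr r) * k z"
      by (simp add: algebra_simps)
    then have "ennreal (?c * (F z * k z)) \<le> ennreal (F z powr r * k z + ((r - 1) * a powr r) * k z)"
      by (rule ennreal_leI)
    then show "ennreal ?c * ennreal (F z * k z) \<le> ennreal (F z powr r * k z) + ennreal ((r - 1) * a powr r) * ennreal (k z)"
      using r F[of z] k[of z] by (simp add: ennreal_mult ennreal_plus)
  qed
  also have "\<dots> = ennreal B + ennreal ((r - 1) * a powr r) * ennreal m"
    by (subst nn_integral_add) (simp_all add: B nn_integral_cmult m)
  also have "\<dots> = ennreal (B + (r - 1) * a powr r * m)"
    using B r m by (simp add: ennreal_mult ennreal_plus)
  finally have le: "?c * H \<le> B + (r - 1) * a powr r * m"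
    using B r m by (subst (asm) ennreal_le_iff) auto
  have eq: "?c * H = r * a powr r * m"
  proof (cases "a = 0")
    case False
    then have "a powr r = a powr (r - 1) * a"
      using a by (simp add: powr_diff)
    then show ?thesis using m by (simp add: a_def)
  qed (use m a_def in simp)
  from le[unfolded eq] have "a powr r * m \<le> B" by (simp add: algebra_simps)
  have "H powr r = m powr (r - 1) * (a powr r * m)"
  proof -
    have "H powr r = (a * m) powr r" using m by (simp add: a_def)
    also have "\<dots> = a powr r * (m powr (r - 1) * m)"
      using a m by (simp add: powr_mult powr_diff)
    finally show ?thesis by simp
  qed
  also have "\<dots> \<le> m powr (r - 1) * B"
    by (intro mult_left_mono \<open>a powr r * m \<le> B\<close>) simp
  finally have "ennreal (H powr r) \<le> ennreal (m powr (r - 1) * B)"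
    by (rule ennreal_leI)
  then show ?thesis
    using B by (simp add: ennreal_mult)
qed

text \<open>Both orders are needed: the modulation norm has the position integral inside, the
  reconstruction formula the frequency integral.\<close>

lemma nn_integral_pair:
  fixes f :: "real \<times> real \<Rightarrow> ennreal"
  assumes "f \<in> borel_measurable borel"
  shows "(\<integral>\<^sup>+x. \<integral>\<^sup>+y. f (x, y) \<partial>lborel \<partial>lborel) = (\<integral>\<^sup>+z. f z \<partial>lborel)"
    "(\<integral>\<^sup>+y. \<integral>\<^sup>+x. f (x, y) \<partial>lborel \<partial>lborel) = (\<integral>\<^sup>+z. f z \<partial>lborel)"
proof -
  have f: "f \<in> borel_measurable (lborel \<Otimes>\<^sub>M lborel)"
    using assms by (simp add: lborel_prod)
  show "(\<integral>\<^sup>+x. \<integral>\<^sup>+y. f (x, y) \<partial>lborel \<partial>lborel) = (\<integral>\<^sup>+z. f z \<partial>lborel)"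
    using lborel.nn_integral_fst[OF f] by (simp add: lborel_prod)
  show "(\<integral>\<^sup>+y. \<integral>\<^sup>+x. f (x, y) \<partial>lborel \<partial>lborel) = (\<integral>\<^sup>+z. f z \<partial>lborel)"
    using lborel_pair.nn_integral_snd[OF f] by (simp add: lborel_prod)
qed

text \<open>The product of two unnormalised Cauchy densities, a convolution kernel on the
  time-frequency plane of total mass pi^2.\<close>

definition cauchy_kernel :: "real \<times> real \<Rightarrow> real \<times> real \<Rightarrow> real" where
  "cauchy_kernel z w = 1 / (1 + (fst z - fst w)\<^sup>2) * (1 / (1 + (snd z - snd w)\<^sup>2))"

lemma cauchy_kernel_nonneg: "0 \<le> cauchy_kernel z w"
  by (simp add: cauchy_kernel_def)

lemma cauchy_kernel_commute: "cauchy_kernel z w = cauchy_kernel w z"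
  by (simp add: cauchy_kernel_def power2_commute)

lemma cauchy_kernel_measurable [measurable (raw)]:
  assumes "f \<in> M \<rightarrow>\<^sub>M borel" "g \<in> M \<rightarrow>\<^sub>M borel"
  shows "(\<lambda>x. cauchy_kernel (f x) (g x)) \<in> borel_measurable M"
proof -
  have "(\<lambda>p. cauchy_kernel (fst p) (snd p)) \<in> borel_measurable (borel \<Otimes>\<^sub>M borel)"
    unfolding cauchy_kernel_def borel_prod[symmetric] by measurable
  from measurable_compose[OF measurable_Pair[OF assms] this] show ?thesis by simp
qed

lemma nn_integral_k0: "(\<integral>\<^sup>+t. ennreal (1 / (1 + (x - t)\<^sup>2)) \<partial>lborel) = ennreal pi"
proof -
  have "(LBINT t. 1 / (1 + t\<^sup>2)) = pi"
    using LBINT_inverse_1_plus_square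
    by (simp add: interval_lebesgue_integral_def set_lebesgue_integral_def einterval_def divide_inverse)
  then have "(\<integral>\<^sup>+t. ennreal (1 / (1 + t\<^sup>2)) \<partial>lborel) = ennreal pi"
    by (subst nn_integral_eq_integral[OF integrable_k0]) simp_all
  then show ?thesis
    by (subst (asm) nn_integral_real_affine[where c = "-1" and t = x]) simp_all
qed

lemma nn_integral_cauchy_kernel: "(\<integral>\<^sup>+w. ennreal (cauchy_kernel z w) \<partial>lborel) = ennreal (pi * pi)"
proof -
  have "(\<integral>\<^sup>+w. ennreal (cauchy_kernel z w) \<partial>lborel) =
      (\<integral>\<^sup>+x. \<integral>\<^sup>+y. ennreal (1 / (1 + (fst z - x)\<^sup>2)) * ennreal (1 / (1 + (snd z - y)\<^sup>2)) \<partial>lborel \<partial>lborel)"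
    by (subst nn_integral_pair(1)[symmetric], measurable) (simp add: cauchy_kernel_def flip: ennreal_mult)
  also have "\<dots> = ennreal pi * ennreal pi"
    by (simp add: nn_integral_cmult nn_integral_multc nn_integral_k0)
  finally show ?thesis by (simp add: ennreal_mult)
qed

section \<open>Moderateness of the polynomial weight\<close>

lemma powr_comparable:
  fixes A B D e :: real
  assumes "0 < A" "0 < B" "A \<le> D * B" "B \<le> D * A"
  shows "A powr e \<le> B powr e * D powr \<bar>e\<bar>"
proof -
  have D: "0 < D"
    using assms by (metis less_le_trans zero_less_mult_pos2)
  \<comment> \<open>Both A / B and B / A are at most D, and the sign of e decides which of them is
    used; hence the absolute value in the exponent.\<close>
  have "(A / B) powr e \<le> D powr \<bar>e\<bar>"
  proof (cases "e \<ge> 0")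
    case True
    have "A / B \<le> D" using assms by (simp add: field_simps)
    then show ?thesis using True assms by (simp add: powr_mono2)
  next
    case False
    have "B / A \<le> D" using assms by (simp add: field_simps)
    then have "(B / A) powr - e \<le> D powr - e" using False assms by (intro powr_mono2) auto
    moreover have "(B / A) powr - e = (A / B) powr e"
      using assms by (simp add: powr_minus_divide powr_divide)
    ultimately show ?thesis using False by simp
  qed
  then show ?thesis using assms by (simp add: powr_divide field_simps)
qed

text \<open>Peetre's inequality in product form, with separate factors for the two coordinates so
  that it matches the product decay of the kernel.\<close>

lemma peetre:
  fixes x y u v :: real
  shows "1 + x\<^sup>2 + y\<^sup>2 \<le> 2 * ((1 + (x - u)\<^sup>2) * (1 + (y - v)\<^sup>2)) * (1 + u\<^sup>2 + v\<^sup>2)"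
proof -
  \<comment> \<open>The difference of the two sides is the square of x - 2 u, respectively y - 2
    v.\<close>
  have 1: "x\<^sup>2 \<le> 2 * (x - u)\<^sup>2 + 2 * u\<^sup>2" "y\<^sup>2 \<le> 2 * (y - v)\<^sup>2 + 2 * v\<^sup>2"
    using zero_le_power2[of "x - 2 * u"] zero_le_power2[of "y - 2 * v"]
    by (simp_all add: power2_eq_square algebra_simps)
  let ?p = "(x - u)\<^sup>2" and ?q = "(y - v)\<^sup>2" and ?w = "u\<^sup>2 + v\<^sup>2"
  have "1 + x\<^sup>2 + y\<^sup>2 \<le> 2 * (1 + ?p + ?q + ?w)" using 1 by simp
  also have "\<dots> \<le> 2 * (1 + ?p + ?q + ?w + (?p * ?q + (?p + ?q + ?p * ?q) * ?w))"
    by (simp add: add_nonneg_nonneg)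
  also have "\<dots> = 2 * ((1 + ?p) * (1 + ?q)) * (1 + u\<^sup>2 + v\<^sup>2)"
    by (simp add: algebra_simps)
  finally show ?thesis .
qed

lemma v_weight_moderate:
  "v_weight l x y \<le> v_weight l u v * (2 * ((1 + (x - u)\<^sup>2) * (1 + (y - v)\<^sup>2))) powr (\<bar>l\<bar> / 2)"
proof -
  have "(1 + x\<^sup>2 + y\<^sup>2) powr (l / 2) \<le>
      (1 + u\<^sup>2 + v\<^sup>2) powr (l / 2) * (2 * ((1 + (x - u)\<^sup>2) * (1 + (y - v)\<^sup>2))) powr \<bar>l / 2\<bar>"
  proof (rule powr_comparable)
    show "1 + u\<^sup>2 + v\<^sup>2 \<le> 2 * ((1 + (x - u)\<^sup>2) * (1 + (y - v)\<^sup>2)) * (1 + x\<^sup>2 + y\<^sup>2)"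
      using peetre[of u v x y] by (simp only: power2_commute)
  qed (rule peetre add_pos_nonneg zero_less_one zero_le_power2)+
  then show ?thesis by (simp add: v_weight_def)
qed

text \<open>Of the M + 1 available powers of decay, M compensate the cost of moving the weight from
  z to w, and the remaining one is the Cauchy kernel.\<close>

lemma v_weight_kernel:
  assumes M: "\<bar>l\<bar> / 2 \<le> real M"
  shows "v_weight l (fst z) (snd z) / ((1 + (fst z - fst w)\<^sup>2) ^ Suc M * (1 + (snd z - snd w)\<^sup>2) ^ Suc M) \<le>
    2 powr (\<bar>l\<bar> / 2) * (v_weight l (fst w) (snd w) * cauchy_kernel z w)"
proof -
  let ?P = "1 + (fst z - fst w)\<^sup>2" and ?Q = "1 + (snd z - snd w)\<^sup>2"
  have cancel: "a * (b * R ^ M) / R ^ Suc M = b * (a * (1 / R))" if "0 < R" for a b R :: real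
    using that by simp
  have ge1: "1 \<le> ?P" "1 \<le> ?Q" by simp_all
  then have PQ1: "1 \<le> ?P * ?Q" using mult_mono[of 1 ?P 1 ?Q] by simp
  then have PQ: "0 < ?P * ?Q" by linarith
  have "(?P * ?Q) powr (\<bar>l\<bar> / 2) \<le> (?P * ?Q) powr real M"
    by (rule powr_mono[OF M PQ1])
  also have "\<dots> = (?P * ?Q) ^ M" by (rule powr_realpow[OF PQ])
  finally have "2 powr (\<bar>l\<bar> / 2) * (?P * ?Q) powr (\<bar>l\<bar> / 2) \<le> 2 powr (\<bar>l\<bar> / 2) * (?P * ?Q) ^ M"
    by (intro mult_left_mono) simp_all
  then have "(2 * (?P * ?Q)) powr (\<bar>l\<bar> / 2) \<le> 2 powr (\<bar>l\<bar> / 2) * (?P * ?Q) ^ M"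
    using PQ by (subst powr_mult) auto
  then have "v_weight l (fst z) (snd z) \<le> v_weight l (fst w) (snd w) * (2 powr (\<bar>l\<bar> / 2) * (?P * ?Q) ^ M)"
    using v_weight_pos[of l "fst w" "snd w"]
    by (intro order_trans[OF v_weight_moderate[of l _ _ "fst w" "snd w"]] mult_left_mono) auto
  then have "v_weight l (fst z) (snd z) / (?P * ?Q) ^ Suc M \<le>
      v_weight l (fst w) (snd w) * (2 powr (\<bar>l\<bar> / 2) * (?P * ?Q) ^ M) / (?P * ?Q) ^ Suc M"
    using PQ by (intro divide_right_mono) auto
  also have "\<dots> = 2 powr (\<bar>l\<bar> / 2) * (v_weight l (fst w) (snd w) * (1 / (?P * ?Q)))"
    by (rule cancel[OF PQ])
  moreover have "cauchy_kernel z w = 1 / (?P * ?Q)"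
    by (simp add: cauchy_kernel_def)
  ultimately show ?thesis
    by (simp only: power_mult_distrib)
qed

text \<open>For a function that is not integrable the Bochner integral has the default value 0, so
  the bound holds for every f.\<close>

lemma ennreal_norm_integral_le: "ennreal (norm (\<integral>x. f x \<partial>M)) \<le> (\<integral>\<^sup>+x. ennreal (norm (f x)) \<partial>M)"
  for f :: "'a \<Rightarrow> complex"
  by (cases "integrable M f") (auto simp: integral_norm_bound_ennreal not_integrable_integral_eq)

text \<open>By continuity g is nonzero on an open neighbourhood of \<open>t0\<close>, which is not
  negligible. Positivity allows the reconstruction formula to be divided by this constant.\<close>

lemma integral_norm_square_pos:
  assumes g: "g \<in> schwartz" "g t0 \<noteq> 0"
  shows "0 < (\<integral>t. (norm (g t))\<^sup>2 \<partial>lborel)"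
proof -
  have int: "integrable lborel (\<lambda>t. (norm (g t))\<^sup>2)"
  proof -
    have "norm (g t * cnj (g t)) = (norm (g t))\<^sup>2" for t
      by (simp add: norm_mult power2_eq_square)
    then show ?thesis
      using integrable_norm[OF integrable_schwartz[OF schwartz_prod[OF g(1) schwartz_cnj[OF g(1)]]]] by simp
  qed
  have "(\<integral>t. (norm (g t))\<^sup>2 \<partial>lborel) \<noteq> 0"
  proof
    assume "(\<integral>t. (norm (g t))\<^sup>2 \<partial>lborel) = 0"
    then have "AE t in lborel. (norm (g t))\<^sup>2 = 0"
      using integral_nonneg_eq_0_iff_AE[OF int] by simp
    then have "AE t in lborel. t \<notin> {t. g t \<noteq> 0}"
      by simp
    moreover have op: "open {t. g t \<noteq> 0}"
      by (rule open_Collect_neq[OF schwartz_continuous[OF g(1)] continuous_on_const])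
    ultimately have "{t. g t \<noteq> 0} \<in> null_sets lborel"
      by (subst AE_iff_null_sets) auto
    then have "negligible {t. g t \<noteq> 0}"
      by (simp add: negligible_iff_null_sets null_sets_completionI)
    then show False
      using open_not_negligible[OF op] g(2) by blast
  qed
  moreover have "0 \<le> (\<integral>t. (norm (g t))\<^sup>2 \<partial>lborel)" by simp
  ultimately show ?thesis by linarith
qed

text \<open>The substitution t = y + u extracts a unimodular factor and leaves only the differences
  x - y and \<eta> - \<omega>. This is the source of the convolution structure.\<close>

lemma norm_fourier_tf_shift:
  "norm (fourier (\<lambda>t. g (t - x) * tf_shift y \<eta> h t) (- \<omega>)) = norm (fourier (\<lambda>t. g (t - (x - y)) * h t) (\<eta> - \<omega>))"
proof -
  let ?f = "\<lambda>t. g (t - x) * tf_shift y \<eta> h t * exp (- (\<i> * complex_of_real (2 * pi * (- \<omega>) * t)))"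
  have "fourier (\<lambda>t. g (t - x) * tf_shift y \<eta> h t) (- \<omega>) = (\<integral>u. ?f (y + 1 * u) \<partial>lborel)"
    using lborel_integral_real_affine[of 1 ?f y] by (simp add: fourier_def)
  also have "?f (y + 1 * u) = exp (- (\<i> * of_real (2 * pi * (\<eta> - \<omega>) * y))) *
      (g (u - (x - y)) * h u * exp (- (\<i> * complex_of_real (2 * pi * (\<eta> - \<omega>) * u))))" for u
  proof -
    have "g (y + 1 * u - x) = g (u - (x - y))" by (simp add: algebra_simps)
    then show ?thesis by (simp add: tf_shift_def algebra_simps flip: exp_add)
  qed
  then have "(\<integral>u. ?f (y + 1 * u) \<partial>lborel) =
      exp (- (\<i> * of_real (2 * pi * (\<eta> - \<omega>) * y))) * fourier (\<lambda>t. g (t - (x - y)) * h t) (\<eta> - \<omega>)"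
    by (simp only: fourier_def integral_mult_right_zero)
  finally show ?thesis
    by (simp only: norm_mult norm_cis mult_1_left)
qed

lemma stft_convolution_bound:
  assumes T: "T \<in> tempered" and g: "g \<in> schwartz" "g t0 \<noteq> 0" and h: "h \<in> schwartz"
  shows "\<exists>C\<ge>0. \<forall>z. ennreal (norm (stft h T (fst z) (snd z)) * v_weight l (fst z) (snd z)) \<le>
    (\<integral>\<^sup>+w. ennreal (C * (norm (stft g T (fst w) (snd w)) * v_weight l (fst w) (snd w)) * cauchy_kernel z w) \<partial>lborel)"
proof -
  define M where "M = nat \<lceil>\<bar>l\<bar> / 2\<rceil>"
  have M: "\<bar>l\<bar> / 2 \<le> real M" by (simp add: M_def real_nat_ceiling_ge)
  let ?N = "\<integral>t. (norm (g t))\<^sup>2 \<partial>lborel"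
  have N: "?N > 0" by (rule integral_norm_square_pos[OF g])
  have ch: "(\<lambda>t. cnj (h t)) \<in> schwartz" by (rule schwartz_cnj[OF h])
  obtain D where D: "D \<ge> 0" "\<And>s \<xi>. norm (fourier (\<lambda>t. g (t - s) * cnj (h t)) \<xi>) \<le> D / ((1 + s\<^sup>2) ^ Suc M * (1 + \<xi>\<^sup>2) ^ Suc M)"
    using schwartz2_fourier_decay[OF schwartz2_translate(1)[OF g(1) ch], of "Suc M"] by blast
  \<comment> \<open>D comes from the decay of the kernel, the power of 2 from Peetre's inequality,
    and the divisor from the reconstruction formula.\<close>
  define C where "C = D * 2 powr (\<bar>l\<bar> / 2) / ?N"
  have C: "C \<ge> 0" using D N by (simp add: C_def)
  have "ennreal (norm (stft h T y \<eta>) * v_weight l y \<eta>) \<le>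
    (\<integral>\<^sup>+w. ennreal (C * (norm (stft g T (fst w) (snd w)) * v_weight l (fst w) (snd w)) * cauchy_kernel (y, \<eta>) w) \<partial>lborel)"
    for y \<eta>
  proof -
    let ?\<phi> = "tf_shift y \<eta> (\<lambda>t. cnj (h t))"
    let ?f = "\<lambda>x \<omega>. stft g T x \<omega> * fourier (\<lambda>t. g (t - x) * ?\<phi> t) (- \<omega>)"
    let ?c = "v_weight l y \<eta> / ?N"
    have c: "?c \<ge> 0" using v_weight_pos[of l y \<eta>] N by simp
    have "of_real ?N * stft h T y \<eta> = (\<integral>x. (\<integral>\<omega>. ?f x \<omega> \<partial>lborel) \<partial>lborel)"
      unfolding stft_eq_tf_shift[of h] by (rule stft_reconstruction[OF T g(1) tf_shift_schwartz[OF ch]])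
    then have "norm (stft h T y \<eta>) * v_weight l y \<eta> = ?c * norm (\<integral>x. (\<integral>\<omega>. ?f x \<omega> \<partial>lborel) \<partial>lborel)"
      using N by (simp add: norm_mult flip: \<open>of_real ?N * stft h T y \<eta> = _\<close>)
    then have "ennreal (norm (stft h T y \<eta>) * v_weight l y \<eta>) =
        ennreal ?c * ennreal (norm (\<integral>x. (\<integral>\<omega>. ?f x \<omega> \<partial>lborel) \<partial>lborel))"
      using c by (simp only: ennreal_mult norm_ge_zero)
    also have "\<dots> \<le> ennreal ?c * (\<integral>\<^sup>+x. \<integral>\<^sup>+\<omega>. ennreal (norm (?f x \<omega>)) \<partial>lborel \<partial>lborel)"
      by (intro mult_left_mono order_trans[OF ennreal_norm_integral_le] nn_integral_mono ennreal_norm_integral_le) simp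
    also have "\<dots> \<le> ennreal ?c * (\<integral>\<^sup>+x. \<integral>\<^sup>+\<omega>. ennreal (norm (stft g T x \<omega>) *
        (D / ((1 + (y - x)\<^sup>2) ^ Suc M * (1 + (\<eta> - \<omega>)\<^sup>2) ^ Suc M))) \<partial>lborel \<partial>lborel)"
    proof (intro mult_left_mono nn_integral_mono ennreal_leI)
      fix x \<omega>
      show "norm (?f x \<omega>) \<le> norm (stft g T x \<omega>) * (D / ((1 + (y - x)\<^sup>2) ^ Suc M * (1 + (\<eta> - \<omega>)\<^sup>2) ^ Suc M))"
        unfolding norm_mult norm_fourier_tf_shift power2_commute[of y x] by (intro mult_left_mono D) simp
    qed simp
    also have "\<dots> = ennreal ?c * (\<integral>\<^sup>+w. ennreal (norm (stft g T (fst w) (snd w)) *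
        (D / ((1 + (y - fst w)\<^sup>2) ^ Suc M * (1 + (\<eta> - snd w)\<^sup>2) ^ Suc M))) \<partial>lborel)"
    proof -
      have [measurable]: "(\<lambda>w. stft g T (fst w) (snd w)) \<in> borel_measurable (borel \<Otimes>\<^sub>M borel)"
        unfolding borel_prod by (rule stft_measurable[OF T g(1) g])
      show ?thesis
        by (subst nn_integral_pair(1)[symmetric], unfold borel_prod[symmetric], measurable)
    qed
    also have "\<dots> = (\<integral>\<^sup>+w. ennreal ?c * ennreal (norm (stft g T (fst w) (snd w)) *
        (D / ((1 + (y - fst w)\<^sup>2) ^ Suc M * (1 + (\<eta> - snd w)\<^sup>2) ^ Suc M))) \<partial>lborel)"
    proof (rule nn_integral_cmult[symmetric])
      have [measurable]: "(\<lambda>w. stft g T (fst w) (snd w)) \<in> borel_measurable (borel \<Otimes>\<^sub>M borel)"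
        unfolding borel_prod by (rule stft_measurable[OF T g(1) g])
      have "(\<lambda>w. ennreal (norm (stft g T (fst w) (snd w)) *
        (D / ((1 + (y - fst w)\<^sup>2) ^ Suc M * (1 + (\<eta> - snd w)\<^sup>2) ^ Suc M)))) \<in> borel_measurable (borel \<Otimes>\<^sub>M borel)"
        by measurable
      then show "(\<lambda>w. ennreal (norm (stft g T (fst w) (snd w)) *
        (D / ((1 + (y - fst w)\<^sup>2) ^ Suc M * (1 + (\<eta> - snd w)\<^sup>2) ^ Suc M)))) \<in> borel_measurable lborel"
        unfolding borel_prod by (simp only: measurable_lborel2)
    qed
    also have "\<dots> \<le> (\<integral>\<^sup>+w. ennreal (C * (norm (stft g T (fst w) (snd w)) * v_weight l (fst w) (snd w)) * cauchy_kernel (y, \<eta>) w) \<partial>lborel)"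
    proof (intro nn_integral_mono)
      fix w
      let ?E = "(1 + (y - fst w)\<^sup>2) ^ Suc M * (1 + (\<eta> - snd w)\<^sup>2) ^ Suc M"
      let ?s = "norm (stft g T (fst w) (snd w))"
      have "?c * (?s * (D / ?E)) = (?s * D / ?N) * (v_weight l y \<eta> / ?E)"
        by simp
      also have "\<dots> \<le> (?s * D / ?N) * (2 powr (\<bar>l\<bar> / 2) * (v_weight l (fst w) (snd w) * cauchy_kernel (y, \<eta>) w))"
        using v_weight_kernel[OF M, of "(y, \<eta>)" w] D N by (intro mult_left_mono) auto
      also have "\<dots> = C * (?s * v_weight l (fst w) (snd w)) * cauchy_kernel (y, \<eta>) w"
        by (simp add: C_def)
      finally have "ennreal (?c * (?s * (D / ?E))) \<le> ennreal (C * (?s * v_weight l (fst w) (snd w)) * cauchy_kernel (y, \<eta>) w)"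
        by (rule ennreal_leI)
      then show "ennreal ?c * ennreal (?s * (D / ?E)) \<le> ennreal (C * (?s * v_weight l (fst w) (snd w)) * cauchy_kernel (y, \<eta>) w)"
        using c D by (subst ennreal_mult[symmetric]) auto
    qed
    finally show ?thesis .
  qed
  then have "\<forall>z. ennreal (norm (stft h T (fst z) (snd z)) * v_weight l (fst z) (snd z)) \<le>
    (\<integral>\<^sup>+w. ennreal (C * (norm (stft g T (fst w) (snd w)) * v_weight l (fst w) (snd w)) * cauchy_kernel z w) \<partial>lborel)"
    by simp
  with C show ?thesis by blast
qed

text \<open>The case L^r * L^1 of Young's inequality: Jensen at each z, then Tonelli, and finally
  the symmetry of the kernel, which gives it the same mass in z as in w.\<close>

theorem stft_window_change:
  assumes T: "T \<in> tempered" and g: "g \<in> schwartz" "g t0 \<noteq> 0" and h: "h \<in> schwartz" and r: "1 \<le> r"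
    and fin: "(\<integral>\<^sup>+w. ennreal ((norm (stft g T (fst w) (snd w)) * v_weight l (fst w) (snd w)) powr r) \<partial>lborel) < \<infinity>"
  shows "(\<integral>\<^sup>+z. ennreal ((norm (stft h T (fst z) (snd z)) * v_weight l (fst z) (snd z)) powr r) \<partial>lborel) < \<infinity>"
proof -
  define F where "F = (\<lambda>w. norm (stft g T (fst w) (snd w)) * v_weight l (fst w) (snd w))"
  let ?H = "\<lambda>z. norm (stft h T (fst z) (snd z)) * v_weight l (fst z) (snd z)"
  have F0: "0 \<le> F w" for w using v_weight_pos[of l "fst w" "snd w"] by (simp add: F_def)
  have H0: "0 \<le> ?H w" for w using v_weight_pos[of l "fst w" "snd w"] by simp
  have [measurable]: "F \<in> borel_measurable borel"
    unfolding F_def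
    by (rule borel_measurable_times[OF measurable_compose[OF stft_measurable[OF T g(1) g] borel_measurable_norm] v_weight_measurable])
  obtain C where C: "C \<ge> 0" "\<And>z. ennreal (?H z) \<le> (\<integral>\<^sup>+w. ennreal (C * F w * cauchy_kernel z w) \<partial>lborel)"
    using stft_convolution_bound[OF T g h, of l] unfolding F_def by blast
  \<comment> \<open>The kernel has mass pi^2 at every z, and Jensen's inequality contributes this
    mass to the power r - 1.\<close>
  let ?m = "(pi * pi) powr (r - 1)"
  have "(\<integral>\<^sup>+z. ennreal (?H z powr r) \<partial>lborel) \<le>
      (\<integral>\<^sup>+z. ennreal ?m * (\<integral>\<^sup>+w. ennreal ((C * F w) powr r * cauchy_kernel z w) \<partial>lborel) \<partial>lborel)"
  proof (intro nn_integral_mono)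
    show "ennreal (?H z powr r) \<le> ennreal ?m * (\<integral>\<^sup>+w. ennreal ((C * F w) powr r * cauchy_kernel z w) \<partial>lborel)" for z
      by (rule jensen_kernel[OF r _ _ _ cauchy_kernel_nonneg nn_integral_cauchy_kernel _ H0 C(2)])
        (use C(1) F0 in \<open>auto intro!: mult_nonneg_nonneg mult_pos_pos\<close>)
  qed
  also have "\<dots> = ennreal ?m * (\<integral>\<^sup>+z. (\<integral>\<^sup>+w. ennreal ((C * F w) powr r * cauchy_kernel z w) \<partial>lborel) \<partial>lborel)"
    by (intro nn_integral_cmult) measurable
  also have "(\<integral>\<^sup>+z. (\<integral>\<^sup>+w. ennreal ((C * F w) powr r * cauchy_kernel z w) \<partial>lborel) \<partial>lborel) =
      (\<integral>\<^sup>+w. (\<integral>\<^sup>+z. ennreal ((C * F w) powr r * cauchy_kernel z w) \<partial>lborel) \<partial>lborel)"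
    by (rule lborel_pair.Fubini'[symmetric]) measurable
  also have "\<dots> = (\<integral>\<^sup>+w. ennreal ((C powr r * (pi * pi)) * F w powr r) \<partial>lborel)"
  proof (intro nn_integral_cong)
    fix w
    have "(\<integral>\<^sup>+z. ennreal ((C * F w) powr r * cauchy_kernel z w) \<partial>lborel) =
        (\<integral>\<^sup>+z. ennreal ((C * F w) powr r) * ennreal (cauchy_kernel w z) \<partial>lborel)"
      using cauchy_kernel_nonneg by (simp add: ennreal_mult cauchy_kernel_commute[of _ w])
    also have "\<dots> = ennreal ((C * F w) powr r) * ennreal (pi * pi)"
      by (subst nn_integral_cmult) (simp_all add: nn_integral_cauchy_kernel)
    also have "\<dots> = ennreal ((C powr r * (pi * pi)) * F w powr r)"
      using C(1) F0[of w] by (simp add: powr_mult ennreal_mult mult_ac)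
    finally show "(\<integral>\<^sup>+z. ennreal ((C * F w) powr r * cauchy_kernel z w) \<partial>lborel) = ennreal ((C powr r * (pi * pi)) * F w powr r)" .
  qed
  also have "\<dots> = ennreal (C powr r * (pi * pi)) * (\<integral>\<^sup>+w. ennreal (F w powr r) \<partial>lborel)"
    by (subst nn_integral_cmult[symmetric]) (simp_all add: ennreal_mult)
  also have "ennreal ?m * \<dots> < \<infinity>"
    using fin by (simp add: F_def ennreal_mult_less_top)
  finally show ?thesis .
qed

section \<open>Covariance of the short-time Fourier transform\<close>

text \<open>Expanding t^2 around x turns the chirp of a shift into a shift of the chirped window
  with frequency \<omega> - s x, a shear of the time-frequency plane. The scalar z collects the
  phases of earlier operators, so that the rules for the elementary operators compose by
  rewriting.\<close>

lemma chirp_tf_shift: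
  "chirp s (\<lambda>t. z * tf_shift x \<omega> \<alpha> t) =
    (\<lambda>t. (z * exp (- (\<i> * of_real (pi * s * x\<^sup>2)))) * tf_shift x (\<omega> - s * x) (chirp s \<alpha>) t)"
proof
  fix t
  have "pi * s * t\<^sup>2 - 2 * pi * \<omega> * t = - (pi * s * x\<^sup>2) + pi * s * (t - x)\<^sup>2 - 2 * pi * (\<omega> - s * x) * t"
    by (simp add: power2_eq_square algebra_simps)
  then have "\<i> * complex_of_real (pi * s * t\<^sup>2 - 2 * pi * \<omega> * t) =
      \<i> * complex_of_real (- (pi * s * x\<^sup>2) + pi * s * (t - x)\<^sup>2 - 2 * pi * (\<omega> - s * x) * t)"
    by (rule arg_cong)
  then have "\<i> * complex_of_real (pi * s * t\<^sup>2) + - (\<i> * of_real (2 * pi * \<omega> * t)) =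
      - (\<i> * of_real (pi * s * x\<^sup>2)) + \<i> * of_real (pi * s * (t - x)\<^sup>2) + - (\<i> * of_real (2 * pi * (\<omega> - s * x) * t))"
    unfolding of_real_diff[of "pi * s * t\<^sup>2"] of_real_diff[of "- (pi * s * x\<^sup>2) + pi * s * (t - x)\<^sup>2"]
      of_real_add of_real_minus by (simp only: right_diff_distrib[of \<i>] distrib_left[of \<i>] mult_minus_right diff_conv_add_uminus)
  then have "exp (\<i> * complex_of_real (pi * s * t\<^sup>2)) * exp (- (\<i> * of_real (2 * pi * \<omega> * t))) =
      exp (- (\<i> * of_real (pi * s * x\<^sup>2))) * exp (\<i> * of_real (pi * s * (t - x)\<^sup>2)) * exp (- (\<i> * of_real (2 * pi * (\<omega> - s * x) * t)))"
    by (simp only: exp_add[symmetric])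
  then show "chirp s (\<lambda>t. z * tf_shift x \<omega> \<alpha> t) t =
      (z * exp (- (\<i> * of_real (pi * s * x\<^sup>2)))) * tf_shift x (\<omega> - s * x) (chirp s \<alpha>) t"
    unfolding chirp_def tf_shift_def by algebra
qed

lemma modulate_tf_shift: "modulate s (\<lambda>t. z * tf_shift x \<omega> \<alpha> t) = (\<lambda>t. z * tf_shift x (\<omega> - s) \<alpha> t)"
  by (auto simp: modulate_def tf_shift_def algebra_simps simp flip: exp_add)

lemma dilate_tf_shift:
  "s \<noteq> 0 \<Longrightarrow> dilate s (\<lambda>t. z * tf_shift x \<omega> \<alpha> t) = (\<lambda>t. z * tf_shift (s * x) (\<omega> / s) (dilate s \<alpha>) t)"
  by (auto simp: dilate_def tf_shift_def diff_divide_distrib)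

text \<open>The substitution t = x + u shows that the Fourier transform acts on the time-frequency
  plane as a quarter turn.\<close>

lemma fourier_tf_shift:
  "fourier (\<lambda>t. z * tf_shift x \<omega> \<alpha> t) =
    (\<lambda>t. (z * exp (- (\<i> * of_real (2 * pi * \<omega> * x)))) * tf_shift (- \<omega>) x (fourier \<alpha>) t)"
proof
  fix \<xi>
  let ?f = "\<lambda>t. tf_shift x \<omega> \<alpha> t * exp (- (\<i> * complex_of_real (2 * pi * \<xi> * t)))"
  let ?c = "exp (- (\<i> * complex_of_real (2 * pi * \<omega> * x))) * exp (- (\<i> * of_real (2 * pi * x * \<xi>)))"
  have "fourier (tf_shift x \<omega> \<alpha>) \<xi> = (\<integral>t. ?f (x + 1 * t) \<partial>lborel)"
    using lborel_integral_real_affine[of 1 ?f x] by (simp add: fourier_def)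
  also have "?f (x + 1 * t) = ?c * (\<alpha> t * exp (- (\<i> * complex_of_real (2 * pi * (\<xi> + \<omega>) * t))))" for t
    by (simp add: tf_shift_def algebra_simps flip: exp_add)
  then have "(\<integral>t. ?f (x + 1 * t) \<partial>lborel) = ?c * fourier \<alpha> (\<xi> + \<omega>)"
    by (simp only: fourier_def integral_mult_right_zero)
  finally have F: "fourier (tf_shift x \<omega> \<alpha>) \<xi> = ?c * fourier \<alpha> (\<xi> + \<omega>)" .
  show "fourier (\<lambda>t. z * tf_shift x \<omega> \<alpha> t) \<xi> =
      (z * exp (- (\<i> * of_real (2 * pi * \<omega> * x)))) * tf_shift (- \<omega>) x (fourier \<alpha>) \<xi>"
    unfolding fourier_cmult F by (simp add: tf_shift_def)
qed

lemma saft_apply: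
  "saft a b c d p q T \<phi> = T (modulate (p / b) (chirp (a / b) (fourier (dilate (1 / b)
    (modulate ((b * q - d * p) / b) (chirp (d / b) \<phi>))))))"
  by (simp add: saft_def chirp_dist_def modulate_dist_def dilate_dist_def fourier_dist_def)

text \<open>The transposed factors act on (x, \<omega>) by a shear, a frequency shift, a scaling, a
  quarter turn, a second shear and a second frequency shift. Their composite has as linear part the
  inverse of the matrix with rows (a, b) and (c, d).\<close>

lemma stft_saft:
  assumes T: "T \<in> tempered" and g: "g \<in> schwartz" and b: "b \<noteq> 0" and det: "a * d - b * c = 1"
  shows "\<exists>h\<in>schwartz. \<exists>x0 \<omega>0. \<forall>x \<omega>. norm (stft g (saft a b c d p q T) x \<omega>) =
    norm (stft h T (d * x - b * \<omega> + x0) (a * \<omega> - c * x + \<omega>0))"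
proof -
  \<comment> \<open>The two modulations are absent because they change only the frequency of a shift
    and not its window. The window h is the conjugate of \<alpha>, since \<open>stft\<close>
    conjugates its window.\<close>
  define \<alpha> where "\<alpha> = chirp (a / b) (fourier (dilate (1 / b) (chirp (d / b) (\<lambda>t. cnj (g t)))))"
  have \<alpha>: "\<alpha> \<in> schwartz"
    unfolding \<alpha>_def using b
    by (intro contop_schwartz[OF contop_chirp] contop_schwartz[OF contop_fourier] contop_schwartz[OF contop_dilate]
        schwartz_cnj g) simp
  define m where "m = (b * q - d * p) / b"
  have "norm (stft g (saft a b c d p q T) x \<omega>) =
    norm (stft (\<lambda>t. cnj (\<alpha> t)) T (d * x - b * \<omega> + b * m) (a * \<omega> - c * x + (- a * m - p / b)))" for x \<omega>
  proof -
    define z where "z = exp (- (\<i> * complex_of_real (pi * (d / b) * x\<^sup>2)))"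
    \<comment> \<open>The frequency after chirp, modulation and dilation; the Fourier transform
      makes - \<omega>1 the new position.\<close>
    define \<omega>1 where "\<omega>1 = (\<omega> - d / b * x - m) / (1 / b)"
    define z' where "z' = exp (- (\<i> * complex_of_real (2 * pi * \<omega>1 * (1 / b * x))))"
    define z'' where "z'' = exp (- (\<i> * complex_of_real (pi * (a / b) * (- \<omega>1)\<^sup>2)))"
    let ?X = "- \<omega>1" and ?W = "1 / b * x - a / b * - \<omega>1 - p / b"
    have b': "1 / b \<noteq> 0" using b by simp
    have "stft g (saft a b c d p q T) x \<omega> = T (modulate (p / b) (chirp (a / b) (fourier (dilate (1 / b)
        (modulate m (chirp (d / b) (\<lambda>t. 1 * tf_shift x \<omega> (\<lambda>t. cnj (g t)) t)))))))"
      by (simp add: stft_eq_tf_shift saft_apply m_def)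
    also have "chirp (d / b) (\<lambda>t. 1 * tf_shift x \<omega> (\<lambda>t. cnj (g t)) t) =
        (\<lambda>t. z * tf_shift x (\<omega> - d / b * x) (chirp (d / b) (\<lambda>t. cnj (g t))) t)"
      using chirp_tf_shift[of "d / b" 1] by (simp add: z_def)
    also have "T (modulate (p / b) (chirp (a / b) (fourier (dilate (1 / b) (modulate m
        (\<lambda>t. z * tf_shift x (\<omega> - d / b * x) (chirp (d / b) (\<lambda>t. cnj (g t))) t)))))) =
        T (\<lambda>t. (z * z' * z'') * tf_shift ?X ?W \<alpha> t)"
      unfolding modulate_tf_shift dilate_tf_shift[OF b'] fourier_tf_shift
        chirp_tf_shift[of "a / b"] \<alpha>_def z'_def z''_def \<omega>1_def ..
    also have "\<dots> = (z * z' * z'') * T (tf_shift ?X ?W \<alpha>)"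
      by (rule tempered_cmult[OF T tf_shift_schwartz[OF \<alpha>]])
    finally have "norm (stft g (saft a b c d p q T) x \<omega>) = norm (T (tf_shift ?X ?W \<alpha>))"
      by (simp only: norm_mult z_def z'_def z''_def norm_cis mult_1_left)
    moreover have "?X = d * x - b * \<omega> + b * m"
      using b by (simp add: \<omega>1_def algebra_simps)
    moreover have "?W = a * \<omega> - c * x + (- a * m - p / b)"
    proof -
      \<comment> \<open>After multiplication by b the coefficient of x is 1 - a d, which the
        determinant condition identifies as - b c, so that b can be cancelled.\<close>
      have "b * (1 / b * x - a / b * - \<omega>1) = x * (1 - a * d) + b * (a * \<omega> - a * m)"
        using b by (simp add: \<omega>1_def algebra_simps)
      also have "\<dots> = b * (a * \<omega> - c * x - a * m)"
        using det by (simp add: algebra_simps)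
      finally have "1 / b * x - a / b * - \<omega>1 = a * \<omega> - c * x - a * m"
        using b by simp
      then show ?thesis by simp
    qed
    ultimately show ?thesis
      by (simp only: stft_eq_tf_shift complex_cnj_cnj)
  qed
  then show ?thesis using schwartz_cnj[OF \<alpha>] by blast
qed

text \<open>The plane substitution is carried out as two one-dimensional ones, \<omega> to u for
  fixed x and then x to y for fixed u. Each contributes a factor |b|, and these cancel.\<close>

lemma nn_integral_unimodular:
  fixes G :: "real \<times> real \<Rightarrow> ennreal"
  assumes G: "G \<in> borel_measurable borel" and b: "b \<noteq> 0" and det: "a * d - b * c = 1"
    and fin: "(\<integral>\<^sup>+z. G z \<partial>lborel) < \<infinity>"
  shows "(\<integral>\<^sup>+\<omega>. \<integral>\<^sup>+x. G (d * x - b * \<omega> + x0, a * \<omega> - c * x + \<omega>0) \<partial>lborel \<partial>lborel) < \<infinity>"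
proof -
  \<comment> \<open>The second argument of G is a \<omega> - c x + \<omega>0 expressed through x and
    u = d x - b \<omega> + x0, using a d - b c = 1.\<close>
  let ?g = "\<lambda>x u. G (u, (x - a * u + a * x0) / b + \<omega>0)"
  have [measurable]: "G \<in> borel_measurable (borel \<Otimes>\<^sub>M borel)"
    using G by (simp add: borel_prod)
  have swap: "(\<integral>\<^sup>+y. \<integral>\<^sup>+x. f x y \<partial>lborel \<partial>lborel) = (\<integral>\<^sup>+x. \<integral>\<^sup>+y. f x y \<partial>lborel \<partial>lborel)"
    if "(\<lambda>z. f (fst z) (snd z)) \<in> borel_measurable (borel \<Otimes>\<^sub>M borel)" for f :: "real \<Rightarrow> real \<Rightarrow> ennreal"
    using nn_integral_pair[of "\<lambda>z. f (fst z) (snd z)"] that by (simp add: borel_prod)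
  have "ennreal \<bar>b\<bar> * (\<integral>\<^sup>+\<omega>. \<integral>\<^sup>+x. G (d * x - b * \<omega> + x0, a * \<omega> - c * x + \<omega>0) \<partial>lborel \<partial>lborel) =
      ennreal \<bar>b\<bar> * (\<integral>\<^sup>+x. \<integral>\<^sup>+\<omega>. G (d * x - b * \<omega> + x0, a * \<omega> - c * x + \<omega>0) \<partial>lborel \<partial>lborel)"
    by (subst swap) measurable
  also have "\<dots> = (\<integral>\<^sup>+x. ennreal \<bar>b\<bar> * (\<integral>\<^sup>+\<omega>. G (d * x - b * \<omega> + x0, a * \<omega> - c * x + \<omega>0) \<partial>lborel) \<partial>lborel)"
    by (intro nn_integral_cmult[symmetric]) measurable
  also have "\<dots> = (\<integral>\<^sup>+x. (\<integral>\<^sup>+u. ?g x u \<partial>lborel) \<partial>lborel)"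
  proof (intro nn_integral_cong)
    fix x
    have sub: "(\<integral>\<^sup>+u. ?g x u \<partial>lborel) = ennreal \<bar>- b\<bar> * (\<integral>\<^sup>+\<omega>. ?g x ((d * x + x0) + - b * \<omega>) \<partial>lborel)"
      by (rule nn_integral_real_affine) (use b in \<open>measurable, simp\<close>)
    have "?g x ((d * x + x0) + - b * \<omega>) = G (d * x - b * \<omega> + x0, a * \<omega> - c * x + \<omega>0)" for \<omega>
    proof -
      have "x - a * ((d * x + x0) + - b * \<omega>) + a * x0 = x * (1 - a * d) + a * (b * \<omega>)"
        by (simp add: algebra_simps)
      also have "\<dots> = b * (a * \<omega> - c * x)"
        using det by (simp add: algebra_simps)
      finally have "(x - a * ((d * x + x0) + - b * \<omega>) + a * x0) / b = a * \<omega> - c * x"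
        using b by simp
      moreover have "(d * x + x0) + - b * \<omega> = d * x - b * \<omega> + x0" by simp
      ultimately show ?thesis by (simp only:)
    qed
    then show "ennreal \<bar>b\<bar> * (\<integral>\<^sup>+\<omega>. G (d * x - b * \<omega> + x0, a * \<omega> - c * x + \<omega>0) \<partial>lborel) = (\<integral>\<^sup>+u. ?g x u \<partial>lborel)"
      unfolding sub by (simp only: abs_minus_cancel)
  qed
  also have "\<dots> = (\<integral>\<^sup>+u. (\<integral>\<^sup>+x. ?g x u \<partial>lborel) \<partial>lborel)"
    by (subst swap) measurable
  also have "\<dots> = (\<integral>\<^sup>+u. ennreal \<bar>b\<bar> * (\<integral>\<^sup>+y. G (u, y) \<partial>lborel) \<partial>lborel)"
  proof (intro nn_integral_cong)
    fix u
    have "(\<lambda>x. ?g x u) \<in> borel_measurable borel"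
      by measurable
    then have sub: "(\<integral>\<^sup>+x. ?g x u \<partial>lborel) = ennreal \<bar>b\<bar> * (\<integral>\<^sup>+y. ?g ((a * u - a * x0 - b * \<omega>0) + b * y) u \<partial>lborel)"
      using b by (rule nn_integral_real_affine)
    have "?g ((a * u - a * x0 - b * \<omega>0) + b * y) u = G (u, y)" for y
      using b by (simp add: diff_divide_distrib)
    then show "(\<integral>\<^sup>+x. ?g x u \<partial>lborel) = ennreal \<bar>b\<bar> * (\<integral>\<^sup>+y. G (u, y) \<partial>lborel)"
      unfolding sub by (simp only:)
  qed
  also have "\<dots> = ennreal \<bar>b\<bar> * (\<integral>\<^sup>+u. \<integral>\<^sup>+y. G (u, y) \<partial>lborel \<partial>lborel)"
    by (intro nn_integral_cmult) measurable
  also have "\<dots> = ennreal \<bar>b\<bar> * (\<integral>\<^sup>+z. G z \<partial>lborel)"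
    by (simp only: nn_integral_pair(1)[OF G])
  also have "\<dots> < \<infinity>"
    using fin by (simp add: ennreal_mult_less_top)
  finally show ?thesis
    using b by (auto simp: ennreal_mult_less_top)
qed

section \<open>Boundedness between the weighted modulation spaces\<close>

lemma w_weight_eq: 
  "w_weight a b c d l x \<omega> = v_weight l (d * x - b * \<omega>) (a * \<omega> - c * x)"
proof -
  have "1 + (c\<^sup>2 + d\<^sup>2) * x\<^sup>2 + (a\<^sup>2 + b\<^sup>2) * \<omega>\<^sup>2 - 2 * (a * c + b * d) * x * \<omega> =
      1 + (d * x - b * \<omega>)\<^sup>2 + (a * \<omega> - c * x)\<^sup>2"
    by (simp add: power2_eq_square algebra_simps)
  then show ?thesis by (simp only: w_weight_def v_weight_def)
qed

theorem theorem4p8: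
  fixes a b c d p q r l :: real
    and g :: "real \<Rightarrow> complex"
    and f :: functional
  assumes "a * d - b * c = 1" and "b \<noteq> 0"
    and "1 \<le> r"
    and "g \<in> schwartz" and "g \<noteq> (\<lambda>t. 0)"
    and "f \<in> modulation_space g r (v_weight l)"
  shows "saft a b c d p q f \<in> modulation_space g r (w_weight a b c d l)"
proof -
  have f: "f \<in> tempered"
    and fin: "(\<integral>\<^sup>+\<omega>. \<integral>\<^sup>+x. ennreal (norm (stft g f x \<omega>) powr r * v_weight l x \<omega> powr r) \<partial>lborel \<partial>lborel) < \<infinity>"
    using assms(6) by (auto simp: modulation_space_def)
  obtain t0 where t0: "g t0 \<noteq> 0" using assms(5) by auto
  have meas: "(\<lambda>w. ennreal ((norm (stft h f (fst w) (snd w)) * v_weight l (fst w) (snd w)) powr r)) \<in> borel_measurable borel"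
    if "h \<in> schwartz" for h
    using borel_measurable_times[OF measurable_compose[OF stft_measurable[OF f that assms(4) t0] borel_measurable_norm] v_weight_measurable[of l]]
    by (rule measurable_compose) measurable
  have pos: "0 \<le> v_weight l x \<omega>" for x \<omega>
    using v_weight_pos[of l x \<omega>] by simp
  obtain h x0 \<omega>0 where h: "h \<in> schwartz" and eq: "\<And>x \<omega>. norm (stft g (saft a b c d p q f) x \<omega>) =
      norm (stft h f (d * x - b * \<omega> + x0) (a * \<omega> - c * x + \<omega>0))"
    using stft_saft[OF f assms(4,2,1)] by blast
  let ?G = "\<lambda>z. ennreal ((norm (stft h f (fst z) (snd z)) * v_weight l (fst z) (snd z)) powr r)"
  have "(\<integral>\<^sup>+z. ennreal ((norm (stft g f (fst z) (snd z)) * v_weight l (fst z) (snd z)) powr r) \<partial>lborel) < \<infinity>"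
    using fin unfolding nn_integral_pair(2)[OF meas[OF assms(4)], symmetric] by (simp add: powr_mult)
  then have "(\<integral>\<^sup>+z. ?G z \<partial>lborel) < \<infinity>"
    by (rule stft_window_change[OF f assms(4) t0 h assms(3)])
  then have G: "(\<integral>\<^sup>+\<omega>. \<integral>\<^sup>+x. ?G (d * x - b * \<omega> + x0, a * \<omega> - c * x + \<omega>0) \<partial>lborel \<partial>lborel) < \<infinity>"
    by (rule nn_integral_unimodular[OF meas[OF h] assms(2,1)])
  \<comment> \<open>\<open>w_weight\<close> is the weight at the linear image of (x, \<omega>),
    whereas the covariance formula evaluates at the image displaced by (x0, \<omega>0). Moderateness
    bounds the ratio of the two weights by this constant, up to the power r.\<close>
  define K where "K = ((2 * ((1 + x0\<^sup>2) * (1 + \<omega>0\<^sup>2))) powr (\<bar>l\<bar> / 2)) powr r"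
  have "norm (stft g (saft a b c d p q f) x \<omega>) powr r * w_weight a b c d l x \<omega> powr r \<le>
      K * (norm (stft h f (d * x - b * \<omega> + x0) (a * \<omega> - c * x + \<omega>0)) * v_weight l (d * x - b * \<omega> + x0) (a * \<omega> - c * x + \<omega>0)) powr r"
    for x \<omega>
  proof -
    have "w_weight a b c d l x \<omega> \<le> v_weight l (d * x - b * \<omega> + x0) (a * \<omega> - c * x + \<omega>0) *
        (2 * ((1 + x0\<^sup>2) * (1 + \<omega>0\<^sup>2))) powr (\<bar>l\<bar> / 2)"
      unfolding w_weight_eq
      using v_weight_moderate[of l "d * x - b * \<omega>" "a * \<omega> - c * x" "d * x - b * \<omega> + x0" "a * \<omega> - c * x + \<omega>0"] by simp
    then have "w_weight a b c d l x \<omega> powr r \<le> v_weight l (d * x - b * \<omega> + x0) (a * \<omega> - c * x + \<omega>0) powr r * K"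
      using assms(3) pos unfolding K_def by (subst powr_mult[symmetric]) (auto intro!: powr_mono2 simp: w_weight_eq)
    then have "norm (stft h f (d * x - b * \<omega> + x0) (a * \<omega> - c * x + \<omega>0)) powr r * w_weight a b c d l x \<omega> powr r \<le>
        norm (stft h f (d * x - b * \<omega> + x0) (a * \<omega> - c * x + \<omega>0)) powr r *
        (v_weight l (d * x - b * \<omega> + x0) (a * \<omega> - c * x + \<omega>0) powr r * K)"
      by (intro mult_left_mono powr_ge_zero)
    then show ?thesis
      unfolding eq powr_mult by (simp only: mult_ac)
  qed
  then have "(\<integral>\<^sup>+\<omega>. \<integral>\<^sup>+x. ennreal (norm (stft g (saft a b c d p q f) x \<omega>) powr r * w_weight a b c d l x \<omega> powr r) \<partial>lborel \<partial>lborel) \<le>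
      (\<integral>\<^sup>+\<omega>. \<integral>\<^sup>+x. ennreal K * ?G (d * x - b * \<omega> + x0, a * \<omega> - c * x + \<omega>0) \<partial>lborel \<partial>lborel)"
    by (intro nn_integral_mono) (simp add: K_def flip: ennreal_mult)
  also have "\<dots> = ennreal K * (\<integral>\<^sup>+\<omega>. \<integral>\<^sup>+x. ?G (d * x - b * \<omega> + x0, a * \<omega> - c * x + \<omega>0) \<partial>lborel \<partial>lborel)"
  proof -
    have cmult: "(\<integral>\<^sup>+\<omega>. \<integral>\<^sup>+x. ennreal K * G (d * x - b * \<omega> + x0, a * \<omega> - c * x + \<omega>0) \<partial>lborel \<partial>lborel) =
        ennreal K * (\<integral>\<^sup>+\<omega>. \<integral>\<^sup>+x. G (d * x - b * \<omega> + x0, a * \<omega> - c * x + \<omega>0) \<partial>lborel \<partial>lborel)"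
      if [measurable]: "G \<in> borel_measurable (borel \<Otimes>\<^sub>M borel)" for G :: "real \<times> real \<Rightarrow> ennreal"
      by (subst nn_integral_cmult, measurable)+
    show ?thesis
      by (rule cmult[of ?G]) (use meas[OF h] in \<open>simp only: borel_prod\<close>)
  qed
  also have "\<dots> < \<infinity>"
    using G by (simp add: ennreal_mult_less_top)
  finally show ?thesis
    unfolding modulation_space_def using tempered_saft[OF f assms(2)] by simp
qed

end
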